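(* Let $T:\mathbb T\to\mathbb T$, $T(x)=x(1+V(x)) \bmod 1$, be a map in the family $\mathscr F$. Let $\omega,\Omega\in\mathcal M$ be such that $\Omega$ is $T$-compatible with respect to $\omega$, and let $f\in\mathscr C_\omega(\mathbb T)$. Let $\chi>0$, $\nu$ and $h$, with $\int h\,d\nu=1$, be the eigenvalue, eigenprobability and positive eigenfunction given by the Ruelle-Perron-Frobenius theorem for $\mathscr L_f$ (described in the context). Then the measure $\mu:=h\nu$ is a $T$-invariant probability such that $$h_\mu(T)+\int f\,d\mu=\log\chi=P(T,f).$$ For any $m\in M(\mathbb T,T)$ with $m\ne\mu$, one has $P(T,f)>h_m(T)+\int f\,dm$. In particular, $\mu$ is the unique equilibrium measure associated with $f$. Furthermore, $\mu$ is a Gibbs measure in the sense that, for every sufficiently small $r>0$, there is a constant $K_r>0$ such that, for all $x\in\mathbb T$ and $n\ge1$, $$K_r^{-1}\le\frac{\mu\big(\{y\in\mathbb T: d(T^j(x),T^j(y))<r,\ 0\le j\le n\}\big)}{e^{S_nf(x)-nP(T,f)}}\le K_r .$$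
   Context: $\mathbb T=\mathbb R/\mathbb Z=[0,1)$ is the circle with metric $d(x,y)=\min\{|x-y|,|x-y\pm1|\}$. Family $\mathscr F$: all continuous maps $T:\mathbb T\to\mathbb T$ of the form $T(x)=x(1+V(x))\bmod 1$ for $x\in[0,1)$, where $V:[0,+\infty)\to[0,+\infty)$ is continuous and increasing, $V(0)=0$ (so $0$ is an indifferent fixed point), $V(1)$ is a positive integer, and for some $\sigma\ge0$ one has $\lim_{x\to0}V(tx)/V(x)=t^\sigma$ for all $t>0$. $\mathcal M$ is the set of all concave moduli of continuity, i.e. concave, continuous, non-decreasing functions $\omega:[0,+\infty)\to[0,+\infty)$ with $\omega(0)=0$. For $\omega\in\mathcal M$, $\mathscr C_\omega(\mathbb T)$ is the linear space of functions $\varphi:\mathbb T\to\mathbb R$ for which there is $C>0$ with $|\varphi(x)-\varphi(y)|\le C\,\omega(d(x,y))$ for all $x,y\in\mathbb T$. $T$-compatibility: for $T\in\mathscr F$ and $\omega,\Omega\in\mathcal M$, $\Omega$ is $T$-compatible with respect to $\omega$ if there are constants $\varrho_1>0$ and $C_1>0$ such that, given any sequence $\{x_k\}_{k\ge0}$ in $\mathbb T$ with $T(x_{k+1})=x_k$ for $k\ge0$, and a point $y_0\in\mathbb T$ with $d(x_0,y_0)<\varrho_1$, there is a unique pre-orbit $\{y_k\}_{k\ge1}$ of $y_0$ (that is, $T(y_{k+1})=y_k$ for $k\ge0$) satisfying, for all $k\ge1$, $$d(x_k,y_k)\le d(x_0,y_0)<\varrho_1\quad\text{and}\quad \Omega(d(x_k,y_k))+C_1\sum_{j=1}^k\omega(d(x_j,y_j))\le\Omega(d(x_0,y_0));$$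 moreover, this correspondence between pre-orbits of $x_0$ and pre-orbits of $y_0$ is one-to-one. Transfer operator: for continuous $f:\mathbb T\to\mathbb R$, $\mathscr L_f\phi(x)=\sum_{y\in T^{-1}(x)}e^{f(y)}\phi(y)$ for $\phi\in C^0(\mathbb T)$. The dual $\mathscr L_f^*$ acts on finite signed Borel measures by $\int\phi\,d(\mathscr L_f^*m)=\int\mathscr L_f\phi\,dm$ for all $\phi\in C^0(\mathbb T)$. Birkhoff sums: $S_nf=\sum_{j=0}^{n-1}f\circ T^j$. Ruelle-Perron-Frobenius data: whenever $T\in\mathscr F$, $\omega,\Omega\in\mathcal M$ are such that $\Omega$ is $T$-compatible with respect to $\omega$, and $f\in\mathscr C_\omega(\mathbb T)$, there are $\chi>0$, a Borel probability $\nu$ on $\mathbb T$ and a positive $h\in\mathscr C_\Omega(\mathbb T)$ with $\mathscr L_f^*\nu=\chi\nu$, $\mathscr L_fh=\chi h$, $\int h\,d\nu=1$; $\chi$ is a simple eigenvalue of $\mathscr L_f$; $\mathscr L_f$ on complex-valued continuous functions has no other eigenvalue of absolute value $\ge\chi$; and for every continuous $\phi$, $\chi^{-n}\mathscr L_f^n\phi\to h\int\phi\,d\nu$ uniformly on $\mathbb T$. The measure $h\nu$ is the one with density $h$ with respect to $\nu$. $M(\mathbb T,T)$ is the set of $T$-invariant Borel probability measures, $h_m(T)$ is the metric (Kolmogorov-Sinai) entropy of $m$, and $P(T,f)=\sup_{m\in M(\mathbb T,T)}\{h_m(T)+\int f\,dm\}$ is the topological pressure. An equilibrium measure associated with $f$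 is an $m\in M(\mathbb T,T)$ attaining this supremum. *)

theory Defs
  imports "HOL-Probability.Probability"
begin

section \<open>The circle\<close>

typedef circle = "{0..<1::real}"
  morphisms coord Circle
  by (rule exI[of _ 0]) simp

instantiation circle :: metric_space
begin

definition dist_circle :: "circle \<Rightarrow> circle \<Rightarrow> real" where
  "dist_circle x y =
     Min {\<bar>coord x - coord y\<bar>, \<bar>coord x - coord y + 1\<bar>, \<bar>coord x - coord y - 1\<bar>}"

definition uniformity_circle :: "(circle \<times> circle) filter" where
  "uniformity_circle = (INF e\<in>{0<..}. principal {(x, y). dist x y < e})"

definition open_circle :: "circle set \<Rightarrow> bool" where
  "open_circle U \<longleftrightarrow> (\<forall>x\<in>U. eventually (\<lambda>(x', y). x' = x \<longrightarrow> y \<in> U) uniformity)"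

instance
proof
  fix x y z :: circle
  have bnd: "0 \<le> coord u \<and> coord u < 1" for u
    using coord[of u] by simp
  have eq: "dist u v = min \<bar>coord u - coord v\<bar>
      (min \<bar>coord u - coord v + 1\<bar> \<bar>coord u - coord v - 1\<bar>)" for u v :: circle
    by (simp add: dist_circle_def)
  show "dist x y = 0 \<longleftrightarrow> x = y"
    unfolding eq coord_inject[symmetric] using bnd[of x] bnd[of y] by linarith
  show "dist x y \<le> dist x z + dist y z"
    unfolding eq using bnd[of x] bnd[of y] bnd[of z] by (smt (verit))
qed (simp_all add: uniformity_circle_def open_circle_def)

end


section \<open>The family of maps and moduli of continuity\<close>

text \<open>
  \<open>frac\<close> is the reduction modulo 1. The limit for \<open>x \<rightarrow> 0\<close> is one-sided because \<open>V\<close>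
  lives on \<open>[0, \<infinity>)\<close>.
\<close>

definition map_family :: "(circle \<Rightarrow> circle) set" where
  "map_family = {T. continuous_on UNIV T \<and>
     (\<exists>V :: real \<Rightarrow> real.
        V \<in> {0..} \<rightarrow> {0..} \<and> continuous_on {0..} V \<and> mono_on {0..} V \<and> V 0 = 0 \<and>
        (\<exists>N::nat. 0 < N \<and> V 1 = real N) \<and>
        (\<exists>\<sigma>\<ge>0. \<forall>t>0. ((\<lambda>x. V (t * x) / V x) \<longlongrightarrow> t powr \<sigma>) (at_right 0)) \<and>
        (\<forall>x. coord (T x) = frac (coord x * (1 + V (coord x)))))}"

definition concave_moduli :: "(real \<Rightarrow> real) set" where
  "concave_moduli = {\<omega>. \<omega> \<in> {0..} \<rightarrow> {0..} \<and> concave_on {0..} \<omega> \<and> continuous_on {0..} \<omega> \<and>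
     mono_on {0..} \<omega> \<and> \<omega> 0 = 0}"

definition C_mod :: "(real \<Rightarrow> real) \<Rightarrow> (circle \<Rightarrow> real) set" where
  "C_mod \<omega> = {\<phi>. \<exists>C>0. \<forall>x y. \<bar>\<phi> x - \<phi> y\<bar> \<le> C * \<omega> (dist x y)}"


section \<open>Compatibility\<close>

definition pre_orbits :: "(circle \<Rightarrow> circle) \<Rightarrow> circle \<Rightarrow> (nat \<Rightarrow> circle) set" where
  "pre_orbits T x = {X. X 0 = x \<and> (\<forall>k. T (X (Suc k)) = X k)}"

definition contracts_along ::
    "(real \<Rightarrow> real) \<Rightarrow> (real \<Rightarrow> real) \<Rightarrow> real \<Rightarrow> (nat \<Rightarrow> circle) \<Rightarrow> (nat \<Rightarrow> circle) \<Rightarrow> bool" where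
  "contracts_along \<omega> \<Omega> C X Y \<longleftrightarrow> (\<forall>k\<ge>1.
     dist (X k) (Y k) \<le> dist (X 0) (Y 0) \<and>
     \<Omega> (dist (X k) (Y k)) + C * (\<Sum>j=1..k. \<omega> (dist (X j) (Y j))) \<le> \<Omega> (dist (X 0) (Y 0)))"

text \<open>
  The last conjunct says that the correspondence between pre-orbits of \<open>x\<close> and of \<open>y\<close>
  defined by the preceding one is one-to-one.
\<close>

definition compatible ::
    "(circle \<Rightarrow> circle) \<Rightarrow> (real \<Rightarrow> real) \<Rightarrow> (real \<Rightarrow> real) \<Rightarrow> bool" where
  "compatible T \<omega> \<Omega> \<longleftrightarrow> (\<exists>\<rho>>0. \<exists>C>0. \<forall>x y. dist x y < \<rho> \<longrightarrow>
     (\<forall>X\<in>pre_orbits T x. \<exists>!Y. Y \<in> pre_orbits T y \<and> contracts_along \<omega> \<Omega> C X Y) \<and>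
     (\<forall>Y\<in>pre_orbits T y. \<exists>!X. X \<in> pre_orbits T x \<and> contracts_along \<omega> \<Omega> C X Y))"


section \<open>Transfer operator and Ruelle-Perron-Frobenius data\<close>

text \<open>
  The value type is arbitrary so that the operator acts on real and on complex functions.
  Point preimages of members of the family are finite.
\<close>

definition transfer ::
    "(circle \<Rightarrow> circle) \<Rightarrow> (circle \<Rightarrow> real) \<Rightarrow> (circle \<Rightarrow> 'a::real_vector) \<Rightarrow> circle \<Rightarrow> 'a" where
  "transfer T f \<phi> x = (\<Sum>y\<in>T -` {x}. exp (f y) *\<^sub>R \<phi> y)"

definition borel_probability :: "circle measure \<Rightarrow> bool" where
  "borel_probability m \<longleftrightarrow> sets m = sets borel \<and> prob_space m"

text \<open>\<open>dual_transfer T f m m'\<close> expresses that the dual operator maps \<open>m\<close> to \<open>m'\<close>;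
  both are finite Borel measures, which determines \<open>m'\<close>.\<close>

definition dual_transfer ::
    "(circle \<Rightarrow> circle) \<Rightarrow> (circle \<Rightarrow> real) \<Rightarrow> circle measure \<Rightarrow> circle measure \<Rightarrow> bool" where
  "dual_transfer T f m m' \<longleftrightarrow>
     (\<forall>\<phi> :: circle \<Rightarrow> real. continuous_on UNIV \<phi> \<longrightarrow> (\<integral>x. \<phi> x \<partial>m') = (\<integral>x. transfer T f \<phi> x \<partial>m))"

definition transfer_eigenvalue :: "(circle \<Rightarrow> circle) \<Rightarrow> (circle \<Rightarrow> real) \<Rightarrow> complex \<Rightarrow> bool" where
  "transfer_eigenvalue T f z \<longleftrightarrow> (\<exists>\<phi> :: circle \<Rightarrow> complex.
     continuous_on UNIV \<phi> \<and> (\<exists>x. \<phi> x \<noteq> 0) \<and> transfer T f \<phi> = (\<lambda>x. z * \<phi> x))"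

text \<open>Simple means algebraically simple: the generalised eigenspace is one-dimensional.\<close>

definition simple_transfer_eigenvalue ::
    "(circle \<Rightarrow> circle) \<Rightarrow> (circle \<Rightarrow> real) \<Rightarrow> complex \<Rightarrow> bool" where
  "simple_transfer_eigenvalue T f z \<longleftrightarrow> (\<exists>\<phi>\<^sub>0 :: circle \<Rightarrow> complex.
     continuous_on UNIV \<phi>\<^sub>0 \<and> (\<exists>x. \<phi>\<^sub>0 x \<noteq> 0) \<and> transfer T f \<phi>\<^sub>0 = (\<lambda>x. z * \<phi>\<^sub>0 x) \<and>
     (\<forall>k \<phi>. continuous_on UNIV \<phi> \<and>
        ((\<lambda>\<psi> x. transfer T f \<psi> x - z * \<psi> x) ^^ k) \<phi> = (\<lambda>x. 0) \<longrightarrow>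
        (\<exists>c. \<phi> = (\<lambda>x. c * \<phi>\<^sub>0 x))))"

definition RPF_data ::
    "(circle \<Rightarrow> circle) \<Rightarrow> (real \<Rightarrow> real) \<Rightarrow> (circle \<Rightarrow> real) \<Rightarrow>
     real \<Rightarrow> circle measure \<Rightarrow> (circle \<Rightarrow> real) \<Rightarrow> bool" where
  "RPF_data T \<Omega> f \<kappa> \<nu> h \<longleftrightarrow>
     \<kappa> > 0 \<and> borel_probability \<nu> \<and> h \<in> C_mod \<Omega> \<and> (\<forall>x. h x > 0) \<and>
     dual_transfer T f \<nu> (scale_measure (ennreal \<kappa>) \<nu>) \<and>
     transfer T f h = (\<lambda>x. \<kappa> * h x) \<and>
     (\<integral>x. h x \<partial>\<nu>) = 1 \<and>
     simple_transfer_eigenvalue T f (of_real \<kappa>) \<and>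
     (\<forall>z. transfer_eigenvalue T f z \<and> z \<noteq> of_real \<kappa> \<longrightarrow> cmod z < \<kappa>) \<and>
     (\<forall>\<phi> :: circle \<Rightarrow> real. continuous_on UNIV \<phi> \<longrightarrow>
        uniform_limit UNIV (\<lambda>n x. (transfer T f ^^ n) \<phi> x / \<kappa> ^ n)
          (\<lambda>x. h x * (\<integral>y. \<phi> y \<partial>\<nu>)) sequentially)"


section \<open>Entropy, pressure and equilibrium measures\<close>

definition invariant_measures :: "(circle \<Rightarrow> circle) \<Rightarrow> circle measure set" where
  "invariant_measures T =
     {m. borel_probability m \<and> T \<in> measurable m m \<and> distr m m T = m}"

definition finite_partitions :: "circle measure \<Rightarrow> circle set set set" where
  "finite_partitions m = {\<xi>. finite \<xi> \<and> \<xi> \<subseteq> sets m \<and> partition_on (space m) \<xi>}"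

text \<open>Atoms of measure zero contribute zero, since \<open>0 * ln 0 = 0\<close>.\<close>

definition partition_entropy :: "circle measure \<Rightarrow> circle set set \<Rightarrow> real" where
  "partition_entropy m \<xi> = - (\<Sum>A\<in>\<xi>. measure m A * ln (measure m A))"

text \<open>The common refinement of \<open>T\<^sup>-\<^sup>j \<xi>\<close> for \<open>j < n\<close>.\<close>

definition iterated_join ::
    "(circle \<Rightarrow> circle) \<Rightarrow> nat \<Rightarrow> circle set set \<Rightarrow> circle set set" where
  "iterated_join T n \<xi> = {\<Inter>j<n. (T ^^ j) -` A j | A. \<forall>j<n. A j \<in> \<xi>} - {{}}"

definition entropy_wrt ::
    "circle measure \<Rightarrow> (circle \<Rightarrow> circle) \<Rightarrow> circle set set \<Rightarrow> ereal" where
  "entropy_wrt m T \<xi> = lim (\<lambda>n. ereal (partition_entropy m (iterated_join T n \<xi>) / real n))"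

definition KS_entropy :: "circle measure \<Rightarrow> (circle \<Rightarrow> circle) \<Rightarrow> ereal" where
  "KS_entropy m T = (SUP \<xi>\<in>finite_partitions m. entropy_wrt m T \<xi>)"

definition pressure :: "(circle \<Rightarrow> circle) \<Rightarrow> (circle \<Rightarrow> real) \<Rightarrow> ereal" where
  "pressure T f = (SUP m\<in>invariant_measures T. KS_entropy m T + ereal (\<integral>x. f x \<partial>m))"

definition equilibrium_measure ::
    "(circle \<Rightarrow> circle) \<Rightarrow> (circle \<Rightarrow> real) \<Rightarrow> circle measure \<Rightarrow> bool" where
  "equilibrium_measure T f m \<longleftrightarrow>
     m \<in> invariant_measures T \<and> KS_entropy m T + ereal (\<integral>x. f x \<partial>m) = pressure T f"


section \<open>Gibbs measures\<close>

definition birkhoff_sum ::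
    "(circle \<Rightarrow> circle) \<Rightarrow> (circle \<Rightarrow> real) \<Rightarrow> nat \<Rightarrow> circle \<Rightarrow> real" where
  "birkhoff_sum T f n x = (\<Sum>j<n. f ((T ^^ j) x))"

definition dyn_ball :: "(circle \<Rightarrow> circle) \<Rightarrow> circle \<Rightarrow> nat \<Rightarrow> real \<Rightarrow> circle set" where
  "dyn_ball T x n r = {y. \<forall>j\<le>n. dist ((T ^^ j) x) ((T ^^ j) y) < r}"

text \<open>
  The pressure is an extended real; the second conjunct is only meaningful with the first.
\<close>

definition gibbs_measure ::
    "(circle \<Rightarrow> circle) \<Rightarrow> (circle \<Rightarrow> real) \<Rightarrow> circle measure \<Rightarrow> bool" where
  "gibbs_measure T f \<mu> \<longleftrightarrow> \<bar>pressure T f\<bar> \<noteq> \<infinity> \<and>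
     (\<exists>r\<^sub>0>0. \<forall>r. 0 < r \<and> r < r\<^sub>0 \<longrightarrow> (\<exists>K>0. \<forall>x. \<forall>n\<ge>1.
        let q = measure \<mu> (dyn_ball T x n r) /
                exp (birkhoff_sum T f n x - real n * real_of_ereal (pressure T f))
        in inverse K \<le> q \<and> q \<le> K))"

end

theory Submission
  imports Defs
begin

text \<open>
  The argument replaces \<open>f\<close> by the cohomologous function
  \<open>\<psi> = f - ln \<kappa> + ln h - ln (h \<circ> T)\<close>. The eigenfunction equation for \<open>h\<close> says exactly that
  the weights \<open>exp \<psi>\<close> over the preimages of a point add up to one, and the eigenmeasure
  equation for \<open>\<nu>\<close> says that the dual of the operator with weight \<open>\<psi>\<close> fixes
  \<open>\<mu> = h \<nu>\<close>. Since \<open>ln h - ln (h \<circ> T)\<close> integrates to zero against invariant measures, the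
  theorem becomes a statement about \<open>\<psi>\<close>: for every invariant \<open>m\<close> the entropy plus
  \<open>\<integral>\<psi> \<partial>m\<close> is at most zero, with equality only for \<open>m = \<mu>\<close>.

  The map has finitely many full inverse branches, and points with the same sequence of
  branches for a long time are close, because an interval of length \<open>t\<close> is stretched at least
  to length \<open>t (1 + V t)\<close>. So the label \<open>digit\<close>, which records the branch of a point,
  generates, and the Kolmogorov-Sinai entropy of \<open>m\<close> is the decreasing limit of the
  conditional entropies of the first digit given the next \<open>n\<close> digits
  (\<open>KS_entropy_generator\<close>).

  Fix \<open>n\<close>. For a digit \<open>i\<close> and a word \<open>A\<close> of \<open>n\<close> digits, let \<open>p\<close> be the measure of the points
  with first digit \<open>i\<close> and next digits \<open>A\<close>, let \<open>q\<close> be the measure of the points with next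
  digits \<open>A\<close>, and let \<open>r\<close> be \<open>q\<close> times \<open>exp \<psi>\<close> at the preimage in branch \<open>i\<close> of a sample point of
  the cylinder of \<open>A\<close>. Both \<open>p\<close> and \<open>r\<close> sum to \<open>q\<close> over \<open>i\<close>, and the conditional entropy plus \<open>\<integral>\<psi> \<partial>m\<close> is, up to the
  oscillation of \<open>\<psi>\<close> on cylinders, minus the relative entropy of \<open>p\<close> with respect to \<open>r\<close>, hence
  at most minus the sum of \<open>(\<surd>r - \<surd>p)\<^sup>2\<close> (\<open>increment_le_hellinger\<close>). This gives the upper
  bound. In the case of equality \<open>p\<close> and \<open>r\<close> merge as \<open>n\<close> grows, which says that the dual
  operator fixes \<open>m\<close> (\<open>dual_transfer_of_maximal\<close>), and the convergence of the iterates in the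
  Ruelle-Perron-Frobenius theorem leaves only one fixed measure (\<open>dual_transfer_unique\<close>).
  Conversely for a fixed measure \<open>p\<close> and \<open>r\<close> agree up to the oscillation, which yields
  equality (\<open>maximal_of_dual_transfer\<close>).

  For the Gibbs property, compatibility and the injectivity of \<open>T\<close> at small scales show that
  \<open>T\<^sup>n\<close> maps a dynamical ball bijectively onto a metric ball, with Birkhoff sums distorted
  by at most a constant (\<open>shadowing_preimage\<close>, \<open>dyn_ball_injective\<close>). Integrating the \<open>n\<close>-th iterate of
  the operator on the indicator of the dynamical ball then compares its measure with
  \<open>exp (S\<^sub>n \<psi>)\<close> times the measure of that metric ball, which is bounded below
  (\<open>ball_measure_lower_bound\<close>).
\<close>

section \<open>The circle as a compact metric space\<close>

definition wrap :: "real \<Rightarrow> circle" where "wrap t = Circle (frac t)"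

lemma coord_bounds: "0 \<le> coord x" "coord x < 1"
  using coord[of x] by auto

lemma coord_wrap: "coord (wrap t) = frac t"
  unfolding wrap_def by (rule Circle_inverse) (simp add: frac_lt_1)

lemma wrap_coord: "wrap (coord x) = x"
  by (simp add: wrap_def coord_bounds frac_eq[THEN iffD2] coord_inverse)

lemma dist_circle_min: "dist x y = min \<bar>coord x - coord y\<bar>
    (min \<bar>coord x - coord y + 1\<bar> \<bar>coord x - coord y - 1\<bar>)"
  by (simp add: dist_circle_def)

lemma dist_le_coord: "dist x y \<le> \<bar>coord x - coord y\<bar>"
  by (simp add: dist_circle_min)

lemma dist_circle_le_1: "dist (x::circle) y \<le> 1"
  using coord_bounds[of x] coord_bounds[of y] by (simp add: dist_circle_min)

text \<open>
  The minimum over three shifts in the metric is the distance of the real difference to the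
  nearest integer, so reduction modulo 1 cannot increase distances. This makes the circle a
  continuous image of the unit interval.
\<close>
lemma dist_wrap_le: "dist (wrap s) (wrap t) \<le> \<bar>s - t\<bar>"
proof -
  define k where "k = \<lfloor>s\<rfloor> - \<lfloor>t\<rfloor>"
  have eq: "s - t = frac s - frac t + real_of_int k"
    by (simp add: frac_def k_def)
  have b: "0 \<le> frac s" "frac s < 1" "0 \<le> frac t" "frac t < 1"
    by (auto simp: frac_lt_1)
  consider "k \<le> -2" | "k = -1" | "k = 0" | "k = 1" | "k \<ge> 2" by linarith
  then show ?thesis
  proof cases
    case 1
    then have "real_of_int k \<le> -2" by simp
    then show ?thesis unfolding dist_circle_min coord_wrap eq using b by linarith
  next
    case 5
    then have "real_of_int k \<ge> 2" by simp
    then show ?thesis unfolding dist_circle_min coord_wrap eq using b by linarith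
  qed (simp_all add: dist_circle_min coord_wrap eq)
qed

lemma continuous_on_wrap: "continuous_on S wrap"
  unfolding continuous_on_iff
  by (metis dist_commute dist_real_def dist_wrap_le dual_order.strict_trans2 order_le_less_trans)

lemma compact_circle: "compact (UNIV :: circle set)"
proof -
  have "(UNIV :: circle set) = wrap ` {0..1}"
    using coord_bounds by (force intro: wrap_coord[symmetric] order.strict_implies_order)
  then show ?thesis
    by (metis compact_Icc compact_continuous_image continuous_on_wrap)
qed

lemma uniformly_continuous_circle:
  fixes \<phi> :: "circle \<Rightarrow> 'a::metric_space"
  assumes "continuous_on UNIV \<phi>"
  shows "uniformly_continuous_on UNIV \<phi>"
  using assms compact_circle by (rule compact_uniformly_continuous)

lemma bounded_circle:
  fixes \<phi> :: "circle \<Rightarrow> real"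
  assumes "continuous_on UNIV \<phi>"
  obtains B where "\<And>x. \<bar>\<phi> x\<bar> \<le> B"
  using compact_imp_bounded[OF compact_continuous_image[OF assms compact_circle]]
  by (auto simp: bounded_iff)

text \<open>
  These two instances make the regularity theorem for finite Borel measures applicable.
\<close>
instance circle :: complete_space
proof
  fix X :: "nat \<Rightarrow> circle" assume "Cauchy X"
  then show "convergent X"
    using compact_imp_complete[OF compact_circle]
    by (auto simp: complete_def convergent_def)
qed

instance circle :: second_countable_topology
proof
  define B where "B = (\<lambda>(q, n). ball (wrap q) (1 / real (Suc n))) ` (\<rat> \<times> UNIV)"
  have "countable B"
    unfolding B_def by (intro countable_image countable_SIGMA countable_rat) auto
  moreover have "topological_basis B"
  proof (rule topological_basisI)
    fix U :: "circle set" and x assume "open U" "x \<in> U"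
    then obtain e where e: "e > 0" "ball x e \<subseteq> U"
      by (meson openE)
    obtain n where n: "2 / e < real (Suc n)"
      by (meson less_Suc_eq_le linorder_not_le reals_Archimedean2 of_nat_less_iff less_trans lessI)
    then have n': "1 / real (Suc n) < e / 2"
      using e by (simp add: field_simps)
    obtain q where q: "q \<in> \<rat>" "coord x < q" "q < coord x + 1 / real (Suc n)"
      using Rats_dense_in_real[of "coord x" "coord x + 1 / real (Suc n)"] by auto
    have d: "dist (wrap q) x < 1 / real (Suc n)"
      using dist_wrap_le[of q "coord x"] q by (simp add: wrap_coord)
    have "ball (wrap q) (1 / real (Suc n)) \<subseteq> ball x e"
    proof
      fix y assume "y \<in> ball (wrap q) (1 / real (Suc n))"
      then have "dist x y < 1 / real (Suc n) + 1 / real (Suc n)"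
        using d dist_triangle[of x y "wrap q"] by (simp add: dist_commute)
      then show "y \<in> ball x e" using n' by simp
    qed
    moreover have "ball (wrap q) (1 / real (Suc n)) \<in> B"
      unfolding B_def using q by force
    ultimately show "\<exists>B'\<in>B. x \<in> B' \<and> B' \<subseteq> U"
      using d e by (intro bexI[of _ "ball (wrap q) (1 / real (Suc n))"]) auto
  qed (auto simp: B_def)
  ultimately show "\<exists>B :: circle set set. countable B \<and> open = generate_topology B"
    using topological_basis_imp_subbasis by blast
qed

lemma measurable_coord [measurable]: "coord \<in> borel_measurable borel"
proof -
  \<comment> \<open>The coordinate jumps at 0, but its sublevel sets are closed arcs starting at 0.\<close>
  have "closed {x. coord x \<le> a} \<or> {x. coord x \<le> a} = UNIV" for a
  proof (cases "0 \<le> a \<and> a < 1")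
    case True
    have "{x. coord x \<le> a} = wrap ` {0..a}"
    proof
      show "{x. coord x \<le> a} \<subseteq> wrap ` {0..a}"
        by (force intro: wrap_coord[symmetric] coord_bounds)
    qed (use True in \<open>auto simp: coord_wrap frac_eq[THEN iffD2]\<close>)
    then show ?thesis
      by (metis compact_Icc compact_continuous_image compact_imp_closed continuous_on_wrap)
  next
    case False
    then have "{x. coord x \<le> a} = {} \<or> {x. coord x \<le> a} = UNIV"
      using coord_bounds by (auto, meson less_le_trans not_le order.trans, meson le_less_trans less_imp_le not_less order_trans)
    then show ?thesis by auto
  qed
  then have "{x. coord x \<le> a} \<in> sets borel" for a
    by (metis borel_closed closed_UNIV)
  then show ?thesis
    by (intro borel_measurableI_le) auto
qed

lemma measurable_wrap [measurable]: "wrap \<in> borel_measurable borel"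
  by (intro borel_measurable_continuous_onI continuous_on_wrap)

lemma integral_fading_distance:
  fixes M :: "'a::metric_space measure"
  assumes "finite_measure M" "sets M = sets borel" "closed K" "K \<noteq> {}"
  shows "(\<lambda>n. \<integral>x. max 0 (1 - real n * infdist x K) \<partial>M) \<longlonglongrightarrow> measure M K"
proof -
  interpret finite_measure M by fact
  have [measurable_cong]: "sets M = sets borel" by fact
  have meas [measurable]: "(\<lambda>x. infdist x K) \<in> borel_measurable M"
    unfolding measurable_cong_sets[OF assms(2) refl]
    by (intro borel_measurable_continuous_onI continuous_intros)
  have K: "K \<in> sets M" using assms by simp
  have lim: "(\<lambda>n. max 0 (1 - real n * infdist x K)) \<longlonglongrightarrow> indicator K x" for x
  proof (cases "x \<in> K")
    case True
    then show ?thesis by simp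
  next
    case False
    then have pos: "infdist x K > 0"
      using assms in_closed_iff_infdist_zero[of K x] infdist_nonneg[of x K] by fastforce
    obtain n0 :: nat where n0: "1 / infdist x K < real n0" using reals_Archimedean2 by blast
    have "max 0 (1 - real n * infdist x K) = 0" if "n \<ge> n0" for n
    proof -
      have "1 < real n0 * infdist x K" using n0 pos by (simp add: field_simps)
      also have "\<dots> \<le> real n * infdist x K" using that pos by simp
      finally show ?thesis by simp
    qed
    then have "eventually (\<lambda>n. max 0 (1 - real n * infdist x K) = 0) sequentially"
      using eventually_sequentially by blast
    then show ?thesis using False by (simp add: tendsto_eventually)
  qed
  have "(\<lambda>n. \<integral>x. max 0 (1 - real n * infdist x K) \<partial>M) \<longlonglongrightarrow> (\<integral>x. indicator K x \<partial>M)"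
  proof (rule integral_dominated_convergence[where w="\<lambda>x. 1"])
    show "AE x in M. norm (max 0 (1 - real n * infdist x K)) \<le> 1" for n
      by (auto simp: infdist_nonneg)
  qed (use lim K in \<open>auto intro!: borel_measurable_indicator\<close>)
  then show ?thesis using K by simp
qed

text \<open>
  Integrals of continuous functions determine the measure of closed sets, by approximation of
  the indicator from above, and closed sets generate the Borel sets.
\<close>
lemma measure_eq_of_continuous_integrals:
  fixes M M' :: "'a::metric_space measure"
  assumes fin: "finite_measure M" "finite_measure M'"
    and sets: "sets M = sets borel" "sets M' = sets borel"
    and eq: "\<And>\<phi> :: 'a \<Rightarrow> real. continuous_on UNIV \<phi> \<Longrightarrow> bounded (range \<phi>) \<Longrightarrow>
        (\<integral>x. \<phi> x \<partial>M) = (\<integral>x. \<phi> x \<partial>M')"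
  shows "M = M'"
proof -
  interpret M: finite_measure M by fact
  interpret M': finite_measure M' by fact
  have closed_eq: "measure M K = measure M' K" if "closed K" for K
  proof (cases "K = {}")
    case False
    have "(\<integral>x. max 0 (1 - real n * infdist x K) \<partial>M) = (\<integral>x. max 0 (1 - real n * infdist x K) \<partial>M')" for n
    proof (rule eq)
      show "bounded (range (\<lambda>x. max 0 (1 - real n * infdist x K)))"
        by (rule boundedI[of _ 1]) (auto simp: infdist_nonneg)
    qed (intro continuous_intros)
    then show ?thesis
      using integral_fading_distance[OF fin(1) sets(1) that False]
        integral_fading_distance[OF fin(2) sets(2) that False] LIMSEQ_unique by simp
  qed simp
  show ?thesis
  proof (rule measure_eqI_generator_eq[where E="Collect closed" and \<Omega>=UNIV and A="\<lambda>_. UNIV"])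
    show "Int_stable (Collect (closed :: 'a set \<Rightarrow> bool))"
      by (auto simp: Int_stable_def)
    show "sets M = sigma_sets UNIV (Collect closed)" "sets M' = sigma_sets UNIV (Collect closed)"
      using sets by (simp_all add: borel_eq_closed)
  qed (use closed_eq in \<open>auto simp: M.emeasure_eq_measure M'.emeasure_eq_measure\<close>)
qed

section \<open>Entropy of finite labels\<close>

text \<open>
  This is \<open>ln t \<le> t - 1\<close> at \<open>t = r s / (p q)\<close>. The order hypotheses on \<open>p\<close>, \<open>q\<close>, \<open>r\<close>, \<open>s\<close> ensure that
  all of them are positive as soon as \<open>p\<close> is.
\<close>
lemma mult_ln_quotient_ge:
  fixes p q r s :: real
  assumes "0 \<le> p" "0 \<le> q" "p \<le> r" "p \<le> s" "r \<le> q" "s \<le> q"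
  shows "p - r * s / q \<le> p * ln p + p * ln q - p * ln r - p * ln s"
proof (cases "p = 0")
  case True
  then show ?thesis using assms by (simp add: divide_nonneg_nonneg)
next
  case False
  then have pos: "0 < p" "0 < q" "0 < r" "0 < s" using assms by auto
  have "ln ((r * s) / (p * q)) \<le> (r * s) / (p * q) - 1"
    using pos by (intro ln_le_minus_one) simp
  then have "p * ln ((r * s) / (p * q)) \<le> p * ((r * s) / (p * q) - 1)"
    using pos by (intro mult_left_mono) auto
  moreover have "p * ((r * s) / (p * q) - 1) = r * s / q - p"
    using pos by (simp add: field_simps)
  moreover have "p * ln ((r * s) / (p * q)) = p * (ln r + ln s - ln p - ln q)"
    using pos by (simp add: ln_div ln_mult)
  ultimately show ?thesis by (simp add: algebra_simps)
qed

text \<open>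
  The mass \<open>q\<close> need not be one, so the inequality applies to the joint distribution of two
  labels restricted to a single value of a third label. Summing over that value gives strong
  subadditivity.
\<close>
lemma mutual_information_sum_nonneg:
  fixes p :: "'a \<Rightarrow> 'b \<Rightarrow> real"
  assumes fin: "finite A" "finite B" and nn: "\<And>x z. 0 \<le> p x z"
  defines "r \<equiv> \<lambda>x. \<Sum>z\<in>B. p x z" and "s \<equiv> \<lambda>z. \<Sum>x\<in>A. p x z"
    and "q \<equiv> \<Sum>x\<in>A. \<Sum>z\<in>B. p x z"
  shows "(\<Sum>x\<in>A. r x * ln (r x)) + (\<Sum>z\<in>B. s z * ln (s z)) \<le>
    (\<Sum>x\<in>A. \<Sum>z\<in>B. p x z * ln (p x z)) + q * ln q"
proof -
  have q: "q = (\<Sum>x\<in>A. r x)" "q = (\<Sum>z\<in>B. s z)"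
    by (simp_all add: q_def r_def s_def sum.swap[of _ A B])
  have rs_nn: "0 \<le> r x" "0 \<le> s z" for x z
    by (simp_all add: r_def s_def sum_nonneg nn)
  have le: "p x z - r x * s z / q \<le> p x z * ln (p x z) + p x z * ln q - p x z * ln (r x) - p x z * ln (s z)"
    if "x \<in> A" "z \<in> B" for x z
  proof (rule mult_ln_quotient_ge)
    show "p x z \<le> r x" unfolding r_def using fin nn that by (intro member_le_sum) auto
    show "p x z \<le> s z" unfolding s_def using fin nn that
      by (intro member_le_sum[of x A "\<lambda>x. p x z"]) auto
    show "r x \<le> q" unfolding q(1) using fin rs_nn that by (intro member_le_sum) auto
    show "s z \<le> q" unfolding q(2) using fin rs_nn that by (intro member_le_sum) auto
    show "0 \<le> q" unfolding q(1) using rs_nn by (intro sum_nonneg)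
  qed (rule nn)
  have "(\<Sum>x\<in>A. \<Sum>z\<in>B. p x z - r x * s z / q) = q - q * q / q"
  proof -
    have "(\<Sum>x\<in>A. \<Sum>z\<in>B. r x * s z / q) = (\<Sum>x\<in>A. r x) * (\<Sum>z\<in>B. s z) / q"
      by (simp add: sum_product sum_divide_distrib)
    then show ?thesis by (simp add: sum_subtractf q[symmetric]) (simp add: q_def)
  qed
  also have "\<dots> = 0" by simp
  finally have "0 \<le> (\<Sum>x\<in>A. \<Sum>z\<in>B. p x z * ln (p x z) + p x z * ln q - p x z * ln (r x) - p x z * ln (s z))"
    using sum_mono[of A "\<lambda>x. \<Sum>z\<in>B. p x z - r x * s z / q"] sum_mono le
    by (smt (verit, ccfv_SIG))
  also have "\<dots> = (\<Sum>x\<in>A. \<Sum>z\<in>B. p x z * ln (p x z)) + (\<Sum>x\<in>A. \<Sum>z\<in>B. p x z) * ln q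
      - (\<Sum>x\<in>A. \<Sum>z\<in>B. p x z * ln (r x)) - (\<Sum>x\<in>A. \<Sum>z\<in>B. p x z * ln (s z))"
    by (simp add: sum_subtractf sum.distrib sum_distrib_right)
  also have "(\<Sum>x\<in>A. \<Sum>z\<in>B. p x z * ln (r x)) = (\<Sum>x\<in>A. r x * ln (r x))"
    by (simp add: r_def sum_distrib_right)
  also have "(\<Sum>x\<in>A. \<Sum>z\<in>B. p x z * ln (s z)) = (\<Sum>z\<in>B. s z * ln (s z))"
    by (subst sum.swap) (simp add: s_def sum_distrib_right)
  finally show ?thesis by (simp add: q_def)
qed

text \<open>
  Partitions are handled as the fibres of label functions, since refinement is then pairing of
  functions and the common refinement of preimages under \<open>T\<close> is an itinerary.
\<close>
locale full_prob_space = prob_space +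
  assumes space_UNIV: "space M = UNIV"
begin

definition label :: "('a \<Rightarrow> 'b) \<Rightarrow> bool" where
  "label X \<longleftrightarrow> finite (range X) \<and> (\<forall>v. X -` {v} \<in> sets M)"

definition label_entropy :: "('a \<Rightarrow> 'b) \<Rightarrow> real" where
  "label_entropy X = - (\<Sum>v\<in>range X. prob (X -` {v}) * ln (prob (X -` {v})))"

lemma label_sets: "label X \<Longrightarrow> X -` {v} \<in> sets M"
  by (simp add: label_def)

lemma label_finite: "label X \<Longrightarrow> finite (range X)"
  by (simp add: label_def)

lemma label_vimage:
  assumes "label X" shows "X -` S \<in> sets M"
proof -
  have "X -` S = (\<Union>v\<in>range X \<inter> S. X -` {v})" by auto
  also have "\<dots> \<in> sets M"
    using assms by (intro sets.finite_UN) (auto simp: label_def)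
  finally show ?thesis .
qed

lemma label_pair:
  assumes "label X" "label Y" shows "label (\<lambda>x. (X x, Y x))"
  unfolding label_def
proof safe
  show "finite (range (\<lambda>x. (X x, Y x)))"
    by (rule finite_subset[of _ "range X \<times> range Y"]) (use assms in \<open>auto simp: label_def\<close>)
  fix v w
  have "(\<lambda>x. (X x, Y x)) -` {(v, w)} = X -` {v} \<inter> Y -` {w}" by auto
  then show "(\<lambda>x. (X x, Y x)) -` {(v, w)} \<in> sets M"
    using assms by (metis sets.Int label_sets)
qed

lemma label_comp:
  assumes "label X" shows "label (\<lambda>x. g (X x))"
  unfolding label_def
proof safe
  show "finite (range (\<lambda>x. g (X x)))"
    using finite_imageI[of "range X" g] assms by (simp add: label_def image_image)
  fix v
  have "(\<lambda>x. g (X x)) -` {v} = X -` (g -` {v})" by auto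
  then show "(\<lambda>x. g (X x)) -` {v} \<in> sets M"
    using label_vimage[OF assms] by simp
qed

lemma label_entropy_superset:
  assumes "finite S" "range X \<subseteq> S"
  shows "label_entropy X = - (\<Sum>v\<in>S. prob (X -` {v}) * ln (prob (X -` {v})))"
proof -
  have "X -` {v} = {}" if "v \<notin> range X" for v using that by auto
  then show ?thesis
    unfolding label_entropy_def using assms
    by (intro arg_cong[of _ _ uminus] sum.mono_neutral_left) auto
qed

lemma label_entropy_relabel:
  assumes "inj_on g (range X)"
  shows "label_entropy (\<lambda>x. g (X x)) = label_entropy X"
proof -
  have "(\<lambda>x. g (X x)) -` {g v} = X -` {v}" if "v \<in> range X" for v
    using that assms by (auto simp: inj_on_def)
  moreover have "range (\<lambda>x. g (X x)) = g ` range X" by auto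
  ultimately show ?thesis
    unfolding label_entropy_def by (simp add: sum.reindex[OF assms])
qed

lemma prob_marginal:
  assumes "A \<in> sets M" "label Y"
  shows "prob A = (\<Sum>w\<in>range Y. prob (A \<inter> Y -` {w}))"
proof -
  have "A = (\<Union>w\<in>range Y. A \<inter> Y -` {w})" by auto
  then have "prob A = prob (\<Union>w\<in>range Y. A \<inter> Y -` {w})" by simp
  also have "\<dots> = (\<Sum>w\<in>range Y. prob (A \<inter> Y -` {w}))"
    using assms by (intro finite_measure_finite_Union) (auto simp: label_def disjoint_family_on_def)
  finally show ?thesis .
qed

lemma label_entropy_pair:
  assumes "label X" "label Y"
  shows "label_entropy (\<lambda>x. (X x, Y x)) =
    - (\<Sum>v\<in>range X. \<Sum>w\<in>range Y. prob (X -` {v} \<inter> Y -` {w}) * ln (prob (X -` {v} \<inter> Y -` {w})))"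
proof -
  have *: "(\<lambda>x. (X x, Y x)) -` {(v, w)} = X -` {v} \<inter> Y -` {w}" for v w by auto
  show ?thesis
    by (subst label_entropy_superset[of "range X \<times> range Y"])
      (use assms in \<open>auto simp: label_def sum.cartesian_product * intro!: sum.cong\<close>)
qed

lemma label_entropy_mono:
  assumes "label X" "label Y"
  shows "label_entropy Y \<le> label_entropy (\<lambda>x. (X x, Y x))"
proof -
  have "(\<Sum>v\<in>range X. prob (X -` {v} \<inter> Y -` {w}) * ln (prob (X -` {v} \<inter> Y -` {w}))) \<le>
     prob (Y -` {w}) * ln (prob (Y -` {w}))" for w
  proof -
    have "prob (X -` {v} \<inter> Y -` {w}) * ln (prob (X -` {v} \<inter> Y -` {w})) \<le>
       prob (X -` {v} \<inter> Y -` {w}) * ln (prob (Y -` {w}))" for v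
    proof (cases "prob (X -` {v} \<inter> Y -` {w}) = 0")
      case False
      then have "0 < prob (X -` {v} \<inter> Y -` {w})" using measure_nonneg by (metis less_eq_real_def)
      moreover have "prob (X -` {v} \<inter> Y -` {w}) \<le> prob (Y -` {w})"
        using assms by (intro finite_measure_mono) (auto simp: label_def)
      ultimately show ?thesis by (intro mult_left_mono) auto
    qed simp
    then have "(\<Sum>v\<in>range X. prob (X -` {v} \<inter> Y -` {w}) * ln (prob (X -` {v} \<inter> Y -` {w}))) \<le>
       (\<Sum>v\<in>range X. prob (X -` {v} \<inter> Y -` {w}) * ln (prob (Y -` {w})))"
      by (rule sum_mono)
    also have "\<dots> = prob (Y -` {w}) * ln (prob (Y -` {w}))"
      using prob_marginal[OF label_sets[OF assms(2)] assms(1), of w]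
      by (simp add: sum_distrib_right Int_commute)
    finally show ?thesis .
  qed
  then show ?thesis
    unfolding label_entropy_pair[OF assms] label_entropy_def
    by (subst sum.swap) (simp add: sum_mono)
qed

text \<open>
  The conditional mutual information of \<open>X\<close> and \<open>Z\<close> given \<open>Y\<close> is nonnegative. All monotonicity of
  conditional entropy below comes from this inequality.
\<close>
lemma label_entropy_strong_subadditive:
  assumes X: "label X" and Y: "label Y" and Z: "label Z"
  shows "label_entropy (\<lambda>x. (Y x, X x, Z x)) + label_entropy Y \<le>
    label_entropy (\<lambda>x. (X x, Y x)) + label_entropy (\<lambda>x. (Z x, Y x))"
proof -
  let ?p = "\<lambda>w v z. prob (Y -` {w} \<inter> (X -` {v} \<inter> Z -` {z}))"
  let ?e = "\<lambda>t :: real. t * ln t"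
  have XZ: "label (\<lambda>x. (X x, Z x))" using X Z by (rule label_pair)
  have r: "(\<Sum>z\<in>range Z. ?p w v z) = prob (X -` {v} \<inter> Y -` {w})" for w v
    using prob_marginal[OF sets.Int[OF label_sets[OF X] label_sets[OF Y]] Z, of v w]
    by (simp add: ac_simps)
  have s: "(\<Sum>v\<in>range X. ?p w v z) = prob (Z -` {z} \<inter> Y -` {w})" for w z
    using prob_marginal[OF sets.Int[OF label_sets[OF Z] label_sets[OF Y]] X, of z w]
    by (simp add: ac_simps)
  have q: "(\<Sum>v\<in>range X. prob (X -` {v} \<inter> Y -` {w})) = prob (Y -` {w})" for w
    using prob_marginal[of "Y -` {w}" X] X Y by (simp add: label_sets Int_commute)
  have main: "(\<Sum>v\<in>range X. ?e (prob (X -` {v} \<inter> Y -` {w}))) + (\<Sum>z\<in>range Z. ?e (prob (Z -` {z} \<inter> Y -` {w})))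
     \<le> (\<Sum>v\<in>range X. \<Sum>z\<in>range Z. ?e (?p w v z)) + ?e (prob (Y -` {w}))" for w
    using mutual_information_sum_nonneg[of "range X" "range Z" "?p w"] X Z
    unfolding r s q by (simp add: label_finite)
  have triple: "label_entropy (\<lambda>x. (Y x, X x, Z x)) =
     - (\<Sum>w\<in>range Y. \<Sum>v\<in>range X. \<Sum>z\<in>range Z. ?e (?p w v z))"
  proof -
    have *: "(\<lambda>x. (Y x, X x, Z x)) -` {(w, v, z)} = Y -` {w} \<inter> (X -` {v} \<inter> Z -` {z})" for w v z by auto
    show ?thesis
      by (subst label_entropy_superset[of "range Y \<times> range X \<times> range Z"])
        (use X Y Z in \<open>auto simp: label_def sum.cartesian_product * intro!: sum.cong\<close>)
  qed
  have "(\<Sum>w\<in>range Y. \<Sum>v\<in>range X. ?e (prob (X -` {v} \<inter> Y -` {w}))) +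
      (\<Sum>w\<in>range Y. \<Sum>z\<in>range Z. ?e (prob (Z -` {z} \<inter> Y -` {w})))
     \<le> (\<Sum>w\<in>range Y. \<Sum>v\<in>range X. \<Sum>z\<in>range Z. ?e (?p w v z)) + (\<Sum>w\<in>range Y. ?e (prob (Y -` {w})))"
    unfolding sum.distrib[symmetric] by (rule sum_mono) (rule main)
  then show ?thesis
    unfolding triple label_entropy_pair[OF X Y] label_entropy_pair[OF Z Y]
      sum.swap[of _ "range X" "range Y"] sum.swap[of _ "range Z" "range Y"]
    by (simp add: label_entropy_def)
qed

definition cond_entropy :: "('a \<Rightarrow> 'b) \<Rightarrow> ('a \<Rightarrow> 'c) \<Rightarrow> real" where
  "cond_entropy X Y = label_entropy (\<lambda>x. (X x, Y x)) - label_entropy Y"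

lemma cond_entropy_nonneg: "label X \<Longrightarrow> label Y \<Longrightarrow> 0 \<le> cond_entropy X Y"
  by (simp add: cond_entropy_def label_entropy_mono)

lemma cond_entropy_chain:
  "cond_entropy (\<lambda>x. (X x, Y x)) Z = cond_entropy X (\<lambda>x. (Y x, Z x)) + cond_entropy Y Z"
proof -
  have "label_entropy (\<lambda>x. ((X x, Y x), Z x)) = label_entropy (\<lambda>x. (X x, Y x, Z x))"
    using label_entropy_relabel[of "\<lambda>(u, v, w). ((u, v), w)" "\<lambda>x. (X x, Y x, Z x)"]
    by (simp add: inj_on_def case_prod_unfold)
  then show ?thesis by (simp add: cond_entropy_def)
qed

text \<open>
  Conditioning on coarser information \<open>g \<circ> Z\<close> increases entropy. This is strong subadditivity
  for a middle label that is a function of \<open>Z\<close>.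
\<close>
lemma cond_entropy_antimono:
  assumes X: "label X" and Z: "label Z"
  shows "cond_entropy X Z \<le> cond_entropy X (\<lambda>x. g (Z x))"
proof -
  let ?Y = "\<lambda>x. g (Z x)"
  have Y: "label ?Y" by (rule label_comp) fact
  have "label_entropy (\<lambda>x. (?Y x, X x, Z x)) = label_entropy (\<lambda>x. (X x, Z x))"
    using label_entropy_relabel[of "\<lambda>(u, v). (g v, u, v)" "\<lambda>x. (X x, Z x)"]
    by (simp add: inj_on_def case_prod_unfold)
  moreover have "label_entropy (\<lambda>x. (Z x, ?Y x)) = label_entropy Z"
    using label_entropy_relabel[of "\<lambda>v. (v, g v)" Z] by (simp add: inj_on_def)
  ultimately show ?thesis
    using label_entropy_strong_subadditive[OF X Y Z] by (simp add: cond_entropy_def)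
qed

lemma expectation_label:
  fixes c :: "'b \<Rightarrow> real"
  assumes "label Z"
  shows "expectation (\<lambda>x. c (Z x)) = (\<Sum>v\<in>range Z. prob (Z -` {v}) * c v)"
    and "integrable M (\<lambda>x. c (Z x))"
proof -
  have eq: "c (Z x) = (\<Sum>v\<in>range Z. c v * indicator (Z -` {v}) x)" for x
    using sum.remove[of "range Z" "Z x" "\<lambda>v. c v * indicator (Z -` {v}) x"] label_finite[OF assms]
    by (simp add: sum.neutral indicator_def)
  have int: "integrable M (\<lambda>x. c v * indicator (Z -` {v}) x)" for v
    using label_sets[OF assms]
    by (intro integrable_mult_right integrable_real_indicator) (simp_all add: less_top[symmetric])
  show "integrable M (\<lambda>x. c (Z x))"
    unfolding eq by (rule Bochner_Integration.integrable_sum) (rule int)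
  show "expectation (\<lambda>x. c (Z x)) = (\<Sum>v\<in>range Z. prob (Z -` {v}) * c v)"
    unfolding eq
    by (subst Bochner_Integration.integral_sum)
      (use int label_sets[OF assms] in \<open>auto simp: space_UNIV mult.commute\<close>)
qed

lemma expectation_approx_label:
  fixes \<phi> :: "'a \<Rightarrow> real"
  assumes "label Z" "integrable M \<phi>" "\<And>x. \<bar>\<phi> x - c (Z x)\<bar> \<le> e"
  shows "\<bar>expectation \<phi> - (\<Sum>v\<in>range Z. prob (Z -` {v}) * c v)\<bar> \<le> e"
proof -
  have int: "integrable M (\<lambda>x. \<phi> x - c (Z x))"
    using assms(2) expectation_label(2)[OF assms(1)] by (rule Bochner_Integration.integrable_diff)
  have "\<bar>expectation (\<lambda>x. \<phi> x - c (Z x))\<bar> \<le> expectation (\<lambda>x. \<bar>\<phi> x - c (Z x)\<bar>)"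
    by (rule integral_abs_bound)
  also have "\<dots> \<le> expectation (\<lambda>x. e)"
    by (rule integral_mono) (use int assms(3) in auto)
  also have "\<dots> = e" by (simp add: prob_space)
  finally show ?thesis
    using assms(2) expectation_label[OF assms(1)] by (simp add: Bochner_Integration.integral_diff)
qed

end

section \<open>Itineraries and entropy rates\<close>

definition itinerary :: "('a \<Rightarrow> 'a) \<Rightarrow> ('a \<Rightarrow> 'b) \<Rightarrow> nat \<Rightarrow> 'a \<Rightarrow> 'b list" where
  "itinerary T X n x = map (\<lambda>j. X ((T ^^ j) x)) [0..<n]"

lemma itinerary_0 [simp]: "itinerary T X 0 = (\<lambda>x. [])"
  by (simp add: itinerary_def fun_eq_iff)

lemma itinerary_Suc: "itinerary T X (Suc n) x = X x # itinerary T X n (T x)"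
  unfolding itinerary_def map_upt_Suc by (simp add: funpow_swap1)

lemma take_itinerary: "k \<le> n \<Longrightarrow> take k (itinerary T X n x) = itinerary T X k x"
  by (simp add: itinerary_def take_map)

locale measure_preserving_map = full_prob_space +
  fixes T :: "'a \<Rightarrow> 'a"
  assumes T_measurable [measurable]: "T \<in> measurable M M"
    and T_invariant: "distr M M T = M"
begin

lemma prob_vimage:
  assumes "A \<in> sets M" shows "prob (T -` A) = prob A"
  using measure_distr[OF T_measurable assms] by (simp add: T_invariant space_UNIV)

lemma vimage_sets: "A \<in> sets M \<Longrightarrow> T -` A \<in> sets M"
  using measurable_sets[OF T_measurable] by (simp add: space_UNIV)

lemma label_shift:
  assumes "label X" shows "label (\<lambda>x. X (T x))"
proof -
  have "(\<lambda>x. X (T x)) -` {v} = T -` (X -` {v})" for v by auto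
  moreover have "range (\<lambda>x. X (T x)) \<subseteq> range X" by auto
  ultimately show ?thesis
    using assms finite_subset unfolding label_def by (auto intro: vimage_sets)
qed

lemma label_entropy_shift:
  assumes "label X" shows "label_entropy (\<lambda>x. X (T x)) = label_entropy X"
proof -
  have "(\<lambda>x. X (T x)) -` {v} = T -` (X -` {v})" for v by auto
  then have "prob ((\<lambda>x. X (T x)) -` {v}) = prob (X -` {v})" for v
    using prob_vimage label_sets[OF assms] by simp
  then show ?thesis
    using label_finite[OF assms]
    by (subst label_entropy_superset[of "range X"]) (auto simp: label_entropy_def)
qed

lemma cond_entropy_shift:
  assumes "label X" "label Y"
  shows "cond_entropy (\<lambda>x. X (T x)) (\<lambda>x. Y (T x)) = cond_entropy X Y"
  using label_entropy_shift[OF label_pair[OF assms]] label_entropy_shift[OF assms(2)]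
  by (simp add: cond_entropy_def)

lemma label_itinerary:
  assumes "label X" shows "label (itinerary T X n)"
proof (induction n)
  case 0
  have "{} \<in> sets M" "UNIV \<in> sets M" using sets.top[of M] by (simp_all add: space_UNIV)
  then have "{x. P} \<in> sets M" for P by (cases P) auto
  then show ?case by (auto simp: label_def vimage_def image_constant_conv)
next
  case (Suc n)
  have "label (\<lambda>x. case (X x, itinerary T X n (T x)) of (u, v) \<Rightarrow> u # v)"
    by (rule label_comp) (intro label_pair label_shift Suc assms)
  then show ?case by (simp add: itinerary_Suc)
qed

text \<open>
  The entropy of the present given the next \<open>n\<close> future labels. By invariance it is the growth of
  the entropy of itineraries from length \<open>n\<close> to \<open>n + 1\<close>.
\<close>
definition entropy_increment :: "('a \<Rightarrow> 'b) \<Rightarrow> nat \<Rightarrow> real" where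
  "entropy_increment X n = cond_entropy X (\<lambda>x. itinerary T X n (T x))"

lemma label_entropy_itinerary_Suc:
  assumes "label X"
  shows "label_entropy (itinerary T X (Suc n)) =
    label_entropy (itinerary T X n) + entropy_increment X n"
proof -
  have "label_entropy (itinerary T X (Suc n)) = label_entropy (\<lambda>x. (X x, itinerary T X n (T x)))"
    using label_entropy_relabel[of "\<lambda>(u, v). u # v" "\<lambda>x. (X x, itinerary T X n (T x))"]
    by (simp add: inj_on_def itinerary_Suc[abs_def])
  then show ?thesis
    using label_entropy_shift[OF label_itinerary[OF assms]]
    by (simp add: entropy_increment_def cond_entropy_def)
qed

lemma entropy_increment_nonneg: "label X \<Longrightarrow> 0 \<le> entropy_increment X n"
  unfolding entropy_increment_def by (intro cond_entropy_nonneg label_shift label_itinerary)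

lemma entropy_increment_antimono:
  assumes "label X" shows "decseq (entropy_increment X)"
proof (rule decseq_SucI)
  fix n
  have "cond_entropy X (\<lambda>x. itinerary T X (Suc n) (T x)) \<le>
      cond_entropy X (\<lambda>x. take n (itinerary T X (Suc n) (T x)))"
    by (intro cond_entropy_antimono label_shift label_itinerary assms)
  then show "entropy_increment X (Suc n) \<le> entropy_increment X n"
    by (simp add: entropy_increment_def take_itinerary)
qed

lemma label_entropy_itinerary_0: "label_entropy (itinerary T X 0) = 0"
proof -
  have "prob UNIV = 1" using prob_space by (simp add: space_UNIV)
  then show ?thesis by (simp add: label_entropy_def)
qed

lemma label_entropy_itinerary:
  assumes "label X"
  shows "label_entropy (itinerary T X n) = (\<Sum>i<n. entropy_increment X i)"
  by (induction n) (use assms in \<open>simp_all add: label_entropy_itinerary_Suc label_entropy_itinerary_0 del: itinerary_0\<close>)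

end

lemma decseq_averages_tendsto:
  fixes a :: "nat \<Rightarrow> real"
  assumes dec: "decseq a" and lim: "a \<longlonglongrightarrow> L"
  shows "(\<lambda>n. (\<Sum>i<n. a i) / real n) \<longlonglongrightarrow> L"
proof (rule LIMSEQ_I)
  fix e :: real assume e: "0 < e"
  have ge: "L \<le> a n" for n using dec lim by (rule decseq_ge)
  obtain k where k: "a k < L + e / 2"
    using e order_tendstoD(2)[OF lim, of "L + e / 2"] by (auto simp: eventually_sequentially)
  define S where "S = (\<Sum>i<k. a i - L)"
  have S: "0 \<le> S" unfolding S_def using ge by (intro sum_nonneg) simp
  obtain n0 :: nat where n0: "2 * S / e < real n0" using reals_Archimedean2 by blast
  have "norm ((\<Sum>i<n. a i) / real n - L) < e" if n: "n \<ge> Suc (max n0 k)" for n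
  proof -
    have pos: "0 < real n" using n by simp
    have eq: "(\<Sum>i<n. a i) / real n - L = (\<Sum>i<n. a i - L) / real n"
      using pos by (simp add: sum_subtractf field_simps)
    have "(\<Sum>i<n. a i - L) = S + (\<Sum>i=k..<n. a i - L)"
      unfolding S_def using n by (subst sum.atLeastLessThan_concat[of 0 k n, symmetric, simplified atLeast0LessThan]) auto
    also have "(\<Sum>i=k..<n. a i - L) \<le> (\<Sum>i=k..<n. e / 2)"
      using k dec by (intro sum_mono) (fastforce simp: decseq_def)
    also have "\<dots> \<le> real n * (e / 2)" using e by simp
    also have "S < real n * (e / 2)"
    proof -
      have "2 * S < real n0 * e" using n0 e by (simp add: field_simps)
      also have "\<dots> \<le> real n * e" using n e by simp
      finally show ?thesis by simp
    qed
    finally have "(\<Sum>i<n. a i - L) < e * real n" by (simp add: mult.commute)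
    moreover have "0 \<le> (\<Sum>i<n. a i - L)" using ge by (intro sum_nonneg) simp
    ultimately show ?thesis unfolding eq using pos by (simp add: field_simps)
  qed
  then show "\<exists>n0. \<forall>n\<ge>n0. norm ((\<Sum>i<n. a i) / real n - L) < e" by blast
qed

context measure_preserving_map
begin

definition entropy_rate :: "('a \<Rightarrow> 'b) \<Rightarrow> real" where
  "entropy_rate X = lim (entropy_increment X)"

lemma entropy_increment_tendsto:
  assumes "label X" shows "entropy_increment X \<longlonglongrightarrow> entropy_rate X"
proof -
  obtain L where "entropy_increment X \<longlonglongrightarrow> L"
    using decseq_convergent[OF entropy_increment_antimono[OF assms], of 0]
      entropy_increment_nonneg[OF assms] by blast
  then show ?thesis unfolding entropy_rate_def by (simp add: limI)
qed

lemma entropy_rate_le_increment: "label X \<Longrightarrow> entropy_rate X \<le> entropy_increment X n"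
  using decseq_ge[OF entropy_increment_antimono entropy_increment_tendsto] by blast

text \<open>
  The increments decrease, so their averages converge. In particular the limit that defines the
  entropy with respect to a partition exists.
\<close>
lemma entropy_rate_tendsto:
  assumes "label X"
  shows "(\<lambda>n. label_entropy (itinerary T X n) / real n) \<longlonglongrightarrow> entropy_rate X"
  unfolding label_entropy_itinerary[OF assms]
  using assms by (intro decseq_averages_tendsto entropy_increment_antimono entropy_increment_tendsto)

text \<open>
  Each of the \<open>n\<close> coordinates of the \<open>Y\<close>-itinerary has in the longer \<open>X\<close>-itinerary a window of
  \<open>l\<close> symbols starting at the same time, and so costs at most the entropy of \<open>Y\<close> given \<open>l\<close>
  symbols of \<open>X\<close>.
\<close>
lemma cond_entropy_itinerary:
  fixes X :: "'a \<Rightarrow> 'b" and Y :: "'a \<Rightarrow> 'c"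
  assumes X: "label X" and Y: "label Y"
  shows "cond_entropy (itinerary T Y n) (itinerary T X (n + l)) \<le> real n * cond_entropy Y (itinerary T X l)"
proof (induction n)
  case 0
  have "label_entropy (\<lambda>x. ([] :: 'c list, itinerary T X l x)) = label_entropy (itinerary T X l)"
    using label_entropy_relabel[of "\<lambda>v. ([] :: 'c list, v)" "itinerary T X l"] by (simp add: inj_on_def)
  then show ?case by (simp add: cond_entropy_def )
next
  case (Suc n)
  let ?W = "\<lambda>x. itinerary T Y n (T x)" and ?Z = "itinerary T X (Suc n + l)"
  note labels = label_itinerary[OF X] label_shift[OF label_itinerary[OF X]]
    label_shift[OF label_itinerary[OF Y]]
  have "label_entropy (\<lambda>x. (itinerary T Y (Suc n) x, ?Z x)) = label_entropy (\<lambda>x. ((Y x, ?W x), ?Z x))"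
    using label_entropy_relabel[of "\<lambda>((u, v), w). (u # v, w)" "\<lambda>x. ((Y x, ?W x), ?Z x)"]
    by (simp add: inj_on_def itinerary_Suc[abs_def] case_prod_unfold)
  then have "cond_entropy (itinerary T Y (Suc n)) ?Z = cond_entropy Y (\<lambda>x. (?W x, ?Z x)) + cond_entropy ?W ?Z"
    using cond_entropy_chain[of Y ?W ?Z] by (simp add: cond_entropy_def)
  also have "cond_entropy Y (\<lambda>x. (?W x, ?Z x)) \<le> cond_entropy Y (\<lambda>x. take l (snd (?W x, ?Z x)))"
    by (intro cond_entropy_antimono Y label_pair labels)
  also have "\<dots> = cond_entropy Y (itinerary T X l)"
    by (simp add: take_itinerary)
  also have "cond_entropy ?W ?Z \<le> cond_entropy ?W (\<lambda>x. tl (?Z x))"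
    by (intro cond_entropy_antimono labels)
  also have "\<dots> = cond_entropy (itinerary T Y n) (itinerary T X (n + l))"
    using cond_entropy_shift[OF label_itinerary[OF Y] label_itinerary[OF X], of n "n + l"]
    by (simp add: itinerary_Suc)
  also note Suc
  finally show ?case by (simp add: algebra_simps)
qed

lemma entropy_rate_le_add_cond:
  assumes X: "label X" and Y: "label Y"
  shows "entropy_rate Y \<le> entropy_rate X + cond_entropy Y (itinerary T X l)"
proof -
  let ?c = "cond_entropy Y (itinerary T X l)" and ?a = "entropy_increment X 0"
  have bound: "label_entropy (itinerary T Y n) / real n \<le>
      label_entropy (itinerary T X n) / real n + real l * ?a * (1 / real n) + ?c" if "n > 0" for n
  proof -
    have "label_entropy (itinerary T Y n) \<le> label_entropy (\<lambda>x. (itinerary T X (n + l) x, itinerary T Y n x))"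
      using X Y by (intro label_entropy_mono label_itinerary)
    also have "\<dots> = label_entropy (\<lambda>x. (itinerary T Y n x, itinerary T X (n + l) x))"
      using label_entropy_relabel[of prod.swap "\<lambda>x. (itinerary T Y n x, itinerary T X (n + l) x)"]
      by (simp add: inj_on_def)
    also have "\<dots> \<le> label_entropy (itinerary T X (n + l)) + real n * ?c"
      using cond_entropy_itinerary[OF X Y, of n l] by (simp add: cond_entropy_def)
    also have "label_entropy (itinerary T X (n + l)) \<le> label_entropy (itinerary T X n) + real l * ?a"
    proof (induction l)
      case (Suc l)
      have "entropy_increment X (n + l) \<le> ?a"
        using entropy_increment_antimono[OF X] by (simp add: decseq_def)
      then show ?case using Suc label_entropy_itinerary_Suc[OF X, of "n + l"]
        by (simp add: algebra_simps)
    qed simp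
    finally show ?thesis using that by (simp add: field_simps)
  qed
  have "(\<lambda>n. label_entropy (itinerary T X n) / real n + real l * ?a * (1 / real n) + ?c) \<longlonglongrightarrow>
      entropy_rate X + real l * ?a * 0 + ?c"
    by (intro tendsto_intros entropy_rate_tendsto X lim_1_over_n)
  then have "(\<lambda>n. label_entropy (itinerary T X n) / real n + real l * ?a * (1 / real n) + ?c) \<longlonglongrightarrow>
      entropy_rate X + ?c" by simp
  then show ?thesis
    by (rule LIMSEQ_le[OF entropy_rate_tendsto[OF Y]]) (use bound in \<open>auto intro!: exI[of _ 1]\<close>)
qed

end

lemma xlnx_bound_one:
  fixes t :: real assumes "0 \<le> t" shows "- t * ln t \<le> 1 - t"
proof (cases "t = 0")
  case False
  then have "ln (1 / t) \<le> 1 / t - 1" using assms by (intro ln_le_minus_one) simp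
  then have "t * ln (1 / t) \<le> t * (1 / t - 1)" using assms by (rule mult_left_mono)
  then show ?thesis using False assms by (simp add: ln_div algebra_simps)
qed simp

lemma xlnx_bound_zero:
  fixes t e :: real assumes "0 \<le> t" "0 < e" shows "- t * ln t \<le> e + t / e"
proof (cases "t = 0")
  case False
  then have t: "0 < t" "0 < sqrt t" using assms by auto
  have "ln (1 / sqrt t) \<le> 1 / sqrt t - 1" using t by (intro ln_le_minus_one) simp
  then have "2 * t * ln (1 / sqrt t) \<le> 2 * t * (1 / sqrt t)"
    using t by (intro mult_left_mono) auto
  moreover have "2 * t * ln (1 / sqrt t) = - t * ln t"
    using t by (simp add: ln_div ln_sqrt)
  moreover have "2 * t * (1 / sqrt t) = 2 * sqrt t"
    using t real_div_sqrt[of t] by simp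
  moreover have "2 * sqrt t \<le> e + t / e"
  proof -
    have "0 \<le> (e - sqrt t)\<^sup>2 / e" using assms by simp
    also have "\<dots> = e + t / e - 2 * sqrt t"
      using assms t by (simp add: power2_diff field_simps power2_eq_square[of e])
    finally show ?thesis by simp
  qed
  ultimately show ?thesis by simp
qed (use assms in simp)

text \<open>
  The left-hand side is \<open>- q t ln t\<close> for the conditional probability \<open>t = p / q\<close>. It is small when
  \<open>t\<close> is close to 0 or to 1, which \<open>d\<close> measures.
\<close>
lemma xlnx_quotient_bound:
  fixes p q d e :: real
  assumes "0 \<le> p" "p \<le> q" "0 < e" "e \<le> 1" "d = min p (q - p)"
  shows "p * ln q - p * ln p \<le> e * q + d / e"
proof (cases "p = 0")
  case True
  then show ?thesis using assms by simp
next
  case False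
  then have pos: "0 < p" "0 < q" using assms by auto
  have eq: "p * ln q - p * ln p = q * (- (p / q) * ln (p / q))"
    using pos by (simp add: ln_div algebra_simps)
  have "q * (- (p / q) * ln (p / q)) \<le> q * (e + (p / q) / e)"
    using pos assms by (intro mult_left_mono xlnx_bound_zero) auto
  moreover have "q * (- (p / q) * ln (p / q)) \<le> q * (1 - p / q)"
    using pos by (intro mult_left_mono xlnx_bound_one) auto
  moreover have "q * (1 - p / q) = q - p" using pos by (simp add: field_simps)
  moreover have "(q - p) * 1 \<le> (q - p) * (1 / e)" using assms by (intro mult_left_mono) auto
  moreover have "q * (e + (p / q) / e) = e * q + p / e" using pos by (simp add: field_simps)
  moreover have "0 \<le> e * q" using pos assms by simp
  ultimately show ?thesis using assms(5) unfolding eq by (auto simp: min_def)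
qed

section \<open>Generating labels compute the Kolmogorov-Sinai entropy\<close>

context full_prob_space
begin

lemma sum_prob_label: "label Z \<Longrightarrow> (\<Sum>z\<in>range Z. prob (Z -` {z})) = 1"
  using prob_marginal[OF sets.top, of Z] prob_space by (simp add: space_UNIV)

lemma cond_entropy_eq:
  assumes Y: "label Y" and Z: "label Z"
  defines "p \<equiv> \<lambda>y z. prob (Z -` {z} \<inter> Y -` {y})" and "q \<equiv> \<lambda>z. prob (Z -` {z})"
  shows "cond_entropy Y Z = (\<Sum>y\<in>range Y. \<Sum>z\<in>range Z. p y z * ln (q z) - p y z * ln (p y z))"
proof -
  have "(\<Sum>y\<in>range Y. \<Sum>z\<in>range Z. p y z * ln (q z)) = (\<Sum>z\<in>range Z. q z * ln (q z))"
    using prob_marginal[OF label_sets[OF Z] Y]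
    by (subst sum.swap) (simp add: sum_distrib_right p_def q_def)
  then show ?thesis
    unfolding cond_entropy_def label_entropy_pair[OF Y Z] label_entropy_def[of Z]
    by (simp add: sum_subtractf Int_commute p_def q_def)
qed

text \<open>
  A label that is almost determined by \<open>Z\<close>, in the sense that each of its fibres is up to small
  measure a union of fibres of \<open>Z\<close>, has small entropy given \<open>Z\<close>.
\<close>
lemma cond_entropy_le:
  assumes Y: "label Y" and Z: "label Z" and e: "0 < e" "e \<le> 1"
    and small: "\<And>y. (\<Sum>z\<in>range Z. min (prob (Z -` {z} \<inter> Y -` {y})) (prob (Z -` {z} - Y -` {y}))) \<le> d"
  shows "cond_entropy Y Z \<le> real (card (range Y)) * (e + d / e)"
proof -
  let ?p = "\<lambda>y z. prob (Z -` {z} \<inter> Y -` {y})" and ?q = "\<lambda>z. prob (Z -` {z})"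
  have diff: "?q z - ?p y z = prob (Z -` {z} - Y -` {y})" for y z
    using finite_measure_Diff'[OF label_sets[OF Z] label_sets[OF Y], of z y] by simp
  have term_le: "?p y z * ln (?q z) - ?p y z * ln (?p y z) \<le>
      e * ?q z + min (?p y z) (prob (Z -` {z} - Y -` {y})) / e" for y z
    using e label_sets[OF Z] by (intro xlnx_quotient_bound) (auto simp: diff intro!: finite_measure_mono)
  have "cond_entropy Y Z = (\<Sum>y\<in>range Y. \<Sum>z\<in>range Z. ?p y z * ln (?q z) - ?p y z * ln (?p y z))"
    by (rule cond_entropy_eq[OF Y Z])
  also have "\<dots> \<le> (\<Sum>y\<in>range Y. \<Sum>z\<in>range Z. e * ?q z + min (?p y z) (prob (Z -` {z} - Y -` {y})) / e)"
    by (intro sum_mono term_le)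
  also have "\<dots> \<le> (\<Sum>y\<in>range Y. e + d / e)"
  proof (rule sum_mono)
    fix y
    have "(\<Sum>z\<in>range Z. e * ?q z + min (?p y z) (prob (Z -` {z} - Y -` {y})) / e) =
       e + (\<Sum>z\<in>range Z. min (?p y z) (prob (Z -` {z} - Y -` {y}))) / e"
      using sum_prob_label[OF Z] by (simp add: sum.distrib sum_distrib_left[symmetric] sum_divide_distrib)
    also have "\<dots> \<le> e + d / e" using small[of y] e by (simp add: divide_right_mono)
    finally show "(\<Sum>z\<in>range Z. e * ?q z + min (?p y z) (prob (Z -` {z} - Y -` {y})) / e) \<le> e + d / e" .
  qed
  finally show ?thesis by simp
qed

end

text \<open>
  Regularity, with a positive distance \<open>r\<close> from the compact inner set to the complement of the
  open outer set: a set of diameter less than \<open>r\<close> either misses \<open>K\<close> or lies in \<open>U\<close>.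
\<close>
lemma borel_sandwich:
  fixes M :: "'a::{second_countable_topology, complete_space} measure"
  assumes "finite_measure M" and sets: "sets M = sets borel" and B: "B \<in> sets borel" and d: "0 < d"
  obtains K U r where "compact K" "K \<subseteq> B" "B \<subseteq> U" "open U" "measure M (U - K) < d"
    "0 < r" "\<And>x y. x \<in> K \<Longrightarrow> dist x y < r \<Longrightarrow> y \<in> U"
proof -
  interpret finite_measure M by fact
  have fin: "emeasure M (space M) \<noteq> \<infinity>" by simp
  have "measure M B < measure M B + d / 2" using d by simp
  then have "emeasure M B < ennreal (measure M B + d / 2)"
    using d by (simp add: emeasure_eq_measure ennreal_less_iff)
  then obtain U where U: "B \<subseteq> U" "open U" "emeasure M U < ennreal (measure M B + d / 2)"
    unfolding outer_regular[OF sets fin B] INF_less_iff by auto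
  have "\<exists>K. K \<subseteq> B \<and> compact K \<and> measure M B - d / 2 < measure M K"
  proof (cases "measure M B - d / 2 < 0")
    case True
    then show ?thesis by (intro exI[of _ "{}"]) auto
  next
    case False
    then have "ennreal (measure M B - d / 2) < emeasure M B"
      using d by (simp add: emeasure_eq_measure ennreal_less_iff)
    then obtain K where "K \<subseteq> B" "compact K" "ennreal (measure M B - d / 2) < emeasure M K"
      unfolding inner_regular[OF sets fin B] less_SUP_iff by auto
    then show ?thesis using False by (auto simp: emeasure_eq_measure ennreal_less_iff)
  qed
  then obtain K where K: "K \<subseteq> B" "compact K" "measure M B - d / 2 < measure M K" by blast
  have "measure M U < measure M B + d / 2"
    using U(3) by (simp add: emeasure_eq_measure ennreal_less_iff)
  moreover have "measure M (U - K) = measure M U - measure M K"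
    using U K sets by (intro finite_measure_Diff) (auto intro: borel_compact)
  ultimately have "measure M (U - K) < d" using K(3) by simp
  moreover obtain r where "0 < r" "(\<Union>x\<in>K. ball x r) \<subseteq> U"
    using compact_subset_open_imp_ball_epsilon_subset[OF K(2) U(2)] U(1) K(1) by auto
  ultimately show ?thesis using K U by (intro that[of K U r]) (auto simp: subset_iff)
qed

definition generating :: "('a::metric_space \<Rightarrow> 'a) \<Rightarrow> ('a \<Rightarrow> 'b) \<Rightarrow> bool" where
  "generating T X \<longleftrightarrow> (\<forall>r>0. \<exists>n. \<forall>x y. itinerary T X n x = itinerary T X n y \<longrightarrow> dist x y < r)"

lemma generating_eventually:
  assumes "generating T X" "0 < r"
  shows "\<exists>n0. \<forall>n\<ge>n0. \<forall>x y. itinerary T X n x = itinerary T X n y \<longrightarrow> dist x y < r"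
proof -
  obtain n0 where n0: "\<And>x y. itinerary T X n0 x = itinerary T X n0 y \<Longrightarrow> dist x y < r"
    using assms unfolding generating_def by blast
  have "dist x y < r" if "n0 \<le> n" "itinerary T X n x = itinerary T X n y" for n x y
  proof (rule n0)
    show "itinerary T X n0 x = itinerary T X n0 y"
      using arg_cong[OF that(2), of "take n0"] that(1) by (simp add: take_itinerary)
  qed
  then show ?thesis by blast
qed

text \<open>
  Long cylinders of \<open>X\<close> have diameter below the distance provided by \<open>borel_sandwich\<close> for each
  fibre of \<open>Y\<close>. A cylinder can then split a fibre of \<open>Y\<close> only inside the thin set between \<open>K\<close> and \<open>U\<close>.
\<close>
lemma cond_entropy_generator_small:
  fixes M :: "'a::{second_countable_topology, complete_space} measure"
  assumes "measure_preserving_map M T" and sets: "sets M = sets borel"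
    and X: "full_prob_space.label M X" and Y: "full_prob_space.label M Y" and gen: "generating T X"
    and c: "0 < c"
  shows "\<exists>l. full_prob_space.cond_entropy M Y (itinerary T X l) < c"
proof -
  interpret measure_preserving_map M T by fact
  define N where "N = real (card (range Y)) + 1"
  have N: "1 \<le> N" by (simp add: N_def)
  define e where "e = min 1 (c / (4 * N))"
  have e: "0 < e" "e \<le> 1" "e \<le> c / (4 * N)" using c N by (auto simp: e_def)
  have ex: "\<exists>n0. \<forall>n\<ge>n0. (\<Sum>z\<in>range (itinerary T X n).
      min (prob (itinerary T X n -` {z} \<inter> Y -` {y})) (prob (itinerary T X n -` {z} - Y -` {y}))) \<le> e * e" for y
  proof -
    have "Y -` {y} \<in> sets borel" using label_sets[OF Y] sets by simp
    then obtain K U r where K: "compact K" "K \<subseteq> Y -` {y}" "Y -` {y} \<subseteq> U" "open U" "measure M (U - K) < e * e"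
      "0 < r" "\<And>x y. x \<in> K \<Longrightarrow> dist x y < r \<Longrightarrow> y \<in> U"
      using borel_sandwich[OF finite_measure_axioms sets, of _ "e * e"] e by (metis mult_pos_pos)
    from generating_eventually[OF gen K(6)]
    obtain n0 where n0: "\<forall>n\<ge>n0. \<forall>x y. itinerary T X n x = itinerary T X n y \<longrightarrow> dist x y < r" ..
    have UK: "U - K \<in> sets M" using K sets by (auto intro: borel_compact)
    have "(\<Sum>z\<in>range (itinerary T X n).
      min (prob (itinerary T X n -` {z} \<inter> Y -` {y})) (prob (itinerary T X n -` {z} - Y -` {y}))) \<le> e * e" if "n0 \<le> n" for n
    proof -
      let ?Z = "itinerary T X n"
      have lab: "label ?Z" by (rule label_itinerary) fact
      have "min (prob (?Z -` {z} \<inter> Y -` {y})) (prob (?Z -` {z} - Y -` {y})) \<le> prob ((U - K) \<inter> ?Z -` {z})" for z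
      proof (cases "?Z -` {z} \<inter> K = {}")
        case True
        then have "?Z -` {z} \<inter> Y -` {y} \<subseteq> (U - K) \<inter> ?Z -` {z}" using K by auto
        then have "prob (?Z -` {z} \<inter> Y -` {y}) \<le> prob ((U - K) \<inter> ?Z -` {z})"
          using UK label_sets[OF lab] by (intro finite_measure_mono) auto
        then show ?thesis by simp
      next
        case False
        then obtain x where "x \<in> K" "?Z x = z" by auto
        have "?Z -` {z} - Y -` {y} \<subseteq> (U - K) \<inter> ?Z -` {z}"
        proof
          fix u assume u: "u \<in> ?Z -` {z} - Y -` {y}"
          then have "?Z x = ?Z u" using \<open>?Z x = z\<close> by simp
          then have "dist x u < r" using n0 that by blast
          then have "u \<in> U" by (rule K(7)[OF \<open>x \<in> K\<close>])
          then show "u \<in> (U - K) \<inter> ?Z -` {z}" using u K(2) by blast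
        qed
        then have "prob (?Z -` {z} - Y -` {y}) \<le> prob ((U - K) \<inter> ?Z -` {z})"
          using UK label_sets[OF lab] by (intro finite_measure_mono) auto
        then show ?thesis by simp
      qed
      then have "(\<Sum>z\<in>range ?Z. min (prob (?Z -` {z} \<inter> Y -` {y})) (prob (?Z -` {z} - Y -` {y})))
          \<le> (\<Sum>z\<in>range ?Z. prob ((U - K) \<inter> ?Z -` {z}))"
        by (rule sum_mono)
      also have "\<dots> = prob (U - K)" using prob_marginal[OF UK lab] by simp
      also have "\<dots> \<le> e * e" using K by simp
      finally show ?thesis .
    qed
    then show ?thesis by blast
  qed
  from choice[OF allI, OF ex] obtain n0 where n0': "\<forall>y. \<forall>n\<ge>n0 y. (\<Sum>z\<in>range (itinerary T X n).
      min (prob (itinerary T X n -` {z} \<inter> Y -` {y})) (prob (itinerary T X n -` {z} - Y -` {y}))) \<le> e * e" ..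
  have n0: "\<And>y n. n0 y \<le> n \<Longrightarrow> (\<Sum>z\<in>range (itinerary T X n).
      min (prob (itinerary T X n -` {z} \<inter> Y -` {y})) (prob (itinerary T X n -` {z} - Y -` {y}))) \<le> e * e"
    using n0' by simp
  define n where "n = Max (n0 ` range Y)"
  have "(\<Sum>z\<in>range (itinerary T X n).
      min (prob (itinerary T X n -` {z} \<inter> Y -` {y})) (prob (itinerary T X n -` {z} - Y -` {y}))) \<le> e * e" for y
  proof (cases "y \<in> range Y")
    case True
    then have "n0 y \<le> n" unfolding n_def using label_finite[OF Y] by (intro Max_ge) auto
    then show ?thesis by (rule n0)
  next
    case False
    then have "Y -` {y} = {}" by auto
    then show ?thesis using e by (simp add: sum.neutral)
  qed
  then have "cond_entropy Y (itinerary T X n) \<le> real (card (range Y)) * (e + e * e / e)"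
    using e by (intro cond_entropy_le Y label_itinerary X)
  also have "\<dots> \<le> N * (2 * (c / (4 * N)))"
    using e N by (intro mult_mono) (auto simp: N_def)
  also have "\<dots> < c" using N c by simp
  finally show ?thesis by blast
qed

text \<open>
  The core of the Kolmogorov-Sinai theorem: no label has a larger entropy rate than a
  generating one.
\<close>
lemma entropy_rate_le_generator:
  fixes M :: "'a::{second_countable_topology, complete_space} measure"
  assumes "measure_preserving_map M T" and sets: "sets M = sets borel"
    and X: "full_prob_space.label M X" and Y: "full_prob_space.label M Y" and gen: "generating T X"
  shows "measure_preserving_map.entropy_rate M T Y \<le> measure_preserving_map.entropy_rate M T X"
proof (rule field_le_epsilon)
  interpret measure_preserving_map M T by fact
  fix c :: real assume "0 < c"
  then obtain l where "cond_entropy Y (itinerary T X l) < c"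
    using cond_entropy_generator_small[OF assms] by blast
  then show "entropy_rate Y \<le> entropy_rate X + c"
    using entropy_rate_le_add_cond[OF X Y, of l] by simp
qed

definition atoms :: "('a \<Rightarrow> 'b) \<Rightarrow> 'a set set" where
  "atoms X = (\<lambda>v. X -` {v}) ` range X"

lemma iterated_join_atoms: "iterated_join T n (atoms X) = atoms (itinerary T X n)"
proof -
  have vim: "itinerary T X n -` {map v [0..<n]} = (\<Inter>j<n. (T ^^ j) -` (X -` {v j}))" for v
    by (auto simp: itinerary_def)
  show ?thesis
  proof (intro subset_antisym subsetI)
    fix B assume "B \<in> iterated_join T n (atoms X)"
    then obtain A where A: "B = (\<Inter>j<n. (T ^^ j) -` A j)" "\<And>j. j < n \<Longrightarrow> A j \<in> atoms X" "B \<noteq> {}"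
      by (auto simp: iterated_join_def)
    then have "\<forall>j. \<exists>v. j < n \<longrightarrow> A j = X -` {v}" by (auto simp: atoms_def)
    then obtain v where v: "\<And>j. j < n \<Longrightarrow> A j = X -` {v j}" by metis
    have B: "B = itinerary T X n -` {map v [0..<n]}" unfolding vim A(1) using v by simp
    then obtain x where "itinerary T X n x = map v [0..<n]" using A(3) by blast
    then have "B = itinerary T X n -` {itinerary T X n x}" using B by simp
    then show "B \<in> atoms (itinerary T X n)" unfolding atoms_def by (rule image_eqI) simp
  next
    fix B assume "B \<in> atoms (itinerary T X n)"
    then obtain x where x: "B = itinerary T X n -` {itinerary T X n x}" by (auto simp: atoms_def)
    define A where "A = (\<lambda>j. X -` {X ((T ^^ j) x)})"
    have "B = (\<Inter>j<n. (T ^^ j) -` A j)"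
      unfolding x A_def vim[symmetric] by (simp only: itinerary_def)
    moreover have "\<forall>j<n. A j \<in> atoms X" by (auto simp: A_def atoms_def)
    ultimately have "B \<in> {\<Inter>j<n. (T ^^ j) -` A j | A. \<forall>j<n. A j \<in> atoms X}"
      by (intro CollectI exI[of _ A] conjI)
    moreover have "B \<noteq> {}" using x by blast
    ultimately show "B \<in> iterated_join T n (atoms X)"
      by (simp add: iterated_join_def)
  qed
qed

lemma partition_entropy_atoms:
  fixes X :: "circle \<Rightarrow> 'b"
  shows "partition_entropy m (atoms X) =
    - (\<Sum>v\<in>range X. measure m (X -` {v}) * ln (measure m (X -` {v})))"
  unfolding partition_entropy_def atoms_def
  by (subst sum.reindex) (auto simp: inj_on_def)

text \<open>
  Every partition consists of the fibres of a label, namely the map that sends a point to the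
  part containing it.
\<close>
lemma atoms_of_partition:
  assumes "partition_on UNIV \<xi>"
  shows "atoms (\<lambda>x. THE A. A \<in> \<xi> \<and> x \<in> A) = \<xi>"
    and "A \<in> \<xi> \<Longrightarrow> (\<lambda>x. THE A. A \<in> \<xi> \<and> x \<in> A) -` {A} = A"
    and "range (\<lambda>x. THE A. A \<in> \<xi> \<and> x \<in> A) = \<xi>"
proof -
  let ?Y = "\<lambda>x. THE A. A \<in> \<xi> \<and> x \<in> A"
  have ex1: "\<exists>!A. A \<in> \<xi> \<and> x \<in> A" for x
    using assms unfolding partition_on_def disjoint_def by blast
  have Y: "?Y x \<in> \<xi>" "x \<in> ?Y x" for x
    using theI'[OF ex1[of x]] by auto
  have Yeq: "?Y x = A" if "A \<in> \<xi>" "x \<in> A" for x A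
    using ex1[of x] that by (intro the1_equality) auto
  show vim: "?Y -` {A} = A" if "A \<in> \<xi>" for A
    using Y(2) Yeq[OF that] by blast
  show ran: "range ?Y = \<xi>"
  proof
    show "\<xi> \<subseteq> range ?Y"
    proof
      fix A assume A: "A \<in> \<xi>"
      then have "A \<noteq> {}" using partition_onD3[OF assms] by blast
      then obtain x where "x \<in> A" by blast
      then show "A \<in> range ?Y" using Yeq[OF A] by (intro image_eqI[of _ _ x]) auto
    qed
  qed (use Y in auto)
  show "atoms ?Y = \<xi>"
    unfolding atoms_def ran using vim by (simp cong: image_cong)
qed

lemma invariant_measuresD:
  assumes "m \<in> invariant_measures T"
  shows "measure_preserving_map m T" "sets m = sets borel"
proof -
  show s: "sets m = sets borel" using assms by (simp add: invariant_measures_def borel_probability_def)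
  then have "space m = UNIV" using sets_eq_imp_space_eq by force
  then show "measure_preserving_map m T"
    using assms unfolding measure_preserving_map_def full_prob_space_def
      full_prob_space_axioms_def measure_preserving_map_axioms_def
    by (auto simp: invariant_measures_def borel_probability_def)
qed

lemma entropy_wrt_atoms:
  assumes "measure_preserving_map m T" "full_prob_space.label m X"
  shows "entropy_wrt m T (atoms X) = ereal (measure_preserving_map.entropy_rate m T X)"
proof -
  interpret measure_preserving_map m T by fact
  show ?thesis
    unfolding entropy_wrt_def iterated_join_atoms partition_entropy_atoms label_entropy_def[symmetric]
    by (intro limI) (simp add: entropy_rate_tendsto assms(2))
qed

theorem KS_entropy_generator:
  assumes m: "m \<in> invariant_measures T" and X: "full_prob_space.label m X" and gen: "generating T X"
  shows "KS_entropy m T = ereal (measure_preserving_map.entropy_rate m T X)"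
proof -
  note mp = invariant_measuresD(1)[OF m] and sets = invariant_measuresD(2)[OF m]
  interpret measure_preserving_map m T by (rule mp)
  show ?thesis unfolding KS_entropy_def
  proof (intro antisym SUP_least)
    fix \<xi> assume "\<xi> \<in> finite_partitions m"
    then have xi: "finite \<xi>" "\<xi> \<subseteq> sets m" "partition_on UNIV \<xi>"
      by (auto simp: finite_partitions_def space_UNIV)
    define Y where "Y = (\<lambda>x. THE A. A \<in> \<xi> \<and> x \<in> A)"
    note Y = atoms_of_partition[OF xi(3), folded Y_def]
    have "Y -` {A} \<in> sets m" for A
    proof (cases "A \<in> \<xi>")
      case False
      then have "Y -` {A} = {}" using Y(3) by auto
      then show ?thesis by simp
    qed (use Y(2) xi in auto)
    then have "label Y" unfolding label_def using Y(3) xi by simp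
    then show "entropy_wrt m T \<xi> \<le> ereal (entropy_rate X)"
      using entropy_wrt_atoms[OF mp, of Y] entropy_rate_le_generator[OF mp sets X _ gen, of Y]
      unfolding Y(1) by simp
  next
    have "atoms X \<in> finite_partitions m"
      using label_finite[OF X] label_sets[OF X]
      by (auto simp: finite_partitions_def atoms_def space_UNIV partition_on_def disjoint_def)
    then show "ereal (entropy_rate X) \<le> (SUP \<xi>\<in>finite_partitions m. entropy_wrt m T \<xi>)"
      using entropy_wrt_atoms[OF mp X] by (metis SUP_upper)
  qed
qed

section \<open>The inverse branches of a map with an indifferent fixed point\<close>

text \<open>
  The only facts about the map that the thermodynamic part uses: continuity, finitely many measurable
  inverse branches \<open>\<tau> 0, \<dots>, \<tau> N\<close>, each defined on the whole circle, whose images are told apart by a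
  generating digit, and injectivity at small scales.
\<close>
locale full_branch_map =
  fixes T :: "circle \<Rightarrow> circle" and \<tau> :: "nat \<Rightarrow> circle \<Rightarrow> circle" and digit :: "circle \<Rightarrow> nat" and N :: nat
  assumes T_continuous: "continuous_on UNIV T"
    and T_branch: "i \<le> N \<Longrightarrow> T (\<tau> i x) = x"
    and digit_branch: "i \<le> N \<Longrightarrow> digit (\<tau> i x) = i"
    and branch_digit: "\<tau> (digit x) (T x) = x"
    and digit_le: "digit x \<le> N"
    and branch_measurable: "\<tau> i \<in> borel_measurable borel"
    and digit_sets: "digit -` {i} \<in> sets borel"
    and generating_digit: "generating T digit"
    and locally_injective: "\<exists>r>0. \<forall>u v. dist u v < r \<longrightarrow> T u = T v \<longrightarrow> u = v"

locale indifferent_map =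
  fixes T :: "circle \<Rightarrow> circle" and V :: "real \<Rightarrow> real" and N :: nat
  assumes T_cont: "continuous_on UNIV T"
    and V_nonneg: "0 \<le> t \<Longrightarrow> 0 \<le> V t"
    and V_cont: "continuous_on {0..} V"
    and V_mono: "0 \<le> s \<Longrightarrow> s \<le> t \<Longrightarrow> V s \<le> V t"
    and V_pos: "0 < t \<Longrightarrow> 0 < V t"
    and V_1: "V 1 = real N"
    and coord_T: "coord (T x) = frac (coord x * (1 + V (coord x)))"
begin

text \<open>
  The lift of \<open>T\<close> to the real line, restricted to the half-line. Its integer part on the unit
  interval is the digit, and its fractional part is \<open>T\<close>.
\<close>
definition F :: "real \<Rightarrow> real" where "F t = t * (1 + V t)"

lemma F_0: "F 0 = 0" and F_1: "F 1 = real N + 1"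
  by (simp_all add: F_def V_1)

lemma F_continuous: "continuous_on {0..} F"
  unfolding F_def by (intro continuous_intros V_cont)

text \<open>
  An interval of length \<open>d\<close> is stretched least when it starts at the indifferent fixed point,
  because \<open>V\<close> is increasing.
\<close>
lemma F_diff:
  assumes "0 \<le> s" "s \<le> t" shows "F (t - s) \<le> F t - F s"
proof -
  have "(t - s) * V (t - s) \<le> (t - s) * V t"
    using assms by (intro mult_left_mono V_mono) auto
  moreover have "s * V s \<le> s * V t"
    using assms by (intro mult_left_mono V_mono) auto
  ultimately show ?thesis by (simp add: F_def algebra_simps)
qed

lemma F_ge: "0 \<le> t \<Longrightarrow> t \<le> F t"
  using V_nonneg[of t] by (simp add: F_def algebra_simps)

lemma F_less_iff: "0 \<le> s \<Longrightarrow> 0 \<le> t \<Longrightarrow> F s < F t \<longleftrightarrow> s < t"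
  using F_diff[of s t] F_diff[of t s] F_ge[of "t - s"] F_ge[of "s - t"] by linarith

lemma F_eq_iff: "0 \<le> s \<Longrightarrow> 0 \<le> t \<Longrightarrow> F s = F t \<longleftrightarrow> s = t"
  using F_less_iff[of s t] F_less_iff[of t s] by linarith

lemma F_le_iff: "0 \<le> s \<Longrightarrow> 0 \<le> t \<Longrightarrow> F s \<le> F t \<longleftrightarrow> s \<le> t"
  using F_less_iff[of t s] by linarith

lemma F_coord: "0 \<le> F (coord x)" "F (coord x) < real N + 1"
  using F_less_iff[of "coord x" 1] F_ge[of "coord x"] coord_bounds[of x] by (simp_all add: F_1)

lemma F_image: "F ` {0..1} = {0..real N + 1}"
proof
  show "F ` {0..1} \<subseteq> {0..real N + 1}"
  proof
    fix s assume "s \<in> F ` {0..1}"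
    then obtain t where "s = F t" "0 \<le> t" "t \<le> 1" by auto
    then show "s \<in> {0..real N + 1}"
      using F_le_iff[of t 1] F_le_iff[of 0 t] by (simp add: F_0 F_1)
  qed
  show "{0..real N + 1} \<subseteq> F ` {0..1}"
  proof
    fix s assume "s \<in> {0..real N + 1}"
    moreover have "continuous_on {0..1} F"
      using F_continuous by (rule continuous_on_subset) auto
    ultimately obtain t where "0 \<le> t" "t \<le> 1" "F t = s"
      using IVT'[of F 0 s 1] by (auto simp: F_0 F_1)
    then show "s \<in> F ` {0..1}" by auto
  qed
qed

lemma F_inj: "inj_on F {0..1}"
  by (auto simp: inj_on_def F_eq_iff)

definition G :: "real \<Rightarrow> real" where "G = the_inv_into {0..1} F"

lemma G:
  assumes "0 \<le> s" "s \<le> real N + 1"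
  shows "0 \<le> G s" "G s \<le> 1" "F (G s) = s"
  using assms the_inv_into_into[OF F_inj, of s "{0..1}"] f_the_inv_into_f[OF F_inj, of s]
  by (auto simp: F_image G_def)

lemma G_F: "0 \<le> t \<Longrightarrow> t \<le> 1 \<Longrightarrow> G (F t) = t"
  by (simp add: G_def the_inv_into_f_f[OF F_inj])

lemma G_continuous: "continuous_on {0..real N + 1} G"
  unfolding G_def F_image[symmetric]
  by (intro continuous_on_inv_into F_inj continuous_on_subset[OF F_continuous]) auto

definition digit :: "circle \<Rightarrow> nat" where "digit x = nat \<lfloor>F (coord x)\<rfloor>"

text \<open>
  Truncation at \<open>N + 1\<close> is inactive for \<open>i \<le> N\<close>. It keeps the argument inside the domain of \<open>G\<close>, so
  that \<open>branch i\<close> is measurable for every \<open>i\<close>.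
\<close>
definition branch :: "nat \<Rightarrow> circle \<Rightarrow> circle" where
  "branch i x = wrap (G (min (coord x + real i) (real N + 1)))"

lemma coord_T_digit: "coord (T x) = F (coord x) - real (digit x)"
  using F_coord[of x] by (simp add: coord_T F_def[symmetric] digit_def frac_def)

lemma digit_le_N: "digit x \<le> N"
  using F_coord[of x] by (simp add: digit_def nat_le_iff floor_le_iff)

lemma coord_branch:
  assumes "i \<le> N" shows "coord (branch i x) = G (coord x + real i)" "F (coord (branch i x)) = coord x + real i"
proof -
  have s: "0 \<le> coord x + real i" "coord x + real i < real N + 1"
    using coord_bounds[of x] assms by auto
  then have "F (G (coord x + real i)) < F 1" using G by (simp add: F_1)
  then have "G (coord x + real i) < 1" using F_less_iff[of _ 1] G(1) s by simp
  then show "coord (branch i x) = G (coord x + real i)"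
    using G(1) s by (simp add: branch_def min_absorb1 coord_wrap frac_eq[THEN iffD2])
  then show "F (coord (branch i x)) = coord x + real i" using G(3) s by simp
qed

lemma digit_of_branch:
  assumes "i \<le> N" shows "digit (branch i x) = i"
proof -
  have "\<lfloor>coord x + real i\<rfloor> = int i"
    using coord_bounds[of x] by (intro floor_unique) auto
  then show ?thesis by (simp add: digit_def coord_branch(2)[OF assms])
qed

lemma T_of_branch:
  assumes "i \<le> N" shows "T (branch i x) = x"
  using coord_T_digit[of "branch i x"] coord_branch(2)[OF assms] digit_of_branch[OF assms]
  by (simp add: coord_inject)

lemma branch_of_digit: "branch (digit x) (T x) = x"
  using coord_bounds[of x] F_coord[of x] by (simp add: branch_def coord_T_digit G_F wrap_coord)

lemma coord_diff_expands:
  assumes "digit x = digit y"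
  shows "F \<bar>coord x - coord y\<bar> \<le> \<bar>coord (T x) - coord (T y)\<bar>"
  using F_diff[of "coord x" "coord y"] F_diff[of "coord y" "coord x"] coord_bounds assms
  by (cases "coord x \<le> coord y") (auto simp: coord_T_digit)

text \<open>
  A bound for the length of the intervals on which the first \<open>n\<close> digits are constant. Such an
  interval is mapped onto one of order \<open>n - 1\<close>, and \<open>F_diff\<close> bounds its length from above by
  \<open>G\<close> of the length of the image.
\<close>
fun cylinder_bound :: "nat \<Rightarrow> real" where
  "cylinder_bound 0 = 1"
| "cylinder_bound (Suc n) = G (cylinder_bound n)"

lemma cylinder_bound_range: "0 \<le> cylinder_bound n" "cylinder_bound n \<le> 1"
proof (induction n)
  case (Suc n)
  { case 1 then show ?case using Suc G(1) by simp }
  { case 2 then show ?case using Suc G(2) by simp }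
qed simp_all

lemma F_cylinder_bound: "F (cylinder_bound (Suc n)) = cylinder_bound n"
  using G(3) cylinder_bound_range[of n] by simp

text \<open>
  The bounds decrease to a fixed point of \<open>F\<close>, and 0 is the only one because \<open>V\<close> is positive
  elsewhere. Expansion is not uniform near the indifferent fixed point, so the limit is
  identified in this way instead of by a geometric bound.
\<close>
lemma cylinder_bound_tendsto_0: "cylinder_bound \<longlonglongrightarrow> 0"
proof -
  have "decseq cylinder_bound"
  proof (rule decseq_SucI)
    show "cylinder_bound (Suc n) \<le> cylinder_bound n" for n
      using F_ge[OF cylinder_bound_range(1)[of "Suc n"]] unfolding F_cylinder_bound .
  qed
  then obtain L where L: "cylinder_bound \<longlonglongrightarrow> L"
    by (rule decseq_convergent[of cylinder_bound 0]) (blast intro: cylinder_bound_range(1))+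
  have "0 \<le> L" by (rule LIMSEQ_le_const[OF L]) (use cylinder_bound_range(1) in blast)
  have "(\<lambda>n. cylinder_bound (Suc n)) \<longlonglongrightarrow> L" using L by (rule LIMSEQ_Suc)
  then have "(\<lambda>n. F (cylinder_bound (Suc n))) \<longlonglongrightarrow> F L"
    by (rule continuous_on_tendsto_compose[OF F_continuous])
      (use \<open>0 \<le> L\<close> cylinder_bound_range(1)[of "Suc _"] in \<open>auto simp del: cylinder_bound.simps\<close>)
  then have "cylinder_bound \<longlonglongrightarrow> F L" unfolding F_cylinder_bound .
  then have "F L = L" using L by (rule LIMSEQ_unique)
  then have "L * V L = 0" by (simp add: F_def algebra_simps)
  then have "L = 0" using V_pos[of L] \<open>0 \<le> L\<close> by fastforce
  then show ?thesis using L by simp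
qed

lemma same_itinerary_close:
  "itinerary T digit n x = itinerary T digit n y \<Longrightarrow> \<bar>coord x - coord y\<bar> \<le> cylinder_bound n"
proof (induction n arbitrary: x y)
  case 0
  then show ?case using coord_bounds[of x] coord_bounds[of y] by simp
next
  case (Suc n)
  then have eq: "digit x = digit y" "itinerary T digit n (T x) = itinerary T digit n (T y)"
    by (simp_all add: itinerary_Suc)
  have "F \<bar>coord x - coord y\<bar> \<le> F (cylinder_bound (Suc n))"
    using coord_diff_expands[OF eq(1)] Suc.IH[OF eq(2)] unfolding F_cylinder_bound by linarith
  then show ?case using F_le_iff[OF _ cylinder_bound_range(1)] by (simp del: cylinder_bound.simps)
qed

lemma generating: "generating T digit"
  unfolding generating_def
proof safe
  fix r :: real assume "0 < r"
  then obtain n where "cylinder_bound n < r"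
    using order_tendstoD(2)[OF cylinder_bound_tendsto_0] by (auto simp: eventually_sequentially)
  then show "\<exists>n. \<forall>x y. itinerary T digit n x = itinerary T digit n y \<longrightarrow> dist x y < r"
    using order.strict_trans1[OF order.trans[OF dist_le_coord same_itinerary_close]] by blast
qed

text \<open>
  Two points with the same image have lifts differing by an integer. For close points the
  difference of the lifts is less than \<open>1 / 2\<close>, or, if the points lie on different sides of 0,
  strictly between \<open>N\<close> and \<open>N + 1\<close>.
\<close>
lemma locally_inj: "\<exists>r>0. \<forall>u v. dist u v < r \<longrightarrow> T u = T v \<longrightarrow> u = v"
proof -
  have "uniformly_continuous_on {0..1} F"
    by (intro compact_uniformly_continuous continuous_on_subset[OF F_continuous]) auto
  then obtain r where r: "r > 0" "\<And>s t. s \<in> {0..1} \<Longrightarrow> t \<in> {0..1} \<Longrightarrow> dist s t < r \<Longrightarrow> dist (F s) (F t) < 1 / 2"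
    using half_gt_zero[OF zero_less_one] unfolding uniformly_continuous_on_def by (metis dist_commute)
  have close: "\<bar>F s - F t\<bar> < 1 / 2" if "0 \<le> s" "s \<le> 1" "0 \<le> t" "t \<le> 1" "\<bar>s - t\<bar> < r" for s t
    using r(2)[of s t] that by (simp add: dist_real_def)
  have main: "u = v" if "dist u v < r" "T u = T v" "coord v \<le> coord u" for u v
  proof -
    define k where "k = int (digit u) - int (digit v)"
    have k: "F (coord u) - F (coord v) = real_of_int k"
      using that(2) coord_T_digit[of u] coord_T_digit[of v] by (simp add: k_def)
    have b: "0 \<le> coord u" "coord u < 1" "0 \<le> coord v" "coord v < 1" by (simp_all add: coord_bounds)
    have mono: "F (coord v) \<le> F (coord u)" using that(3) b by (simp add: F_le_iff)
    have "\<bar>coord u - coord v\<bar> < r \<or> 1 - (coord u - coord v) < r"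
      using that(1,3) b unfolding dist_circle_min by linarith
    then show ?thesis
    proof
      assume "\<bar>coord u - coord v\<bar> < r"
      then have "real_of_int k < 1 / 2" "0 \<le> real_of_int k" using close[of "coord u" "coord v"] b mono k by auto
      then have "k = 0" by linarith
      then show ?thesis using k b by (simp add: F_eq_iff coord_inject)
    next
      assume "1 - (coord u - coord v) < r"
      then have "\<bar>F (coord u) - F 1\<bar> < 1 / 2" "\<bar>F (coord v) - F 0\<bar> < 1 / 2"
        using b close[of "coord u" 1] close[of "coord v" 0] by auto
      moreover have "F (coord u) < F 1" "F 0 \<le> F (coord v)" using b by (simp_all add: F_less_iff F_le_iff)
      ultimately have "real N < real_of_int k" "real_of_int k < real N + 1"
        unfolding k[symmetric] F_0 F_1 by linarith+
      then have "real_of_int (int N) < real_of_int k" "real_of_int k < real_of_int (int N + 1)"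
        by simp_all
      then have "int N < k" "k < int N + 1" unfolding of_int_less_iff .
      then show ?thesis by simp
    qed
  qed
  have "u = v" if "dist u v < r" "T u = T v" for u v
    using main[of u v] main[of v u] that by (cases "coord v \<le> coord u") (auto simp: dist_commute)
  then show ?thesis using r(1) by blast
qed

lemma branch_meas: "branch i \<in> borel_measurable borel"
proof -
  have "continuous_on UNIV (\<lambda>s. G (max 0 (min (real N + 1) s)))"
    by (intro continuous_on_compose2[OF G_continuous] continuous_intros) auto
  then have [measurable]: "(\<lambda>s. G (max 0 (min (real N + 1) s))) \<in> borel_measurable borel"
    by (rule borel_measurable_continuous_onI)
  have "branch i = (\<lambda>x. wrap (G (max 0 (min (real N + 1) (coord x + real i)))))"
    using coord_bounds by (intro ext) (simp add: branch_def min.commute max.absorb2)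
  also have "\<dots> \<in> borel_measurable borel" by measurable
  finally show ?thesis .
qed

lemma digit_vimage_sets: "digit -` {i} \<in> sets borel"
proof -
  have "continuous_on UNIV (\<lambda>s. F (max 0 s))"
    by (intro continuous_on_compose2[OF F_continuous] continuous_intros) auto
  then have [measurable]: "(\<lambda>s. F (max 0 s)) \<in> borel_measurable borel"
    by (rule borel_measurable_continuous_onI)
  have "digit = (\<lambda>x. nat \<lfloor>F (max 0 (coord x))\<rfloor>)"
    by (simp add: digit_def fun_eq_iff max_absorb2 coord_bounds)
  also have "\<dots> \<in> measurable borel (count_space UNIV)" by measurable
  finally show ?thesis
    using measurable_sets[of digit borel "count_space UNIV" "{i}"] by simp
qed

lemma full_branch: "full_branch_map T branch digit N"
  by unfold_locales (simp_all add: T_cont T_of_branch digit_of_branch branch_of_digit digit_le_N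
    branch_meas digit_vimage_sets generating locally_inj)

end

lemma map_family_full_branch:
  assumes "T \<in> map_family"
  shows "\<exists>\<tau> digit N. full_branch_map T \<tau> digit N"
proof -
  obtain V :: "real \<Rightarrow> real" and N \<sigma> where cont: "continuous_on UNIV T"
    and V: "V \<in> {0..} \<rightarrow> {0..}" "continuous_on {0..} V" "mono_on {0..} V" "V 0 = 0"
    and N: "0 < N" "V 1 = real N"
    and lim: "\<And>t. 0 < t \<Longrightarrow> ((\<lambda>x. V (t * x) / V x) \<longlongrightarrow> t powr \<sigma>) (at_right 0)"
    and coord: "\<And>x. coord (T x) = frac (coord x * (1 + V (coord x)))"
    using assms unfolding map_family_def by blast
  have nonneg: "0 \<le> V t" if "0 \<le> t" for t using V(1) that by auto
  \<comment> \<open>If \<open>V\<close> vanished at some \<open>t > 0\<close> it would vanish near 0, and the quotients in the condition of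
    regular variation would be \<open>0 / 0 = 0\<close> instead of tending to \<open>1\<close> for the dilation factor 1.\<close>
  have pos: "0 < V t" if "0 < t" for t
  proof (rule ccontr)
    assume "\<not> 0 < V t"
    then have "V x = 0" if "0 < x" "x \<le> t" for x
      using nonneg[of x] mono_onD[OF V(3), of x t] that by simp
    then have "eventually (\<lambda>x. V (1 * x) / V x = 0) (at_right 0)"
      using \<open>0 < t\<close> by (auto simp: eventually_at_right_field intro!: exI[of _ t])
    then have "((\<lambda>x. V (1 * x) / V x) \<longlongrightarrow> 0) (at_right 0)" by (rule tendsto_eventually)
    moreover have "((\<lambda>x. V (1 * x) / V x) \<longlongrightarrow> 1) (at_right 0)" using lim[of 1] by simp
    ultimately have "(0::real) = 1" by (intro tendsto_unique[OF trivial_limit_at_right_real])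
    then show False by simp
  qed
  interpret indifferent_map T V N
    by unfold_locales (use cont V(2) N pos nonneg mono_onD[OF V(3)] coord in auto)
  show ?thesis using full_branch by blast
qed

section \<open>Measures fixed by a normalised transfer operator\<close>

context full_branch_map
begin

lemma preimages: "T -` {x} = (\<lambda>i. \<tau> i x) ` {..N}" "inj_on (\<lambda>i. \<tau> i x) {..N}"
proof -
  show "T -` {x} = (\<lambda>i. \<tau> i x) ` {..N}"
  proof
    show "T -` {x} \<subseteq> (\<lambda>i. \<tau> i x) ` {..N}"
    proof
      fix y assume "y \<in> T -` {x}"
      then have "y = \<tau> (digit y) x" using branch_digit[of y] by simp
      then show "y \<in> (\<lambda>i. \<tau> i x) ` {..N}" using digit_le by blast
    qed
  qed (auto simp: T_branch)
  show "inj_on (\<lambda>i. \<tau> i x) {..N}"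
    using digit_branch by (intro inj_on_inverseI[of _ digit]) auto
qed

lemma transfer_branches:
  fixes \<phi> :: "circle \<Rightarrow> real"
  shows "transfer T f \<phi> x = (\<Sum>i\<le>N. exp (f (\<tau> i x)) * \<phi> (\<tau> i x))"
  unfolding transfer_def preimages(1) by (simp add: sum.reindex[OF preimages(2)])

lemma T_borel: "T \<in> borel_measurable borel"
  using T_continuous by (rule borel_measurable_continuous_onI)

lemma transfer_measurable:
  fixes \<phi> :: "circle \<Rightarrow> real"
  assumes [measurable]: "f \<in> borel_measurable borel" "\<phi> \<in> borel_measurable borel"
  shows "transfer T f \<phi> \<in> borel_measurable borel"
proof -
  note [measurable] = branch_measurable
  show ?thesis unfolding transfer_branches[abs_def] by measurable
qed

lemma range_digit: "range digit = {..N}"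
  using digit_le digit_branch by (auto simp: image_def) metis

lemma itinerary_branch:
  "i \<le> N \<Longrightarrow> itinerary T digit (Suc n) (\<tau> i x) = i # itinerary T digit n x"
  by (simp add: itinerary_Suc digit_branch T_branch)

lemma range_itinerary_shift: "range (\<lambda>x. itinerary T digit n (T x)) = range (itinerary T digit n)"
proof -
  have "range T = UNIV" using T_branch[of 0] by (metis surj_def le0)
  then show ?thesis by (metis image_image)
qed

text \<open>
  Uniform continuity through the coding: continuous functions are almost constant on long
  cylinders.
\<close>
lemma small_variation:
  fixes \<phi> :: "circle \<Rightarrow> real"
  assumes "continuous_on UNIV \<phi>" "0 < e"
  shows "eventually (\<lambda>n. \<forall>x y. itinerary T digit n x = itinerary T digit n y \<longrightarrow> \<bar>\<phi> x - \<phi> y\<bar> \<le> e) sequentially"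
proof -
  obtain r where r: "0 < r" "\<And>x y. dist x y < r \<Longrightarrow> dist (\<phi> x) (\<phi> y) < e"
    using uniformly_continuous_circle[OF assms(1)] assms(2) unfolding uniformly_continuous_on_def
    by (auto simp: dist_commute)
  from generating_eventually[OF generating_digit r(1)] obtain n0 where
    "\<forall>n\<ge>n0. \<forall>x y. itinerary T digit n x = itinerary T digit n y \<longrightarrow> dist x y < r" ..
  then show ?thesis
    unfolding eventually_sequentially using r(2) by (intro exI[of _ n0]) (force simp: dist_real_def)
qed

lemma label_digit:
  assumes "full_prob_space m" "sets m = sets borel"
  shows "full_prob_space.label m digit"
  using assms digit_sets range_digit by (simp add: full_prob_space.label_def[OF assms(1)])

end

lemma borel_probabilityD:
  assumes "borel_probability m"
  shows "full_prob_space m" "sets m = sets borel" "space m = UNIV" "prob_space m"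
  using assms sets_eq_imp_space_eq[of m borel]
  by (auto simp: borel_probability_def full_prob_space_def full_prob_space_axioms_def)

lemma integrable_bounded_borel:
  fixes \<phi> :: "circle \<Rightarrow> real"
  assumes "borel_probability m" "\<phi> \<in> borel_measurable borel" "\<And>x. \<bar>\<phi> x\<bar> \<le> B"
  shows "integrable m \<phi>"
proof -
  note m = borel_probabilityD[OF assms(1)]
  interpret prob_space m by (rule m)
  show ?thesis
    using assms(2,3) m(2) by (intro integrable_const_bound[of _ B]) (auto simp: measurable_def m sets_eq_imp_space_eq)
qed

lemma integrable_continuous_circle:
  fixes \<phi> :: "circle \<Rightarrow> real"
  assumes "borel_probability m" "continuous_on UNIV \<phi>"
  shows "integrable m \<phi>"
  using bounded_circle[OF assms(2)] integrable_bounded_borel[OF assms(1)]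
    borel_measurable_continuous_onI[OF assms(2)] by metis

text \<open>
  Normalisation makes the transfer operator an averaging operator, and \<open>exp \<psi>\<close> gives the transition
  probabilities from a point to its preimages.
\<close>
locale normalised_potential = full_branch_map +
  fixes \<psi> :: "circle \<Rightarrow> real"
  assumes \<psi>_continuous: "continuous_on UNIV \<psi>"
    and \<psi>_normalised: "transfer T \<psi> (\<lambda>_. 1) x = (1 :: real)"
begin

lemma weights_sum: "(\<Sum>i\<le>N. exp (\<psi> (\<tau> i x))) = 1"
  using \<psi>_normalised[of x] by (simp add: transfer_branches)

lemma \<psi>_borel [measurable]: "\<psi> \<in> borel_measurable borel"
  using \<psi>_continuous by (rule borel_measurable_continuous_onI)

lemma transfer_bounded:
  fixes \<phi> :: "circle \<Rightarrow> real"
  assumes "\<And>x. \<bar>\<phi> x\<bar> \<le> B" shows "\<bar>transfer T \<psi> \<phi> x\<bar> \<le> B"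
proof -
  have "\<bar>transfer T \<psi> \<phi> x\<bar> \<le> (\<Sum>i\<le>N. exp (\<psi> (\<tau> i x)) * \<bar>\<phi> (\<tau> i x)\<bar>)"
    unfolding transfer_branches by (rule order.trans[OF sum_abs]) (simp add: abs_mult)
  also have "\<dots> \<le> (\<Sum>i\<le>N. exp (\<psi> (\<tau> i x)) * B)"
    by (intro sum_mono mult_left_mono assms) auto
  also have "\<dots> = B" by (simp add: sum_distrib_right[symmetric] weights_sum)
  finally show ?thesis .
qed

text \<open>
  The duality relation is only given for continuous functions, but indicators of cylinders and
  of dynamical balls are needed later. The functional on the left-hand side is integration
  against a measure, which therefore coincides with \<open>m\<close>.
\<close>
lemma dual_transfer_bounded_borel:
  fixes \<phi> :: "circle \<Rightarrow> real"
  assumes m: "borel_probability m" and fixed: "dual_transfer T \<psi> m m"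
    and \<phi> [measurable]: "\<phi> \<in> borel_measurable borel" and B: "\<And>x. \<bar>\<phi> x\<bar> \<le> B"
  shows "(\<integral>x. transfer T \<psi> \<phi> x \<partial>m) = (\<integral>x. \<phi> x \<partial>m)"
proof -
  note mD = borel_probabilityD[OF m]
  interpret m: prob_space m by (rule mD)
  have [measurable_cong]: "sets m = sets borel" by (rule mD)
  note [measurable] = branch_measurable
  \<comment> \<open>\<open>M\<close> is the law of a random preimage of an \<open>m\<close>-distributed point: the branch \<open>i\<close> is taken
    with probability \<open>exp \<psi>\<close> at the preimage.\<close>
  define P where "P = count_space {..N} \<Otimes>\<^sub>M m"
  define b where "b = (\<lambda>(i, x). \<tau> i x)"
  define M where "M = distr (density P (\<lambda>z. ennreal (exp (\<psi> (b z))))) borel b"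
  have fin_count: "finite_measure (count_space {..N})"
    by (rule finite_measure_count_space) simp
  then interpret count: finite_measure "count_space {..N}" .
  interpret P: finite_measure P
    unfolding P_def by (intro finite_measure_pair_measure fin_count m.finite_measure_axioms)
  interpret pair_sigma_finite "count_space {..N}" m ..
  have branch_P [measurable]: "b \<in> borel_measurable P"
    unfolding P_def b_def by (rule measurable_pair_measure_countable1) (auto simp: case_prod_unfold)
  have exp_le: "exp (\<psi> (\<tau> i x)) \<le> 1" if "i \<le> N" for i x
    using member_le_sum[of i "{..N}" "\<lambda>i. exp (\<psi> (\<tau> i x))"] that weights_sum[of x] by simp
  have space_P: "space P = {..N} \<times> UNIV" by (simp add: P_def space_pair_measure mD)
  have int_M: "(\<integral>y. g y \<partial>M) = (\<integral>x. transfer T \<psi> g x \<partial>m)"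
    if g [measurable]: "g \<in> borel_measurable borel" and B: "\<And>x. \<bar>g x\<bar> \<le> B" for g :: "circle \<Rightarrow> real" and B
  proof -
    let ?k = "\<lambda>y. exp (\<psi> y) * g y"
    have int: "integrable P (\<lambda>z. ?k (b z))"
    proof (rule P.integrable_const_bound[of _ B])
      show "AE z in P. norm (?k (b z)) \<le> B"
        using exp_le mult_mono[OF exp_le B] by (intro AE_I2) (auto simp: space_P abs_mult b_def)
      show "(\<lambda>z. ?k (b z)) \<in> borel_measurable P"
        by measurable
    qed
    have "(\<integral>y. g y \<partial>M) = (\<integral>z. g (b z)
        \<partial>density P (\<lambda>z. ennreal (exp (\<psi> (b z)))))"
      unfolding M_def by (rule integral_distr) simp_all
    also have "\<dots> = (\<integral>z. ?k (b z) \<partial>P)"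
      by (subst integral_density) simp_all
    also have "\<dots> = (\<integral>i. (\<integral>x. ?k (\<tau> i x) \<partial>m) \<partial>count_space {..N})"
      using integral_fst'[OF int[unfolded P_def]] by (simp add: P_def b_def)
    also have "\<dots> = (\<Sum>i\<le>N. (\<integral>x. ?k (\<tau> i x) \<partial>m))"
      by (simp add: lebesgue_integral_count_space_finite)
    also have "\<dots> = (\<integral>x. (\<Sum>i\<le>N. ?k (\<tau> i x)) \<partial>m)"
    proof (rule Bochner_Integration.integral_sum[symmetric])
      fix i assume i: "i \<in> {..N}"
      show "integrable m (\<lambda>x. ?k (\<tau> i x))"
      proof (rule integrable_bounded_borel[OF m])
        show "\<bar>?k (\<tau> i x)\<bar> \<le> B" for x
          using i mult_mono[OF exp_le[of i x] B[of "\<tau> i x"]] by (simp add: abs_mult)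
      qed measurable
    qed
    finally show ?thesis by (simp add: transfer_branches)
  qed
  have "M = m"
  proof (rule measure_eq_of_continuous_integrals)
    show "finite_measure M"
    proof (rule finite_measureI)
      have "emeasure M (space M) = (\<integral>\<^sup>+z. ennreal (exp (\<psi> (b z))) \<partial>P)"
        unfolding M_def by (simp add: emeasure_distr emeasure_density)
      also have "\<dots> \<le> (\<integral>\<^sup>+z. 1 \<partial>P)"
        using exp_le by (intro nn_integral_mono) (auto simp: space_P b_def)
      also have "\<dots> < \<infinity>" using P.emeasure_finite by (simp add: less_top[symmetric])
      finally show "emeasure M (space M) \<noteq> \<infinity>" by simp
    qed
    fix g :: "circle \<Rightarrow> real" assume g: "continuous_on UNIV g" "bounded (range g)"
    obtain B where "\<And>x. \<bar>g x\<bar> \<le> B" using bounded_circle[OF g(1)] by blast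
    then have "(\<integral>x. g x \<partial>M) = (\<integral>x. transfer T \<psi> g x \<partial>m)"
      by (rule int_M[OF borel_measurable_continuous_onI[OF g(1)]])
    then show "(\<integral>x. g x \<partial>M) = (\<integral>x. g x \<partial>m)"
      using fixed g(1) unfolding dual_transfer_def by simp
  qed (use mD m.finite_measure_axioms in \<open>simp_all add: M_def\<close>)
  then show ?thesis using int_M[OF \<phi> B] by simp
qed

lemma dual_transfer_power:
  fixes \<phi> :: "circle \<Rightarrow> real"
  assumes m: "borel_probability m" and fixed: "dual_transfer T \<psi> m m"
    and \<phi>: "\<phi> \<in> borel_measurable borel" and B: "\<And>x. \<bar>\<phi> x\<bar> \<le> B"
  shows "(transfer T \<psi> ^^ n) \<phi> \<in> borel_measurable borel \<and> (\<forall>x. \<bar>(transfer T \<psi> ^^ n) \<phi> x\<bar> \<le> B) \<and>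
    (\<integral>x. (transfer T \<psi> ^^ n) \<phi> x \<partial>m) = (\<integral>x. \<phi> x \<partial>m)"
proof (induction n)
  case (Suc n)
  then show ?case
    using dual_transfer_bounded_borel[OF m fixed, of "(transfer T \<psi> ^^ n) \<phi>" B]
    by (auto intro!: transfer_measurable transfer_bounded \<psi>_borel)
qed (use \<phi> B in simp)

text \<open>
  The integral of \<open>\<phi>\<close> equals that of every iterate, and the iterates converge boundedly to a
  constant, so this constant is the integral.
\<close>
lemma dual_transfer_unique:
  assumes m: "borel_probability m" "dual_transfer T \<psi> m m"
    and m': "borel_probability m'" "dual_transfer T \<psi> m' m'"
    and conv: "\<And>\<phi> x. continuous_on UNIV \<phi> \<Longrightarrow> (\<lambda>n. (transfer T \<psi> ^^ n) \<phi> x) \<longlonglongrightarrow> (c \<phi> :: real)"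
  shows "m = m'"
proof (rule measure_eq_of_continuous_integrals)
  have limit: "(\<integral>x. \<phi> x \<partial>m) = c \<phi>"
    if m: "borel_probability m" "dual_transfer T \<psi> m m" and \<phi>: "continuous_on UNIV \<phi>" for m \<phi>
  proof -
    note mD = borel_probabilityD[OF m(1)]
    interpret prob_space m by (rule mD)
    obtain B where B: "\<And>x. \<bar>\<phi> x\<bar> \<le> B" using bounded_circle[OF \<phi>] by blast
    note pow = dual_transfer_power[OF m borel_measurable_continuous_onI[OF \<phi>] B]
    have "(\<lambda>n. \<integral>x. (transfer T \<psi> ^^ n) \<phi> x \<partial>m) \<longlonglongrightarrow> (\<integral>x. c \<phi> \<partial>m)"
      using pow conv[OF \<phi>] mD
      by (intro integral_dominated_convergence[where w="\<lambda>_. B"])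
        (auto simp: measurable_cong_sets[OF mD(2) refl])
    then show ?thesis using pow prob_space by (simp add: LIMSEQ_const_iff)
  qed
  fix \<phi> :: "circle \<Rightarrow> real" assume "continuous_on UNIV \<phi>"
  then show "(\<integral>x. \<phi> x \<partial>m) = (\<integral>x. \<phi> x \<partial>m')"
    using limit[OF m] limit[OF m'] by simp
qed (use borel_probabilityD[OF m(1)] borel_probabilityD[OF m'(1)] in \<open>simp_all add: prob_space.finite_measure\<close>)

text \<open>
  The averaging operator undoes composition with \<open>T\<close>.
\<close>
lemma dual_transfer_invariant:
  assumes m: "borel_probability m" and fixed: "dual_transfer T \<psi> m m"
  shows "m \<in> invariant_measures T"
proof -
  note mD = borel_probabilityD[OF m]
  interpret prob_space m by (rule mD)
  have T [measurable]: "T \<in> measurable m m"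
    using T_borel by (simp cong: measurable_cong_sets add: mD(2))
  have "distr m m T = m"
  proof (rule measure_eq_of_continuous_integrals)
    interpret D: prob_space "distr m m T" by (rule prob_space_distr) (rule T)
    show "finite_measure (distr m m T)" by (rule D.finite_measure_axioms)
    fix \<phi> :: "circle \<Rightarrow> real" assume \<phi>: "continuous_on UNIV \<phi>"
    have [measurable]: "\<phi> \<in> borel_measurable m"
      using borel_measurable_continuous_onI[OF \<phi>] by (simp cong: measurable_cong_sets add: mD(2))
    have "transfer T \<psi> (\<lambda>x. \<phi> (T x)) = \<phi>"
    proof
      show "transfer T \<psi> (\<lambda>x. \<phi> (T x)) x = \<phi> x" for x
        using weights_sum[of x] by (simp add: transfer_branches T_branch sum_distrib_right[symmetric])
    qed
    moreover have "continuous_on UNIV (\<lambda>x. \<phi> (T x))"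
      using continuous_on_compose2[OF \<phi> T_continuous] by simp
    ultimately have "(\<integral>x. \<phi> (T x) \<partial>m) = (\<integral>x. \<phi> x \<partial>m)"
      using fixed unfolding dual_transfer_def by metis
    then show "(\<integral>x. \<phi> x \<partial>distr m m T) = (\<integral>x. \<phi> x \<partial>m)"
      by (simp add: integral_distr)
  qed (use mD finite_measure_axioms in simp_all)
  then show ?thesis using m T by (simp add: invariant_measures_def)
qed

end

section \<open>The variational principle with its equality case\<close>

text \<open>
  A quantitative form of \<open>p ln (r / p) \<le> r - p\<close>, obtained from \<open>ln t \<le> t - 1\<close> at
  \<open>t = \<surd>(r / p)\<close>. The square that it gains controls the equality case.
\<close>
lemma ln_quotient_le_hellinger:
  fixes p r :: real
  assumes "0 \<le> p" "0 < r"
  shows "p * ln r - p * ln p \<le> r - p - (sqrt r - sqrt p)\<^sup>2"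
proof (cases "p = 0")
  case True
  then show ?thesis using assms by simp
next
  case False
  then have pos: "0 < p" "0 < sqrt p" "0 < sqrt r" using assms by auto
  have "ln (sqrt r / sqrt p) \<le> sqrt r / sqrt p - 1"
    using pos by (intro ln_le_minus_one) simp
  then have "2 * p * ln (sqrt r / sqrt p) \<le> 2 * p * (sqrt r / sqrt p - 1)"
    using pos by (intro mult_left_mono) auto
  moreover have "2 * p * ln (sqrt r / sqrt p) = p * ln r - p * ln p"
    using assms pos by (simp add: ln_div ln_sqrt algebra_simps)
  moreover have "2 * p * (sqrt r / sqrt p - 1) = 2 * sqrt p * sqrt r - 2 * p"
  proof -
    have "2 * p * (sqrt r / sqrt p - 1) = 2 * (p / sqrt p) * sqrt r - 2 * p"
      by (simp add: right_diff_distrib)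
    then show ?thesis using real_div_sqrt[of p] pos by simp
  qed
  moreover have "r - p - (sqrt r - sqrt p)\<^sup>2 = 2 * sqrt p * sqrt r - 2 * p"
    using assms by (simp add: power2_diff)
  ultimately show ?thesis by simp
qed

text \<open>
  The arithmetic-geometric mean inequality for the factors of
  \<open>r - p = (\<surd>r - \<surd>p) (\<surd>r + \<surd>p)\<close>. The free parameter \<open>s\<close> replaces an application of the
  Cauchy-Schwarz inequality to the sum over cylinders.
\<close>
lemma abs_diff_le_hellinger:
  fixes p r s :: real
  assumes "0 \<le> p" "0 \<le> r" "0 < s"
  shows "\<bar>r - p\<bar> \<le> (sqrt r - sqrt p)\<^sup>2 / (2 * s) + s * (r + p)"
proof -
  let ?u = "\<bar>sqrt r - sqrt p\<bar>" and ?v = "sqrt r + sqrt p"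
  have "r - p = (sqrt r - sqrt p) * ?v" using assms by (simp add: algebra_simps)
  then have eq: "\<bar>r - p\<bar> = ?u * ?v" using assms by (simp add: abs_mult)
  have "0 \<le> (?u - s * ?v)\<^sup>2 / (2 * s)" using assms by simp
  also have "(?u - s * ?v)\<^sup>2 / (2 * s) = ?u\<^sup>2 / (2 * s) - ?u * ?v + s * ?v\<^sup>2 / 2"
    using assms(3) by (simp add: power2_diff field_simps power2_eq_square)
  finally have "?u * ?v \<le> ?u\<^sup>2 / (2 * s) + s * ?v\<^sup>2 / 2" by simp
  moreover have "?v\<^sup>2 \<le> 2 * (r + p)"
    using assms sum_squares_bound[of "sqrt r" "sqrt p"] by (simp add: power2_sum)
  then have "s * ?v\<^sup>2 / 2 \<le> s * (r + p)"
    using assms by simp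
  ultimately show ?thesis unfolding eq by simp
qed

locale normalised_system =
  normalised_potential T \<tau> digit N \<psi> + measure_preserving_map M T
  for T \<tau> digit N \<psi> and M :: "circle measure" +
  assumes sets_M: "sets M = sets borel"
begin

lemma M_borel_probability: "borel_probability M"
  using sets_M by (simp add: borel_probability_def prob_space_axioms)

lemma label_dig: "label digit"
  using label_digit full_prob_space_axioms sets_M by blast

definition words :: "nat \<Rightarrow> nat list set" where
  "words n = range (itinerary T digit n)"

text \<open>
  A sample point in each cylinder, where potentials are evaluated.
\<close>
definition word_point :: "nat \<Rightarrow> nat list \<Rightarrow> circle" where
  "word_point n A = (SOME z. itinerary T digit n z = A)"

text \<open>
  The event concerns the digits after the first one. By invariance its probability is that of
  the cylinder itself (\<open>word_prob_unshifted\<close>).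
\<close>
definition word_prob :: "nat \<Rightarrow> nat list \<Rightarrow> real" where
  "word_prob n A = prob ((\<lambda>x. itinerary T digit n (T x)) -` {A})"

text \<open>
  The actual joint distribution of the first digit and the following \<open>n\<close> digits.
\<close>
definition branch_prob :: "nat \<Rightarrow> nat \<Rightarrow> nat list \<Rightarrow> real" where
  "branch_prob n i A = prob ((\<lambda>x. itinerary T digit n (T x)) -` {A} \<inter> digit -` {i})"

text \<open>
  The joint distribution that would hold if, given the following digits \<open>A\<close>, the first digit were drawn
  with the transition probabilities \<open>exp \<psi>\<close> of the sample point.
\<close>
definition model_prob :: "nat \<Rightarrow> nat \<Rightarrow> nat list \<Rightarrow> real" where
  "model_prob n i A = word_prob n A * exp (\<psi> (\<tau> i (word_point n A)))"

lemma label_words: "label (itinerary T digit n)" "label (\<lambda>x. itinerary T digit n (T x))"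
  using label_dig by (auto intro: label_itinerary label_shift)

lemma itinerary_word_point: "A \<in> words n \<Longrightarrow> itinerary T digit n (word_point n A) = A"
  unfolding words_def word_point_def by (rule someI_ex) auto

lemma same_itinerary_word_point:
  "itinerary T digit (Suc n) x = itinerary T digit (Suc n) (\<tau> (digit x) (word_point n (itinerary T digit n (T x))))"
proof -
  have "itinerary T digit n (T x) \<in> words n" by (simp add: words_def)
  then show ?thesis
    by (simp add: itinerary_Suc itinerary_word_point T_branch[OF digit_le] digit_branch[OF digit_le])
qed

lemma same_itinerary_word_point':
  assumes "i \<le> N"
  shows "itinerary T digit (Suc n) (\<tau> i x) = itinerary T digit (Suc n) (\<tau> i (word_point n (itinerary T digit n x)))"
proof -
  have "itinerary T digit n x \<in> words n" by (simp add: words_def)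
  then show ?thesis by (simp add: itinerary_branch[OF assms] itinerary_word_point)
qed

lemma range_shifted: "range (\<lambda>x. itinerary T digit n (T x)) = words n"
  by (simp add: range_itinerary_shift words_def)

lemma word_prob_unshifted: "word_prob n A = prob (itinerary T digit n -` {A})"
proof -
  have "(\<lambda>x. itinerary T digit n (T x)) -` {A} = T -` (itinerary T digit n -` {A})" by auto
  then show ?thesis unfolding word_prob_def using prob_vimage label_sets[OF label_words(1)] by simp
qed

lemma probs_nonneg: "0 \<le> branch_prob n i A" "0 \<le> word_prob n A" "0 \<le> model_prob n i A"
  by (simp_all add: branch_prob_def word_prob_def model_prob_def)

lemma branch_prob_le: "branch_prob n i A \<le> word_prob n A"
  unfolding branch_prob_def word_prob_def using label_sets[OF label_words(2)] by (intro finite_measure_mono) auto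

lemma sum_branch_prob: "(\<Sum>i\<le>N. branch_prob n i A) = word_prob n A"
  using prob_marginal[OF label_sets[OF label_words(2)] label_dig, of n A]
  by (simp add: branch_prob_def word_prob_def range_digit)

lemma sum_model_prob: "(\<Sum>i\<le>N. model_prob n i A) = word_prob n A"
  by (simp add: model_prob_def sum_distrib_left[symmetric] weights_sum)

lemma sum_word_prob: "(\<Sum>A\<in>words n. word_prob n A) = 1"
  using sum_prob_label[OF label_words(2), of n] by (simp add: word_prob_def range_shifted)

lemma increment_eq:
  "entropy_increment digit n = (\<Sum>A\<in>words n. \<Sum>i\<le>N. branch_prob n i A * ln (word_prob n A) - branch_prob n i A * ln (branch_prob n i A))"
  unfolding entropy_increment_def cond_entropy_eq[OF label_dig label_words(2)] range_digit range_shifted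
  by (subst sum.swap) (simp add: branch_prob_def word_prob_def)

text \<open>
  Riemann sums over cylinders of order \<open>n + 1\<close>, with sample points \<open>\<tau> i (word_point n A)\<close>.
\<close>
lemma expectation_cylinders:
  fixes \<phi> :: "circle \<Rightarrow> real"
  assumes \<phi>: "continuous_on UNIV \<phi>"
    and var: "\<And>x y. itinerary T digit (Suc n) x = itinerary T digit (Suc n) y \<Longrightarrow> \<bar>\<phi> x - \<phi> y\<bar> \<le> e"
  shows "\<bar>expectation \<phi> - (\<Sum>A\<in>words n. \<Sum>i\<le>N. branch_prob n i A * \<phi> (\<tau> i (word_point n A)))\<bar> \<le> e"
proof -
  let ?Z = "\<lambda>x. (itinerary T digit n (T x), digit x)" and ?c = "\<lambda>(A, i). \<phi> (\<tau> i (word_point n A))"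
  have "range ?Z = words n \<times> {..N}"
  proof
    show "words n \<times> {..N} \<subseteq> range ?Z"
    proof
      fix Ai assume "Ai \<in> words n \<times> {..N}"
      then obtain x i where "Ai = (itinerary T digit n x, i)" "i \<le> N" by (auto simp: words_def)
      then have "Ai = ?Z (\<tau> i x)" by (simp add: T_branch digit_branch)
      then show "Ai \<in> range ?Z" by (rule range_eqI)
    qed
  qed (auto simp: words_def digit_le)
  moreover have "?Z -` {(A, i)} = (\<lambda>x. itinerary T digit n (T x)) -` {A} \<inter> digit -` {i}" for A i
    by auto
  ultimately have "(\<Sum>v\<in>range ?Z. prob (?Z -` {v}) * ?c v) = (\<Sum>A\<in>words n. \<Sum>i\<le>N. branch_prob n i A * \<phi> (\<tau> i (word_point n A)))"
    by (auto simp: sum.cartesian_product branch_prob_def intro!: sum.cong)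
  moreover have "\<bar>\<phi> x - ?c (?Z x)\<bar> \<le> e" for x
    using var[OF same_itinerary_word_point[of n x]] by simp
  ultimately show ?thesis
    using expectation_approx_label[OF label_pair[OF label_words(2) label_dig]
        integrable_continuous_circle[OF M_borel_probability \<phi>], of ?c n e] by simp
qed

lemma expectation_transfer_cylinders:
  fixes \<phi> :: "circle \<Rightarrow> real"
  assumes \<phi>: "continuous_on UNIV \<phi>"
    and var: "\<And>x y. itinerary T digit (Suc n) x = itinerary T digit (Suc n) y \<Longrightarrow>
      \<bar>exp (\<psi> x) * \<phi> x - exp (\<psi> y) * \<phi> y\<bar> \<le> e"
  shows "\<bar>expectation (transfer T \<psi> \<phi>) - (\<Sum>A\<in>words n. \<Sum>i\<le>N. model_prob n i A * \<phi> (\<tau> i (word_point n A)))\<bar> \<le> (real N + 1) * e"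
proof -
  let ?c = "\<lambda>A. \<Sum>i\<le>N. exp (\<psi> (\<tau> i (word_point n A))) * \<phi> (\<tau> i (word_point n A))"
  obtain B where "\<And>x. \<bar>\<phi> x\<bar> \<le> B" using bounded_circle[OF \<phi>] by blast
  then have int: "integrable M (transfer T \<psi> \<phi>)"
    using transfer_bounded transfer_measurable[OF \<psi>_borel borel_measurable_continuous_onI[OF \<phi>]]
      integrable_bounded_borel[OF M_borel_probability] by blast
  have "\<bar>transfer T \<psi> \<phi> x - ?c (itinerary T digit n x)\<bar> \<le> (real N + 1) * e" for x
  proof -
    have "\<bar>transfer T \<psi> \<phi> x - ?c (itinerary T digit n x)\<bar> \<le> (\<Sum>i\<le>N. e)"
      unfolding transfer_branches sum_subtractf[symmetric]
      by (rule order.trans[OF sum_abs]) (intro sum_mono var same_itinerary_word_point', simp)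
    then show ?thesis by (simp add: algebra_simps)
  qed
  then have "\<bar>expectation (transfer T \<psi> \<phi>) - (\<Sum>A\<in>words n. word_prob n A * ?c A)\<bar> \<le> (real N + 1) * e"
    using expectation_approx_label[OF label_words(1) int, of ?c n] by (simp add: word_prob_unshifted words_def)
  then show ?thesis by (simp add: model_prob_def sum_distrib_left mult.assoc)
qed

text \<open>
  Up to the oscillation \<open>e\<close> of \<open>\<psi>\<close> on cylinders, the left-hand side is minus the relative entropy
  of the actual distribution with respect to the model. The two have the same total mass, so the
  linear terms cancel.
\<close>
lemma increment_le_hellinger:
  assumes var: "\<And>x y. itinerary T digit (Suc n) x = itinerary T digit (Suc n) y \<Longrightarrow> \<bar>\<psi> x - \<psi> y\<bar> \<le> e"
  shows "entropy_increment digit n + expectation \<psi> \<le>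
    e - (\<Sum>A\<in>words n. \<Sum>i\<le>N. (sqrt (model_prob n i A) - sqrt (branch_prob n i A))\<^sup>2)"
proof -
  have term_le: "branch_prob n i A * ln (word_prob n A) - branch_prob n i A * ln (branch_prob n i A) + branch_prob n i A * \<psi> (\<tau> i (word_point n A)) \<le>
      model_prob n i A - branch_prob n i A - (sqrt (model_prob n i A) - sqrt (branch_prob n i A))\<^sup>2" for i A
  proof (cases "word_prob n A = 0")
    case True
    then have "branch_prob n i A = 0" using branch_prob_le[of n i A] probs_nonneg(1)[of n i A] by simp
    then show ?thesis using True by (simp add: model_prob_def)
  next
    case False
    then have pos: "0 < word_prob n A" using probs_nonneg(2)[of n A] by simp
    then have "ln (model_prob n i A) = ln (word_prob n A) + \<psi> (\<tau> i (word_point n A))"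
      by (simp add: model_prob_def ln_mult)
    then show ?thesis
      using ln_quotient_le_hellinger[OF probs_nonneg(1), of "model_prob n i A" n i A] pos
      by (simp add: model_prob_def algebra_simps)
  qed
  have "entropy_increment digit n + (\<Sum>A\<in>words n. \<Sum>i\<le>N. branch_prob n i A * \<psi> (\<tau> i (word_point n A))) \<le>
     (\<Sum>A\<in>words n. \<Sum>i\<le>N. model_prob n i A - branch_prob n i A - (sqrt (model_prob n i A) - sqrt (branch_prob n i A))\<^sup>2)"
    unfolding increment_eq sum.distrib[symmetric] by (intro sum_mono term_le)
  also have "\<dots> = - (\<Sum>A\<in>words n. \<Sum>i\<le>N. (sqrt (model_prob n i A) - sqrt (branch_prob n i A))\<^sup>2)"
    by (simp add: sum_subtractf sum_branch_prob sum_model_prob sum_negf)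
  finally have "entropy_increment digit n + (\<Sum>A\<in>words n. \<Sum>i\<le>N. branch_prob n i A * \<psi> (\<tau> i (word_point n A))) \<le>
     - (\<Sum>A\<in>words n. \<Sum>i\<le>N. (sqrt (model_prob n i A) - sqrt (branch_prob n i A))\<^sup>2)" .
  moreover have "\<bar>expectation \<psi> - (\<Sum>A\<in>words n. \<Sum>i\<le>N. branch_prob n i A * \<psi> (\<tau> i (word_point n A)))\<bar> \<le> e"
    by (rule expectation_cylinders[OF \<psi>_continuous]) (rule var)
  ultimately show ?thesis by linarith
qed

lemma eventually_small_variation:
  fixes \<phi> :: "circle \<Rightarrow> real"
  assumes "continuous_on UNIV \<phi>" "0 < e"
  shows "eventually (\<lambda>n. \<forall>x y. itinerary T digit (Suc n) x = itinerary T digit (Suc n) y \<longrightarrow> \<bar>\<phi> x - \<phi> y\<bar> \<le> e) sequentially"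
  using small_variation[OF assms] eventually_sequentially_Suc[of "\<lambda>n. \<forall>x y. itinerary T digit n x = itinerary T digit n y \<longrightarrow> \<bar>\<phi> x - \<phi> y\<bar> \<le> e"] by blast

lemma entropy_rate_le: "entropy_rate digit + expectation \<psi> \<le> 0"
proof (rule field_le_epsilon)
  fix e :: real assume e: "0 < e"
  from eventually_happens'[OF sequentially_bot eventually_small_variation[OF \<psi>_continuous e]]
  obtain n where n: "\<forall>x y. itinerary T digit (Suc n) x = itinerary T digit (Suc n) y \<longrightarrow> \<bar>\<psi> x - \<psi> y\<bar> \<le> e" ..
  have "entropy_increment digit n + expectation \<psi> \<le>
      e - (\<Sum>A\<in>words n. \<Sum>i\<le>N. (sqrt (model_prob n i A) - sqrt (branch_prob n i A))\<^sup>2)"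
    by (rule increment_le_hellinger) (use n in blast)
  moreover have "0 \<le> (\<Sum>A\<in>words n. \<Sum>i\<le>N. (sqrt (model_prob n i A) - sqrt (branch_prob n i A))\<^sup>2)"
    by (intro sum_nonneg) simp
  ultimately show "entropy_rate digit + expectation \<psi> \<le> 0 + e"
    using entropy_rate_le_increment[OF label_dig, of n] by linarith
qed

text \<open>
  If the bound is attained, every increment still exceeds \<open>- \<integral>\<psi>\<close>, so the Hellinger distance
  between the actual and the model distribution is at most the oscillation of \<open>\<psi>\<close> and tends
  to zero. The Riemann sums for \<open>\<integral>\<phi>\<close> and for the integral of the transferred function differ only by
  exchanging these two distributions.
\<close>
lemma dual_transfer_of_maximal:
  assumes max: "entropy_rate digit + expectation \<psi> = 0"
  shows "dual_transfer T \<psi> M M"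
  unfolding dual_transfer_def
proof (intro allI impI)
  fix \<phi> :: "circle \<Rightarrow> real" assume \<phi>: "continuous_on UNIV \<phi>"
  obtain B where B: "\<And>x. \<bar>\<phi> x\<bar> \<le> B" using bounded_circle[OF \<phi>] by blast
  have B0: "0 \<le> B" using B[of undefined] by linarith
  \<comment> \<open>The oscillation of \<open>\<psi>\<close> is taken below \<open>s\<^sup>2\<close>, because the Hellinger sum enters divided by \<open>2 s\<close>.\<close>
  have bound: "\<bar>expectation \<phi> - expectation (transfer T \<psi> \<phi>)\<bar> \<le> (real N + 2 + 3 * B) * s" if s: "0 < s" for s
  proof -
    have "continuous_on UNIV (\<lambda>x. exp (\<psi> x) * \<phi> x)"
      by (intro continuous_intros \<phi> \<psi>_continuous)
    from eventually_conj[OF eventually_small_variation[OF \<psi>_continuous, of "s * s"]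
        eventually_conj[OF eventually_small_variation[OF \<phi> s] eventually_small_variation[OF this s]]]
    have "eventually (\<lambda>n. (\<forall>x y. itinerary T digit (Suc n) x = itinerary T digit (Suc n) y \<longrightarrow> \<bar>\<psi> x - \<psi> y\<bar> \<le> s * s)
      \<and> (\<forall>x y. itinerary T digit (Suc n) x = itinerary T digit (Suc n) y \<longrightarrow> \<bar>\<phi> x - \<phi> y\<bar> \<le> s)
      \<and> (\<forall>x y. itinerary T digit (Suc n) x = itinerary T digit (Suc n) y \<longrightarrow>
          \<bar>exp (\<psi> x) * \<phi> x - exp (\<psi> y) * \<phi> y\<bar> \<le> s)) sequentially"
      using s by simp
    then obtain n where n: "\<And>x y. itinerary T digit (Suc n) x = itinerary T digit (Suc n) y \<Longrightarrow> \<bar>\<psi> x - \<psi> y\<bar> \<le> s * s"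
      "\<And>x y. itinerary T digit (Suc n) x = itinerary T digit (Suc n) y \<Longrightarrow> \<bar>\<phi> x - \<phi> y\<bar> \<le> s"
      "\<And>x y. itinerary T digit (Suc n) x = itinerary T digit (Suc n) y \<Longrightarrow>
          \<bar>exp (\<psi> x) * \<phi> x - exp (\<psi> y) * \<phi> y\<bar> \<le> s"
      by (blast dest: eventually_happens'[OF sequentially_bot])
    define H where "H = (\<Sum>A\<in>words n. \<Sum>i\<le>N. (sqrt (model_prob n i A) - sqrt (branch_prob n i A))\<^sup>2)"
    have H: "H \<le> s * s"
    proof -
      have "entropy_increment digit n + expectation \<psi> \<le> s * s - H"
        unfolding H_def by (rule increment_le_hellinger) (rule n(1))
      then show ?thesis using entropy_rate_le_increment[OF label_dig, of n] max by linarith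
    qed
    let ?P = "\<Sum>A\<in>words n. \<Sum>i\<le>N. branch_prob n i A * \<phi> (\<tau> i (word_point n A))"
    let ?R = "\<Sum>A\<in>words n. \<Sum>i\<le>N. model_prob n i A * \<phi> (\<tau> i (word_point n A))"
    have "\<bar>?R - ?P\<bar> = \<bar>\<Sum>A\<in>words n. \<Sum>i\<le>N. (model_prob n i A - branch_prob n i A) * \<phi> (\<tau> i (word_point n A))\<bar>"
      by (simp add: sum_subtractf left_diff_distrib)
    also have "\<dots> \<le> (\<Sum>A\<in>words n. \<Sum>i\<le>N. \<bar>(model_prob n i A - branch_prob n i A) * \<phi> (\<tau> i (word_point n A))\<bar>)"
      by (intro order.trans[OF sum_abs] sum_mono sum_abs)
    also have "\<dots> \<le> (\<Sum>A\<in>words n. \<Sum>i\<le>N. ((sqrt (model_prob n i A) - sqrt (branch_prob n i A))\<^sup>2 / (2 * s) + s * (model_prob n i A + branch_prob n i A)) * B)"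
      unfolding abs_mult using s B0
      by (intro sum_mono mult_mono abs_diff_le_hellinger B probs_nonneg) (auto intro!: add_nonneg_nonneg mult_nonneg_nonneg probs_nonneg)
    also have "\<dots> = (H / (2 * s) + s * 2) * B"
      by (simp add: H_def sum.distrib sum_distrib_right[symmetric] sum_distrib_left[symmetric]
          sum_divide_distrib[symmetric] sum_branch_prob sum_model_prob sum_word_prob)
    also have "\<dots> \<le> (s + s * 2) * B"
    proof (intro mult_right_mono add_right_mono B0)
      have "H / (2 * s) \<le> s * s / (2 * s)" using H s by (intro divide_right_mono) auto
      then show "H / (2 * s) \<le> s" using s by simp
    qed
    finally have "\<bar>?R - ?P\<bar> \<le> 3 * B * s" by (simp add: algebra_simps)
    moreover have "\<bar>expectation \<phi> - ?P\<bar> \<le> s" by (rule expectation_cylinders[OF \<phi>]) (rule n(2))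
    moreover have "\<bar>expectation (transfer T \<psi> \<phi>) - ?R\<bar> \<le> (real N + 1) * s"
      by (rule expectation_transfer_cylinders[OF \<phi>]) (rule n(3))
    ultimately show ?thesis by (simp add: algebra_simps)
  qed
  have "\<bar>expectation \<phi> - expectation (transfer T \<psi> \<phi>)\<bar> \<le> 0 + e" if "0 < e" for e
  proof -
    have pos: "0 < real N + 2 + 3 * B" using B0 by simp
    then show ?thesis using bound[of "e / (real N + 2 + 3 * B)"] that by simp
  qed
  then have "\<bar>expectation \<phi> - expectation (transfer T \<psi> \<phi>)\<bar> \<le> 0" by (rule field_le_epsilon)
  then show "expectation \<phi> = expectation (transfer T \<psi> \<phi>)" by simp
qed

text \<open>
  For a fixed measure the mass of a cylinder of order \<open>n + 1\<close> is an integral of \<open>exp \<psi>\<close> over a cylinder of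
  order \<open>n\<close>, hence the actual distribution is at most \<open>exp (e / 2)\<close> times the model. This bounds
  the conditional entropies from below.
\<close>
lemma maximal_of_dual_transfer:
  assumes fixed: "dual_transfer T \<psi> M M"
  shows "entropy_rate digit + expectation \<psi> = 0"
proof (rule antisym[OF entropy_rate_le])
  show "0 \<le> entropy_rate digit + expectation \<psi>"
  proof (rule field_le_epsilon)
    fix e :: real assume e: "0 < e"
    have "eventually (\<lambda>n. - expectation \<psi> - e \<le> entropy_increment digit n) sequentially"
      using eventually_small_variation[OF \<psi>_continuous half_gt_zero[OF e]]
    proof (rule eventually_mono)
      fix n assume "\<forall>x y. itinerary T digit (Suc n) x = itinerary T digit (Suc n) y \<longrightarrow> \<bar>\<psi> x - \<psi> y\<bar> \<le> e / 2"
      then have var: "\<And>x y. itinerary T digit (Suc n) x = itinerary T digit (Suc n) y \<Longrightarrow> \<bar>\<psi> x - \<psi> y\<bar> \<le> e / 2"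
        by blast
      have p_le: "branch_prob n i A \<le> word_prob n A * exp (\<psi> (\<tau> i (word_point n A)) + e / 2)" if i: "i \<le> N" and A: "A \<in> words n" for i A
      proof -
        let ?C = "(\<lambda>x. itinerary T digit n (T x)) -` {A} \<inter> digit -` {i}"
        have C: "?C \<in> sets borel"
          using label_sets[OF label_words(2)] label_sets[OF label_dig] sets_M by blast
        have D: "itinerary T digit n -` {A} \<in> sets borel"
          using label_sets[OF label_words(1)] sets_M by blast
        have tr: "transfer T \<psi> (indicator ?C) x = exp (\<psi> (\<tau> i x)) * indicator (itinerary T digit n -` {A}) x" for x
        proof -
          have "transfer T \<psi> (indicator ?C) x = (\<Sum>j\<le>N. if j = i then exp (\<psi> (\<tau> i x)) * indicator (itinerary T digit n -` {A}) x else 0)"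
            unfolding transfer_branches
            by (intro sum.cong refl) (auto simp: indicator_def T_branch digit_branch)
          then show ?thesis using i by simp
        qed
        have "branch_prob n i A = expectation (indicator ?C)"
          using C sets_M by (simp add: branch_prob_def space_UNIV)
        also have "\<dots> = expectation (transfer T \<psi> (indicator ?C))"
          using borel_measurable_indicator[OF C]
          by (intro dual_transfer_bounded_borel[OF M_borel_probability fixed, symmetric, of _ 1]) auto
        also have "\<dots> \<le> expectation (\<lambda>x. exp (\<psi> (\<tau> i (word_point n A)) + e / 2) * indicator (itinerary T digit n -` {A}) x)"
        proof (rule integral_mono)
          show "integrable M (transfer T \<psi> (indicator ?C :: circle \<Rightarrow> real))"
            using borel_measurable_indicator[OF C]
            by (intro integrable_bounded_borel[OF M_borel_probability, where B = 1] transfer_measurable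
                transfer_bounded \<psi>_borel) auto
          show "integrable M (\<lambda>x. exp (\<psi> (\<tau> i (word_point n A)) + e / 2) * indicator (itinerary T digit n -` {A}) x)"
            using D sets_M by (intro integrable_mult_right integrable_real_indicator) (auto simp: less_top[symmetric])
          fix x
          have "exp (\<psi> (\<tau> i x)) \<le> exp (\<psi> (\<tau> i (word_point n A)) + e / 2)" if "itinerary T digit n x = A"
            using var[OF same_itinerary_word_point'[OF i, of n x]] unfolding that exp_le_cancel_iff by linarith
          then show "transfer T \<psi> (indicator ?C) x \<le> exp (\<psi> (\<tau> i (word_point n A)) + e / 2) * indicator (itinerary T digit n -` {A}) x"
            unfolding tr by (auto simp: indicator_def)
        qed
        also have "\<dots> = word_prob n A * exp (\<psi> (\<tau> i (word_point n A)) + e / 2)"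
          using D sets_M by (simp add: word_prob_unshifted space_UNIV)
        finally show ?thesis .
      qed
      have term_ge: "- (branch_prob n i A * \<psi> (\<tau> i (word_point n A))) - branch_prob n i A * (e / 2) \<le> branch_prob n i A * ln (word_prob n A) - branch_prob n i A * ln (branch_prob n i A)"
        if "i \<in> {..N}" and A: "A \<in> words n" for i A
      proof (cases "branch_prob n i A = 0")
        case False
        then have pos: "0 < branch_prob n i A" "0 < word_prob n A"
          using probs_nonneg(1)[of n i A] branch_prob_le[of n i A] by auto
        have "ln (branch_prob n i A) \<le> ln (word_prob n A * exp (\<psi> (\<tau> i (word_point n A)) + e / 2))"
          using p_le[of i A] that pos by (intro ln_mono) auto
        also have "\<dots> = ln (word_prob n A) + (\<psi> (\<tau> i (word_point n A)) + e / 2)"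
          using pos by (simp add: ln_mult)
        finally have "branch_prob n i A * ln (branch_prob n i A) \<le> branch_prob n i A * (ln (word_prob n A) + (\<psi> (\<tau> i (word_point n A)) + e / 2))"
          using pos by (intro mult_left_mono) auto
        then show ?thesis by (simp add: algebra_simps)
      qed simp
      have "(\<Sum>A\<in>words n. \<Sum>i\<le>N. - (branch_prob n i A * \<psi> (\<tau> i (word_point n A))) - branch_prob n i A * (e / 2)) \<le> entropy_increment digit n"
        unfolding increment_eq by (intro sum_mono term_ge)
      moreover have "(\<Sum>A\<in>words n. \<Sum>i\<le>N. - (branch_prob n i A * \<psi> (\<tau> i (word_point n A))) - branch_prob n i A * (e / 2)) =
         - (\<Sum>A\<in>words n. \<Sum>i\<le>N. branch_prob n i A * \<psi> (\<tau> i (word_point n A))) - e / 2"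
        by (simp add: sum_subtractf sum_negf sum_distrib_right[symmetric] sum_divide_distrib[symmetric] sum_branch_prob sum_word_prob)
      moreover have "\<bar>expectation \<psi> - (\<Sum>A\<in>words n. \<Sum>i\<le>N. branch_prob n i A * \<psi> (\<tau> i (word_point n A)))\<bar> \<le> e / 2"
        by (rule expectation_cylinders[OF \<psi>_continuous]) (rule var)
      ultimately show "- expectation \<psi> - e \<le> entropy_increment digit n"
        by linarith
    qed
    then have "- expectation \<psi> - e \<le> entropy_rate digit"
      using tendsto_lowerbound[OF entropy_increment_tendsto[OF label_dig]] sequentially_bot by blast
    then show "0 \<le> entropy_rate digit + expectation \<psi> + e" by simp
  qed
qed

end

section \<open>Dynamical balls and distortion\<close>

lemma birkhoff_sum_Suc: "birkhoff_sum T f (Suc n) x = f x + birkhoff_sum T f n (T x)"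
  unfolding birkhoff_sum_def sum.lessThan_Suc_shift by (simp add: funpow_swap1)

lemma transfer_power:
  fixes \<phi> :: "circle \<Rightarrow> real"
  assumes fin: "\<And>x. finite (T -` {x})"
  shows "finite ((T ^^ n) -` {x}) \<and>
    (transfer T f ^^ n) \<phi> x = (\<Sum>y\<in>(T ^^ n) -` {x}. exp (birkhoff_sum T f n y) * \<phi> y)"
proof (induction n arbitrary: \<phi>)
  case 0
  have "id -` {x} = {x}" by auto
  then show ?case by (simp add: birkhoff_sum_def)
next
  case (Suc n)
  have split: "(T ^^ Suc n) -` {x} = (\<Union>w\<in>(T ^^ n) -` {x}. T -` {w})"
    by (auto simp: funpow_swap1)
  have "(transfer T f ^^ Suc n) \<phi> x = (transfer T f ^^ n) (transfer T f \<phi>) x"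
    by (simp add: funpow_swap1)
  also have "\<dots> = (\<Sum>w\<in>(T ^^ n) -` {x}. exp (birkhoff_sum T f n w) * transfer T f \<phi> w)"
    using Suc by blast
  also have "\<dots> = (\<Sum>w\<in>(T ^^ n) -` {x}. \<Sum>y\<in>T -` {w}. exp (birkhoff_sum T f (Suc n) y) * \<phi> y)"
  proof (intro sum.cong refl)
    fix w
    show "exp (birkhoff_sum T f n w) * transfer T f \<phi> w =
        (\<Sum>y\<in>T -` {w}. exp (birkhoff_sum T f (Suc n) y) * \<phi> y)"
      unfolding transfer_def sum_distrib_left
      by (intro sum.cong refl) (auto simp: birkhoff_sum_Suc exp_add)
  qed
  also have "\<dots> = (\<Sum>y\<in>(T ^^ Suc n) -` {x}. exp (birkhoff_sum T f (Suc n) y) * \<phi> y)"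
    unfolding split using Suc fin by (intro sum.UNION_disjoint[symmetric]) auto
  finally show ?case using Suc fin unfolding split by blast
qed

context full_branch_map
begin

lemma finite_preimages: "finite (T -` {x})"
  by (simp add: preimages(1))

text \<open>
  Since every inverse branch is defined on the whole circle, each cylinder of order \<open>n\<close> is mapped
  onto the circle by \<open>T\<^sup>n\<close>.
\<close>
lemma cylinder_full_image:
  "\<exists>y. itinerary T digit n y = itinerary T digit n x \<and> (T ^^ n) y = z"
proof (induction n arbitrary: x)
  case (Suc n)
  from Suc[of "T x"] obtain y where "itinerary T digit n y = itinerary T digit n (T x)" "(T ^^ n) y = z" by blast
  then show ?case
    by (intro exI[of _ "\<tau> (digit x) y"])
      (simp add: itinerary_Suc funpow_swap1 T_branch[OF digit_le] digit_branch[OF digit_le])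
qed simp

lemma pre_orbit_through: "\<exists>X\<in>pre_orbits T ((T ^^ n) x). \<forall>k\<le>n. X k = (T ^^ (n - k)) x"
proof -
  define X where "X k = (if k \<le> n then (T ^^ (n - k)) x else (\<tau> 0 ^^ (k - n)) x)" for k
  have "T (X (Suc k)) = X k" for k
  proof (cases "k < n")
    case True
    then have "n - k = Suc (n - Suc k)" by simp
    then show ?thesis using True by (simp add: X_def)
  next
    case False
    then have "Suc k - n = Suc (k - n)" by simp
    then show ?thesis using False by (simp add: X_def T_branch)
  qed
  then show ?thesis
    by (intro bexI[of _ X]) (auto simp: X_def pre_orbits_def)
qed

text \<open>
  Two orbits in the dynamical ball stay within \<open>2 r\<close> of each other, so equality of their ends
  propagates backwards by injectivity at small scales.
\<close>
lemma dyn_ball_injective: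
  assumes inj: "\<And>u v. dist u v < r\<^sub>1 \<Longrightarrow> T u = T v \<Longrightarrow> u = v" and r: "2 * r \<le> r\<^sub>1"
    and y: "y \<in> dyn_ball T x n r" "y' \<in> dyn_ball T x n r" and eq: "(T ^^ n) y = (T ^^ n) y'"
  shows "y = y'"
proof -
  have "(T ^^ (n - k)) y = (T ^^ (n - k)) y'" if "k \<le> n" for k
    using that
  proof (induction k)
    case (Suc k)
    let ?j = "n - Suc k"
    have j: "n - k = Suc ?j" using Suc.prems by simp
    have "dist ((T ^^ ?j) x) ((T ^^ ?j) y) < r" "dist ((T ^^ ?j) x) ((T ^^ ?j) y') < r"
      using y by (simp_all add: dyn_ball_def)
    then have "dist ((T ^^ ?j) y) ((T ^^ ?j) y') < r\<^sub>1"
      using dist_triangle3[of "(T ^^ ?j) y" "(T ^^ ?j) y'" "(T ^^ ?j) x"] r by simp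
    moreover have "T ((T ^^ ?j) y) = T ((T ^^ ?j) y')"
      using Suc unfolding j by simp
    ultimately show ?case by (rule inj)
  qed (use eq in simp)
  from this[of n] show ?thesis by simp
qed

text \<open>
  Compatibility applied to a pre-orbit of \<open>T\<^sup>n x\<close> that runs through \<open>x\<close>: the \<open>n\<close>-th point of
  the accompanying pre-orbit of \<open>z\<close> lies in the dynamical ball, and the summability condition
  controls how far Birkhoff sums differ.
\<close>
lemma shadowing_preimage:
  assumes comp: "\<And>u v X. dist u v < \<rho> \<Longrightarrow> X \<in> pre_orbits T u \<Longrightarrow>
      \<exists>Y\<in>pre_orbits T v. contracts_along \<omega> \<Omega> C X Y"
    and C: "0 < C" and \<Omega>: "\<And>t. 0 \<le> t \<Longrightarrow> 0 \<le> \<Omega> t"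
    and r: "r \<le> \<rho>" and n: "1 \<le> n" and z: "dist ((T ^^ n) x) z < r"
  shows "\<exists>y\<in>dyn_ball T x n r. (T ^^ n) y = z \<and>
    C * (\<Sum>j<n. \<omega> (dist ((T ^^ j) x) ((T ^^ j) y))) \<le> \<Omega> (dist ((T ^^ n) x) z)"
proof -
  obtain X where X: "X \<in> pre_orbits T ((T ^^ n) x)" "\<And>k. k \<le> n \<Longrightarrow> X k = (T ^^ (n - k)) x"
    using pre_orbit_through by metis
  obtain Y where Y: "Y \<in> pre_orbits T z" and XY: "contracts_along \<omega> \<Omega> C X Y"
    using comp[OF less_le_trans[OF z r] X(1)] by blast
  have X0: "X 0 = (T ^^ n) x" and Y0: "Y 0 = z" using X(1) Y by (simp_all add: pre_orbits_def)
  have TY: "(T ^^ j) (Y n) = Y (n - j)" if "j \<le> n" for j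
    using that
  proof (induction j)
    case (Suc j)
    then have "n - j = Suc (n - Suc j)" by simp
    then show ?case using Suc Y by (simp add: pre_orbits_def)
  qed simp
  have close: "dist (X k) (Y k) < r" for k
  proof (cases "k = 0")
    case False
    then have "dist (X k) (Y k) \<le> dist (X 0) (Y 0)" using XY by (simp add: contracts_along_def)
    then show ?thesis using z by (simp add: X0 Y0)
  qed (use z in \<open>simp add: X0 Y0\<close>)
  have "dist ((T ^^ j) x) ((T ^^ j) (Y n)) < r" if "j \<le> n" for j
    using close[of "n - j"] X(2)[of "n - j"] TY[OF that] that by simp
  then have "Y n \<in> dyn_ball T x n r" by (simp add: dyn_ball_def)
  moreover have "(T ^^ n) (Y n) = z" using TY[of n] Y0 by simp
  moreover have "(\<Sum>j=1..n. \<omega> (dist (X j) (Y j))) = (\<Sum>j<n. \<omega> (dist ((T ^^ j) x) ((T ^^ j) (Y n))))"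
    by (rule sum.reindex_bij_witness[of _ "\<lambda>j. n - j" "\<lambda>j. n - j"]) (auto simp: X(2) TY)
  moreover have "\<Omega> (dist (X n) (Y n)) + C * (\<Sum>j=1..n. \<omega> (dist (X j) (Y j))) \<le> \<Omega> (dist (X 0) (Y 0))"
    using XY n by (simp add: contracts_along_def)
  ultimately show ?thesis
    using \<Omega>[of "dist (X n) (Y n)"] unfolding X0 Y0 by (intro bexI[of _ "Y n"]) auto
qed

end

lemma open_dyn_ball:
  assumes "continuous_on UNIV T" shows "open (dyn_ball T x n r)"
proof -
  have cont: "continuous_on UNIV (T ^^ j)" for j
  proof (induction j)
    case (Suc j)
    then show ?case using continuous_on_compose2[OF assms Suc] by (simp add: comp_def)
  qed (simp add: id_def continuous_on_id)
  have "dyn_ball T x n r = (\<Inter>j\<in>{..n}. {y. dist ((T ^^ j) x) ((T ^^ j) y) < r})"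
    by (auto simp: dyn_ball_def)
  also have "open \<dots>"
    by (intro open_INT ballI open_Collect_less continuous_intros continuous_on_subset[OF cont]) auto
  finally show ?thesis .
qed

context normalised_system
begin

text \<open>
  A ball contains the cylinder of its centre of some order \<open>n\<close> independent of the centre, every point
  has an \<open>n\<close>-th preimage in that cylinder, and the weight of a preimage is at least
  \<open>exp (- n B)\<close> when \<open>\<bar>\<psi>\<bar> \<le> B\<close>.
\<close>
lemma ball_measure_lower_bound:
  assumes fixed: "dual_transfer T \<psi> M M" and r: "0 < r"
  shows "\<exists>b>0. \<forall>z. b \<le> prob (ball z r)"
proof -
  obtain B where B: "\<And>x. \<bar>\<psi> x\<bar> \<le> B" using bounded_circle[OF \<psi>_continuous] by blast
  from generating_eventually[OF generating_digit r] obtain n where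
    n: "\<And>x y. itinerary T digit n x = itinerary T digit n y \<Longrightarrow> dist x y < r" by blast
  have "exp (- real n * B) \<le> prob (ball z r)" for z
  proof -
    let ?C = "itinerary T digit n -` {itinerary T digit n z}"
    have C: "?C \<in> sets borel" using label_sets[OF label_words(1)] sets_M by blast
    let ?\<phi> = "indicator ?C :: circle \<Rightarrow> real"
    note pow = dual_transfer_power[OF M_borel_probability fixed, of ?\<phi> 1 n]
    have pow: "(transfer T \<psi> ^^ n) ?\<phi> \<in> borel_measurable borel"
        "\<And>x. \<bar>(transfer T \<psi> ^^ n) ?\<phi> x\<bar> \<le> 1"
        "expectation ((transfer T \<psi> ^^ n) ?\<phi>) = expectation ?\<phi>"
      using pow borel_measurable_indicator[OF C] by auto
    have ge: "exp (- real n * B) \<le> (transfer T \<psi> ^^ n) ?\<phi> w" for w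
    proof -
      obtain y where y: "itinerary T digit n y = itinerary T digit n z" "(T ^^ n) y = w"
        using cylinder_full_image by blast
      have "- real n * B = (\<Sum>j<n. - B)" by simp
      also have "\<dots> \<le> birkhoff_sum T \<psi> n y"
        unfolding birkhoff_sum_def using B by (intro sum_mono) (simp add: abs_le_iff minus_le_iff)
      finally have "exp (- real n * B) \<le> exp (birkhoff_sum T \<psi> n y) * ?\<phi> y" using y by simp
      also have "\<dots> \<le> (\<Sum>y\<in>(T ^^ n) -` {w}. exp (birkhoff_sum T \<psi> n y) * ?\<phi> y)"
        using y transfer_power[of T n w, OF finite_preimages] by (intro member_le_sum) auto
      finally show ?thesis using transfer_power[of T n w \<psi> ?\<phi>, OF finite_preimages] by simp
    qed
    have "exp (- real n * B) = expectation (\<lambda>x. exp (- real n * B))" by (simp add: prob_space)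
    also have "\<dots> \<le> expectation ((transfer T \<psi> ^^ n) ?\<phi>)"
      using ge integrable_bounded_borel[OF M_borel_probability pow(1,2)] by (intro integral_mono) auto
    also have "\<dots> = prob ?C" using pow(3) C sets_M by (simp add: space_UNIV)
    also have "\<dots> \<le> prob (ball z r)"
      using n[of z] sets_M by (intro finite_measure_mono) auto
    finally show ?thesis .
  qed
  then show ?thesis by (intro exI[of _ "exp (- real n * B)"]) simp
qed

text \<open>
  Every point has at most one \<open>n\<close>-th preimage in the dynamical ball, so the iterated operator applied to
  its indicator is a single exponential of a Birkhoff sum on the metric ball of radius \<open>r\<close> around
  \<open>T\<^sup>n x\<close>.
\<close>
lemma dyn_ball_measure_bounds:
  assumes fixed: "dual_transfer T \<psi> M M"
    and shadow: "\<And>z. dist ((T ^^ n) x) z < r \<Longrightarrow> \<exists>y\<in>dyn_ball T x n r. (T ^^ n) y = z"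
    and inj: "inj_on (T ^^ n) (dyn_ball T x n r)"
    and dist: "\<And>y. y \<in> dyn_ball T x n r \<Longrightarrow> \<bar>birkhoff_sum T \<psi> n y - s\<bar> \<le> c"
  shows "exp (s - c) * prob (ball ((T ^^ n) x) r) \<le> prob (dyn_ball T x n r)"
    and "prob (dyn_ball T x n r) \<le> exp (s + c)"
proof -
  let ?D = "dyn_ball T x n r" and ?B = "ball ((T ^^ n) x) r"
  let ?\<phi> = "indicator ?D :: circle \<Rightarrow> real"
  have D: "?D \<in> sets borel" using open_dyn_ball[OF T_continuous] by (rule borel_open)
  note pow = dual_transfer_power[OF M_borel_probability fixed, of ?\<phi> 1 n]
  have pow: "(transfer T \<psi> ^^ n) ?\<phi> \<in> borel_measurable borel"
      "\<And>x. \<bar>(transfer T \<psi> ^^ n) ?\<phi> x\<bar> \<le> 1"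
      "expectation ((transfer T \<psi> ^^ n) ?\<phi>) = expectation ?\<phi>"
    using pow borel_measurable_indicator[OF D] by auto
  have int: "integrable M ((transfer T \<psi> ^^ n) ?\<phi>)"
    by (rule integrable_bounded_borel[OF M_borel_probability pow(1,2)])
  have prob_D: "expectation ?\<phi> = prob ?D" using D sets_M by (simp add: space_UNIV)
  have one_preimage: "(transfer T \<psi> ^^ n) ?\<phi> z = exp (birkhoff_sum T \<psi> n y)"
    if y: "y \<in> ?D" "(T ^^ n) y = z" for y z
  proof -
    have "(T ^^ n) -` {z} \<inter> ?D = {y}" using y inj by (auto simp: inj_on_def)
    then have "(\<Sum>y\<in>(T ^^ n) -` {z}. exp (birkhoff_sum T \<psi> n y) * ?\<phi> y) = (\<Sum>y\<in>{y}. exp (birkhoff_sum T \<psi> n y))"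
      using transfer_power[of T n z, OF finite_preimages]
      by (intro sum.mono_neutral_cong_right) (auto simp: indicator_def y)
    then show ?thesis using transfer_power[of T n z \<psi> ?\<phi>, OF finite_preimages] by simp
  qed
  have lower: "exp (s - c) * indicator ?B z \<le> (transfer T \<psi> ^^ n) ?\<phi> z" for z
  proof (cases "z \<in> ?B")
    case True
    then obtain y where y: "y \<in> ?D" "(T ^^ n) y = z" using shadow by auto
    then show ?thesis using one_preimage[OF y] dist[OF y(1)] True by (simp add: abs_le_iff)
  next
    case False
    then show ?thesis using transfer_power[of T n z \<psi> ?\<phi>, OF finite_preimages] by (simp add: sum_nonneg)
  qed
  have upper: "(transfer T \<psi> ^^ n) ?\<phi> z \<le> exp (s + c)" for z
  proof (cases "\<exists>y\<in>?D. (T ^^ n) y = z")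
    case True
    then obtain y where y: "y \<in> ?D" "(T ^^ n) y = z" by blast
    then show ?thesis using one_preimage[OF y] dist[OF y(1)] by (simp add: abs_le_iff)
  next
    case False
    then have "(\<Sum>y\<in>(T ^^ n) -` {z}. exp (birkhoff_sum T \<psi> n y) * ?\<phi> y) = 0"
      by (intro sum.neutral) (auto simp: indicator_def)
    then show ?thesis using transfer_power[of T n z \<psi> ?\<phi>, OF finite_preimages] by simp
  qed
  have "exp (s - c) * prob ?B = expectation (\<lambda>z. exp (s - c) * indicator ?B z)"
    using sets_M by (simp add: space_UNIV)
  also have "\<dots> \<le> expectation ((transfer T \<psi> ^^ n) ?\<phi>)"
    using lower int sets_M
    by (intro integral_mono integrable_mult_right integrable_real_indicator) (auto simp: less_top[symmetric])
  finally show "exp (s - c) * prob ?B \<le> prob ?D" using pow(3) prob_D by simp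
  have "prob ?D = expectation ((transfer T \<psi> ^^ n) ?\<phi>)" using pow(3) prob_D by simp
  also have "\<dots> \<le> expectation (\<lambda>z. exp (s + c))"
    using upper int by (intro integral_mono) auto
  also have "\<dots> = exp (s + c)" by (simp add: prob_space)
  finally show "prob ?D \<le> exp (s + c)" .
qed

end

lemma C_mod_continuous:
  assumes "\<Omega> \<in> concave_moduli" "\<phi> \<in> C_mod \<Omega>"
  shows "continuous_on UNIV \<phi>"
  unfolding continuous_on_iff
proof safe
  fix x and e :: real assume e: "0 < e"
  obtain C where C: "0 < C" "\<And>x y. \<bar>\<phi> x - \<phi> y\<bar> \<le> C * \<Omega> (dist x y)"
    using assms(2) by (auto simp: C_mod_def)
  have cont: "continuous_on {0..} \<Omega>" and "\<Omega> 0 = 0" using assms(1) by (auto simp: concave_moduli_def)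
  have eC: "0 < e / C" using e C(1) by simp
  have "(0::real) \<in> {0..}" by simp
  with cont eC obtain d where d: "0 < d" "\<forall>t\<in>{0..}. dist t 0 < d \<longrightarrow> dist (\<Omega> t) (\<Omega> 0) < e / C"
    unfolding continuous_on_iff by blast
  have \<Omega>_less: "\<Omega> t < e / C" if "0 \<le> t" "t < d" for t
  proof -
    have "dist (\<Omega> t) (\<Omega> 0) < e / C" using d(2) that by (simp add: dist_real_def)
    then show ?thesis using \<open>\<Omega> 0 = 0\<close> by (simp add: dist_real_def)
  qed
  have "dist (\<phi> y) (\<phi> x) < e" if "dist y x < d" for y
  proof -
    have "C * \<Omega> (dist y x) < e" using \<Omega>_less[OF zero_le_dist that] C(1) by (simp add: field_simps)
    then show ?thesis using C(2)[of y x] by (simp add: dist_real_def)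
  qed
  then show "\<exists>d>0. \<forall>x'\<in>UNIV. dist x' x < d \<longrightarrow> dist (\<phi> x') (\<phi> x) < e"
    using d(1) by blast
qed

lemma integral_scale_measure_real:
  fixes \<phi> :: "'a \<Rightarrow> real"
  assumes "\<phi> \<in> borel_measurable M" "0 \<le> c"
  shows "(\<integral>x. \<phi> x \<partial>scale_measure (ennreal c) M) = c * (\<integral>x. \<phi> x \<partial>M)"
proof -
  have "scale_measure (ennreal c) M = density M (\<lambda>_. ennreal c)"
    by (rule measure_eqI) (simp_all add: emeasure_density_const)
  then show ?thesis using assms by (simp add: integral_density)
qed

text \<open>
  Multiplying by \<open>h\<close> turns an eigenmeasure of the operator for \<open>f\<close> into a fixed measure of
  the operator conjugated by \<open>h\<close>. The hypothesis \<open>\<psi>\<close> says that \<open>\<psi>\<close> is a weight for the conjugated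
  operator; \<open>cohomologous_transfer\<close> supplies it.
\<close>
lemma dual_transfer_eigenfunction:
  assumes \<nu>: "borel_probability \<nu>" and \<kappa>: "0 < \<kappa>" and h: "continuous_on UNIV h" "\<And>x. 0 < h x"
    and dual: "dual_transfer T f \<nu> (scale_measure (ennreal \<kappa>) \<nu>)"
    and int_h: "(\<integral>x. h x \<partial>\<nu>) = 1"
    and \<psi>: "\<And>\<phi> :: circle \<Rightarrow> real. transfer T \<psi> \<phi> = (\<lambda>x. transfer T f (\<lambda>y. h y * \<phi> y) x / (\<kappa> * h x))"
    and meas: "\<And>\<phi> :: circle \<Rightarrow> real. continuous_on UNIV \<phi> \<Longrightarrow> transfer T f \<phi> \<in> borel_measurable borel"
  defines "\<mu> \<equiv> density \<nu> (\<lambda>x. ennreal (h x))"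
  shows "borel_probability \<mu>" "dual_transfer T \<psi> \<mu> \<mu>"
    "\<And>\<phi> :: circle \<Rightarrow> real. \<phi> \<in> borel_measurable borel \<Longrightarrow> (\<integral>x. \<phi> x \<partial>\<mu>) = (\<integral>x. h x * \<phi> x \<partial>\<nu>)"
proof -
  note \<nu>D = borel_probabilityD[OF \<nu>]
  interpret \<nu>: prob_space \<nu> by (rule \<nu>D)
  have meas_cong: "measurable \<nu> borel = measurable borel (borel :: real measure)"
    by (rule measurable_cong_sets) (use \<nu>D in simp_all)
  have h_meas: "h \<in> borel_measurable borel" using h(1) by (rule borel_measurable_continuous_onI)
  show int_\<mu>: "(\<integral>x. \<phi> x \<partial>\<mu>) = (\<integral>x. h x * \<phi> x \<partial>\<nu>)" if "\<phi> \<in> borel_measurable borel" for \<phi> :: "circle \<Rightarrow> real"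
    unfolding \<mu>_def using h(2) that h_meas by (subst integral_density) (auto simp: meas_cong less_imp_le)
  have "emeasure \<mu> (space \<mu>) = (\<integral>\<^sup>+x. ennreal (h x) \<partial>\<nu>)"
  proof -
    have [measurable]: "h \<in> borel_measurable \<nu>" using h_meas by (simp add: meas_cong)
    show ?thesis unfolding \<mu>_def by (subst emeasure_density) (auto simp: \<nu>D)
  qed
  also have "\<dots> = ennreal (\<integral>x. h x \<partial>\<nu>)"
    using h by (intro nn_integral_eq_integral integrable_continuous_circle[OF \<nu>]) (auto simp: less_imp_le)
  also have "\<dots> = 1" by (simp add: int_h)
  finally have "prob_space \<mu>" by (rule prob_spaceI)
  then show "borel_probability \<mu>" by (simp add: borel_probability_def \<mu>_def \<nu>D)
  show "dual_transfer T \<psi> \<mu> \<mu>"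
    unfolding dual_transfer_def
  proof (intro allI impI)
    fix \<phi> :: "circle \<Rightarrow> real" assume \<phi>: "continuous_on UNIV \<phi>"
    have h\<phi>: "continuous_on UNIV (\<lambda>x. h x * \<phi> x)" by (intro continuous_intros h \<phi>)
    have tr_meas: "transfer T \<psi> \<phi> \<in> borel_measurable borel"
      unfolding \<psi> using meas[OF h\<phi>] h_meas by measurable
    have "(\<integral>x. transfer T \<psi> \<phi> x \<partial>\<mu>) = (\<integral>x. h x * transfer T \<psi> \<phi> x \<partial>\<nu>)"
      by (rule int_\<mu>) (rule tr_meas)
    also have "\<dots> = (\<integral>x. transfer T f (\<lambda>y. h y * \<phi> y) x / \<kappa> \<partial>\<nu>)"
      unfolding \<psi> using h(2) by (intro Bochner_Integration.integral_cong refl) (simp add: less_imp_neq[symmetric])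
    also have "\<dots> = (\<integral>x. h x * \<phi> x \<partial>scale_measure (ennreal \<kappa>) \<nu>) / \<kappa>"
      using dual h\<phi> unfolding dual_transfer_def by simp
    also have "\<dots> = (\<integral>x. h x * \<phi> x \<partial>\<nu>)"
      using \<kappa> borel_measurable_continuous_onI[OF h\<phi>]
      by (subst integral_scale_measure_real) (auto simp: meas_cong)
    also have "\<dots> = (\<integral>x. \<phi> x \<partial>\<mu>)"
      by (rule int_\<mu>[symmetric]) (rule borel_measurable_continuous_onI[OF \<phi>])
    finally show "(\<integral>x. \<phi> x \<partial>\<mu>) = (\<integral>x. transfer T \<psi> \<phi> x \<partial>\<mu>)" by simp
  qed
qed

lemma cohomologous_transfer:
  fixes \<phi> :: "circle \<Rightarrow> real"
  assumes "0 < \<kappa>" "\<And>x. 0 < h x"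
  shows "transfer T (\<lambda>y. f y - ln \<kappa> + ln (h y) - ln (h (T y))) \<phi> =
    (\<lambda>x. transfer T f (\<lambda>y. h y * \<phi> y) x / (\<kappa> * h x))"
proof
  fix x
  have "exp (f y - ln \<kappa> + ln (h y) - ln (h (T y))) = exp (f y) * h y / (\<kappa> * h (T y))" for y
    using assms by (simp add: exp_diff exp_add)
  then show "transfer T (\<lambda>y. f y - ln \<kappa> + ln (h y) - ln (h (T y))) \<phi> x =
      transfer T f (\<lambda>y. h y * \<phi> y) x / (\<kappa> * h x)"
    unfolding transfer_def sum_divide_distrib by (intro sum.cong refl) auto
qed

lemma cohomologous_transfer_power:
  fixes \<phi> :: "circle \<Rightarrow> real"
  assumes "0 < \<kappa>" "\<And>x. 0 < h x"
    and \<psi>: "\<And>\<phi> :: circle \<Rightarrow> real. transfer T \<psi> \<phi> = (\<lambda>x. transfer T f (\<lambda>y. h y * \<phi> y) x / (\<kappa> * h x))"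
  shows "(transfer T \<psi> ^^ n) \<phi> = (\<lambda>x. (transfer T f ^^ n) (\<lambda>y. h y * \<phi> y) x / (\<kappa> ^ n * h x))"
proof (induction n)
  case 0
  then show ?case using assms(2) by (simp add: fun_eq_iff less_imp_neq[symmetric])
next
  case (Suc n)
  let ?A = "(transfer T f ^^ n) (\<lambda>y. h y * \<phi> y)"
  have "h y * (?A y / (\<kappa> ^ n * h y)) = ?A y / \<kappa> ^ n" for y
    using assms(2)[of y] by simp
  then have step: "transfer T f (\<lambda>y. h y * (?A y / (\<kappa> ^ n * h y))) x = transfer T f ?A x / \<kappa> ^ n" for x
    by (simp add: transfer_def sum_divide_distrib)
  have "(transfer T \<psi> ^^ Suc n) \<phi> = transfer T \<psi> (\<lambda>x. ?A x / (\<kappa> ^ n * h x))"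
    using Suc by simp
  also have "\<dots> = (\<lambda>x. transfer T f ?A x / \<kappa> ^ n / (\<kappa> * h x))"
    by (simp only: \<psi> step)
  also have "\<dots> = (\<lambda>x. (transfer T f ^^ Suc n) (\<lambda>y. h y * \<phi> y) x / (\<kappa> ^ Suc n * h x))"
    by (simp add: fun_eq_iff ac_simps)
  finally show ?case .
qed

text \<open>
  The coboundary telescopes, so the Birkhoff sums of the two potentials differ by \<open>n c\<close> and a
  term that is bounded when \<open>u\<close> is.
\<close>
lemma birkhoff_sum_cohomologous:
  "birkhoff_sum T (\<lambda>y. f y - c + u y - u (T y)) n x =
    birkhoff_sum T f n x - real n * c + u x - u ((T ^^ n) x)"
proof (induction n arbitrary: x)
  case (Suc n)
  show ?case unfolding birkhoff_sum_Suc Suc by (simp add: funpow_swap1 algebra_simps)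
qed (simp add: birkhoff_sum_def)

section \<open>Gibbs bounds and the equilibrium measure\<close>

text \<open>
  The constant \<open>P\<close> will be the pressure and \<open>u = ln h\<close>. Distortion comes from two sources: the
  Birkhoff sums of \<open>f\<close>, bounded through compatibility by \<open>c\<close>, and the coboundary, bounded by
  \<open>2 B\<close>.
\<close>
lemma (in normalised_system) gibbs_bounds:
  assumes fixed: "dual_transfer T \<psi> M M"
    and \<Omega>: "\<Omega> \<in> concave_moduli" and comp: "compatible T \<omega> \<Omega>" and f: "f \<in> C_mod \<omega>"
    and u: "\<And>x. \<bar>u x\<bar> \<le> B" and \<psi>: "\<psi> = (\<lambda>y. f y - P + u y - u (T y))"
  shows "\<exists>r\<^sub>0>0. \<forall>r. 0 < r \<and> r < r\<^sub>0 \<longrightarrow> (\<exists>K>0. \<forall>x. \<forall>n\<ge>1.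
      inverse K \<le> prob (dyn_ball T x n r) / exp (birkhoff_sum T f n x - real n * P) \<and>
      prob (dyn_ball T x n r) / exp (birkhoff_sum T f n x - real n * P) \<le> K)"
proof -
  obtain \<rho> C where \<rho>: "0 < \<rho>" and C: "0 < C"
    and shadow: "\<And>x y X. dist x y < \<rho> \<Longrightarrow> X \<in> pre_orbits T x \<Longrightarrow>
      \<exists>Y\<in>pre_orbits T y. contracts_along \<omega> \<Omega> C X Y"
    using comp unfolding compatible_def by (metis (no_types, lifting))
  obtain r\<^sub>1 where r\<^sub>1: "0 < r\<^sub>1" "\<And>v w. dist v w < r\<^sub>1 \<Longrightarrow> T v = T w \<Longrightarrow> v = w"
    using locally_injective by blast
  obtain L where L: "0 < L" "\<And>x y. \<bar>f x - f y\<bar> \<le> L * \<omega> (dist x y)"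
    using f by (auto simp: C_mod_def)
  have \<Omega>_nonneg: "0 \<le> \<Omega> t" if "0 \<le> t" for t using \<Omega> that by (auto simp: concave_moduli_def)
  have \<Omega>_le: "\<Omega> (dist v w) \<le> \<Omega> 1" for v w :: circle
    using \<Omega> dist_circle_le_1[of v w] by (auto simp: concave_moduli_def intro: mono_onD)
  define c where "c = L * (\<Omega> 1 / C)"
  have c: "0 \<le> c" using L C \<Omega>_nonneg[of 1] by (simp add: c_def)
  have S\<psi>: "birkhoff_sum T \<psi> n x = birkhoff_sum T f n x - real n * P + u x - u ((T ^^ n) x)" for n x
    unfolding \<psi> by (rule birkhoff_sum_cohomologous)
  have B: "0 \<le> B" using u[of undefined] by linarith
  show ?thesis
  proof (rule exI[of _ "min \<rho> (r\<^sub>1 / 2)"], intro conjI allI impI)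
    show "0 < min \<rho> (r\<^sub>1 / 2)" using \<rho> r\<^sub>1 by simp
    fix r assume r: "0 < r \<and> r < min \<rho> (r\<^sub>1 / 2)"
    obtain b where b: "0 < b" "\<And>z. b \<le> prob (ball z r)"
      using ball_measure_lower_bound[OF fixed] r by blast
    \<comment> \<open>This lets the single constant \<open>K\<close> serve for the upper bound as well.\<close>
    have b1: "b \<le> 1" using b(2)[of undefined] by (rule order.trans) simp
    define d where "d = c + 2 * B"
    define K where "K = exp d / b"
    have K: "0 < K" using b by (simp add: K_def)
    have "inverse K \<le> prob (dyn_ball T x n r) / exp (birkhoff_sum T f n x - real n * P) \<and>
        prob (dyn_ball T x n r) / exp (birkhoff_sum T f n x - real n * P) \<le> K" if n: "1 \<le> n" for x n
    proof -
      let ?S = "birkhoff_sum T f n x - real n * P"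
      have shadow': "\<exists>y\<in>dyn_ball T x n r. (T ^^ n) y = z \<and>
          C * (\<Sum>j<n. \<omega> (dist ((T ^^ j) x) ((T ^^ j) y))) \<le> \<Omega> (dist ((T ^^ n) x) z)"
        if "dist ((T ^^ n) x) z < r" for z
        by (rule shadowing_preimage[OF shadow C \<Omega>_nonneg _ n that]) (use r in auto)
      have inj: "inj_on (T ^^ n) (dyn_ball T x n r)"
      proof (rule inj_onI)
        fix y y' assume "y \<in> dyn_ball T x n r" "y' \<in> dyn_ball T x n r" "(T ^^ n) y = (T ^^ n) y'"
        moreover have "2 * r \<le> r\<^sub>1" using r by simp
        ultimately show "y = y'" using dyn_ball_injective[of r\<^sub>1 r, OF r\<^sub>1(2)] by blast
      qed
      have dist: "\<bar>birkhoff_sum T \<psi> n y - ?S\<bar> \<le> d" if y: "y \<in> dyn_ball T x n r" for y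
      proof -
        have "dist ((T ^^ n) x) ((T ^^ n) y) < r" using y by (simp add: dyn_ball_def)
        from shadow'[OF this] obtain y' where y': "y' \<in> dyn_ball T x n r" "(T ^^ n) y' = (T ^^ n) y"
          "C * (\<Sum>j<n. \<omega> (dist ((T ^^ j) x) ((T ^^ j) y'))) \<le> \<Omega> (dist ((T ^^ n) x) ((T ^^ n) y))"
          by blast
        have "y' = y" using inj y y' by (auto dest: inj_onD)
        then have sum_le: "(\<Sum>j<n. \<omega> (dist ((T ^^ j) x) ((T ^^ j) y))) \<le> \<Omega> 1 / C"
          using y'(3) \<Omega>_le[of "(T ^^ n) x" "(T ^^ n) y"] C by (simp add: field_simps)
        have "\<bar>birkhoff_sum T f n x - birkhoff_sum T f n y\<bar> \<le>
            (\<Sum>j<n. \<bar>f ((T ^^ j) x) - f ((T ^^ j) y)\<bar>)"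
          unfolding birkhoff_sum_def sum_subtractf[symmetric] by (rule sum_abs)
        also have "\<dots> \<le> (\<Sum>j<n. L * \<omega> (dist ((T ^^ j) x) ((T ^^ j) y)))"
          by (intro sum_mono L)
        also have "\<dots> \<le> c"
          using sum_le L unfolding c_def sum_distrib_left[symmetric] by (intro mult_left_mono) auto
        finally show ?thesis unfolding S\<psi> d_def using u[of y] u[of "(T ^^ n) y"] by linarith
      qed
      note bounds = dyn_ball_measure_bounds[OF fixed _ inj dist]
      have "exp (?S - d) * b \<le> exp (?S - d) * prob (ball ((T ^^ n) x) r)"
        using b(2) by (intro mult_left_mono) auto
      also have "\<dots> \<le> prob (dyn_ball T x n r)"
        by (rule bounds(1)) (use shadow' in blast)+
      finally have "exp (?S - d) * b / exp ?S \<le> prob (dyn_ball T x n r) / exp ?S"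
        by (rule divide_right_mono) simp
      moreover have "exp (?S - d) * b / exp ?S = inverse K"
        by (simp add: K_def exp_diff[of ?S d])
      moreover have "prob (dyn_ball T x n r) \<le> exp (?S + d)"
        by (rule bounds(2)) (use shadow' in blast)+
      then have "prob (dyn_ball T x n r) / exp ?S \<le> exp (?S + d) / exp ?S"
        by (rule divide_right_mono) simp
      moreover have "exp (?S + d) / exp ?S = exp d * 1" by (simp add: exp_add[of ?S d])
      moreover have "exp d * 1 \<le> exp d * (1 / b)"
        using b b1 by (intro mult_left_mono) auto
      ultimately show ?thesis by (simp add: K_def)
    qed
    then show "\<exists>K>0. \<forall>x. \<forall>n\<ge>1.
        inverse K \<le> prob (dyn_ball T x n r) / exp (birkhoff_sum T f n x - real n * P) \<and>
        prob (dyn_ball T x n r) / exp (birkhoff_sum T f n x - real n * P) \<le> K"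
      using K by blast
  qed
qed

theorem theorem3:
  fixes T :: "circle \<Rightarrow> circle" and \<omega> \<Omega> :: "real \<Rightarrow> real" and f h :: "circle \<Rightarrow> real"
    and \<kappa> :: real and \<nu> :: "circle measure"
  assumes "T \<in> map_family"
    and "\<omega> \<in> concave_moduli" and "\<Omega> \<in> concave_moduli"
    and "compatible T \<omega> \<Omega>"
    and "f \<in> C_mod \<omega>"
    and "RPF_data T \<Omega> f \<kappa> \<nu> h"
  defines "\<mu> \<equiv> density \<nu> (\<lambda>x. ennreal (h x))"
  shows "\<mu> \<in> invariant_measures T \<and>
    KS_entropy \<mu> T + ereal (\<integral>x. f x \<partial>\<mu>) = ereal (ln \<kappa>) \<and>
    ereal (ln \<kappa>) = pressure T f \<and>
    (\<forall>m\<in>invariant_measures T. m \<noteq> \<mu> \<longrightarrow>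
       pressure T f > KS_entropy m T + ereal (\<integral>x. f x \<partial>m)) \<and>
    (\<forall>m. equilibrium_measure T f m \<longleftrightarrow> m = \<mu>) \<and>
    gibbs_measure T f \<mu>"
proof -
  obtain \<tau> digit N where "full_branch_map T \<tau> digit N"
    using map_family_full_branch[OF assms(1)] by blast
  then interpret full_branch_map T \<tau> digit N .
  have \<kappa>: "0 < \<kappa>" and \<nu>: "borel_probability \<nu>" and h: "h \<in> C_mod \<Omega>" "\<And>x. 0 < h x"
    and dual: "dual_transfer T f \<nu> (scale_measure (ennreal \<kappa>) \<nu>)"
    and eigen: "transfer T f h = (\<lambda>x. \<kappa> * h x)" and int_h: "(\<integral>x. h x \<partial>\<nu>) = 1"
    and conv: "\<And>\<phi> :: circle \<Rightarrow> real. continuous_on UNIV \<phi> \<Longrightarrow>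
        uniform_limit UNIV (\<lambda>n x. (transfer T f ^^ n) \<phi> x / \<kappa> ^ n) (\<lambda>x. h x * (\<integral>y. \<phi> y \<partial>\<nu>)) sequentially"
    using assms(6) unfolding RPF_data_def by blast+
  have f_cont: "continuous_on UNIV f" using assms(2,5) by (rule C_mod_continuous)
  have h_cont: "continuous_on UNIV h" using assms(3) h(1) by (rule C_mod_continuous)
  define u where "u x = ln (h x)" for x
  have u_cont: "continuous_on UNIV u"
    unfolding u_def using h_cont h(2) by (intro continuous_on_ln) (auto simp: less_imp_neq[symmetric])
  have uT_cont: "continuous_on UNIV (\<lambda>x. u (T x))"
    using continuous_on_compose2[OF u_cont T_continuous] by simp
  \<comment> \<open>The normalised potential. The coboundary \<open>u - u \<circ> T\<close> is invisible to invariant measures.\<close>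
  define \<psi> where "\<psi> = (\<lambda>y. f y - ln \<kappa> + u y - u (T y))"
  have \<psi>_transfer: "transfer T \<psi> \<phi> = (\<lambda>x. transfer T f (\<lambda>y. h y * \<phi> y) x / (\<kappa> * h x))" for \<phi> :: "circle \<Rightarrow> real"
    unfolding \<psi>_def u_def using \<kappa> h(2) by (rule cohomologous_transfer)
  interpret normalised_potential T \<tau> digit N \<psi>
  proof
    show "continuous_on UNIV \<psi>"
      unfolding \<psi>_def by (intro continuous_intros f_cont u_cont uT_cont)
    show "transfer T \<psi> (\<lambda>_. 1) x = (1::real)" for x
      using \<kappa> h(2)[of x] by (simp add: \<psi>_transfer eigen)
  qed
  have f_meas: "f \<in> borel_measurable borel" using f_cont by (rule borel_measurable_continuous_onI)
  have tr_meas: "transfer T f \<phi> \<in> borel_measurable borel" if "continuous_on UNIV \<phi>" for \<phi> :: "circle \<Rightarrow> real"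
    using f_meas borel_measurable_continuous_onI[OF that] by (rule transfer_measurable)
  note \<mu> = dual_transfer_eigenfunction[OF \<nu> \<kappa> h_cont h(2) dual int_h \<psi>_transfer tr_meas, folded \<mu>_def]
  have \<mu>_inv: "\<mu> \<in> invariant_measures T"
    using \<mu>(1,2) by (rule dual_transfer_invariant)
  have power_conv: "(\<lambda>n. (transfer T \<psi> ^^ n) \<phi> x) \<longlonglongrightarrow> (\<integral>y. h y * \<phi> y \<partial>\<nu>)"
    if "continuous_on UNIV \<phi>" for \<phi> :: "circle \<Rightarrow> real" and x
  proof -
    have "continuous_on UNIV (\<lambda>y. h y * \<phi> y)" by (intro continuous_intros h_cont that)
    from tendsto_uniform_limitI[OF conv[OF this] UNIV_I]
    have "(\<lambda>n. (transfer T f ^^ n) (\<lambda>y. h y * \<phi> y) x / \<kappa> ^ n / h x) \<longlonglongrightarrow> h x * (\<integral>y. h y * \<phi> y \<partial>\<nu>) / h x"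
      by (intro tendsto_divide tendsto_const) (use h(2)[of x] in auto)
    then show ?thesis
      using h(2)[of x] by (simp add: cohomologous_transfer_power[OF \<kappa> h(2) \<psi>_transfer])
  qed
  have system: "normalised_system T \<tau> digit N \<psi> m" if "m \<in> invariant_measures T" for m
    using invariant_measuresD[OF that] normalised_potential_axioms
    by (intro normalised_system.intro normalised_system_axioms.intro)
  \<comment> \<open>The variational principle for \<open>f\<close>, with its equality case, is that for \<open>\<psi>\<close> shifted by \<open>ln \<kappa>\<close>.\<close>
  have free_energy: "KS_entropy m T + ereal (\<integral>x. f x \<partial>m) \<le> ereal (ln \<kappa>) \<and>
      (KS_entropy m T + ereal (\<integral>x. f x \<partial>m) = ereal (ln \<kappa>) \<longleftrightarrow> dual_transfer T \<psi> m m)"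
    if m: "m \<in> invariant_measures T" for m
  proof -
    interpret m: normalised_system T \<tau> digit N \<psi> m using m by (rule system)
    note int = integrable_continuous_circle[OF m.M_borel_probability]
    have "u \<in> borel_measurable m"
      using borel_measurable_continuous_onI[OF u_cont] by (simp cong: measurable_cong_sets add: m.sets_M)
    then have "(\<integral>x. u (T x) \<partial>m) = (\<integral>x. u x \<partial>m)"
      using integral_distr[OF m.T_measurable, of u] by (simp add: m.T_invariant)
    then have "(\<integral>x. \<psi> x \<partial>m) = (\<integral>x. f x \<partial>m) - ln \<kappa>"
      unfolding \<psi>_def using int[OF f_cont] int[OF u_cont] int[OF uT_cont]
      by (simp add: m.prob_space)
    then have KS: "KS_entropy m T + ereal (\<integral>x. f x \<partial>m) = ereal (m.entropy_rate digit + (\<integral>x. \<psi> x \<partial>m) + ln \<kappa>)"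
      by (simp add: KS_entropy_generator[OF m m.label_dig generating_digit])
    show ?thesis
      unfolding KS using m.entropy_rate_le m.dual_transfer_of_maximal m.maximal_of_dual_transfer by auto
  qed
  have unique: "dual_transfer T \<psi> m m \<longleftrightarrow> m = \<mu>" if m: "m \<in> invariant_measures T" for m
    using dual_transfer_unique[OF _ _ \<mu>(1,2) power_conv, of m] \<mu>(2) m
    by (auto simp: invariant_measures_def)
  have energy_\<mu>: "KS_entropy \<mu> T + ereal (\<integral>x. f x \<partial>\<mu>) = ereal (ln \<kappa>)"
    using free_energy[OF \<mu>_inv] \<mu>(2) by simp
  have pressure: "pressure T f = ereal (ln \<kappa>)"
    unfolding pressure_def
  proof (rule antisym)
    show "(SUP m\<in>invariant_measures T. KS_entropy m T + ereal (\<integral>x. f x \<partial>m)) \<le> ereal (ln \<kappa>)"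
      using free_energy by (intro SUP_least) blast
    show "ereal (ln \<kappa>) \<le> (SUP m\<in>invariant_measures T. KS_entropy m T + ereal (\<integral>x. f x \<partial>m))"
      unfolding energy_\<mu>[symmetric] using \<mu>_inv by (rule SUP_upper)
  qed
  have strict: "KS_entropy m T + ereal (\<integral>x. f x \<partial>m) < pressure T f"
    if "m \<in> invariant_measures T" "m \<noteq> \<mu>" for m
    using free_energy[OF that(1)] unique[OF that(1)] that(2) unfolding pressure by (simp add: less_le)
  have equilibrium: "equilibrium_measure T f m \<longleftrightarrow> m = \<mu>" for m
    using strict[of m] \<mu>_inv energy_\<mu> pressure unfolding equilibrium_measure_def
    by (cases "m = \<mu>") auto
  have gibbs: "gibbs_measure T f \<mu>"
  proof -
    interpret \<mu>: normalised_system T \<tau> digit N \<psi> \<mu> using \<mu>_inv by (rule system)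
    obtain B where "\<And>x. \<bar>u x\<bar> \<le> B" using bounded_circle[OF u_cont] by blast
    from \<mu>.gibbs_bounds[OF \<mu>(2) assms(3,4,5) this \<psi>_def]
    show ?thesis unfolding gibbs_measure_def pressure Let_def by simp
  qed
  show ?thesis
    using \<mu>_inv energy_\<mu> pressure strict equilibrium gibbs by simp
qed

end
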